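(* Let $(M,g,Q,P)$ be a super-null Riemannian manifold. Then the super-null Lie algebra $\mathfrak{snull}(M,g,Q,P)$ is a finite-dimensional Lie superalgebra.
   Context: Supermanifolds are real, finite-dimensional, in the Berezin–Leites (locally ringed space) sense, $M=(|M|,\mathcal{O}_M)$; $C^\infty(M)$ is the superalgebra of global functions, $\mathrm{Vect}(M)$ the $C^\infty(M)$-module of vector fields, $\widetilde{\cdot}$ denotes $\mathbb{Z}_2$-parity, and $[X,Y]=XY-(-1)^{\widetilde X\widetilde Y}YX$ is the graded commutator. A metric $g$ on $M$ is an even, graded-symmetric, rank 2 covariant tensor, possibly degenerate; it determines a pairing $\langle X|Y\rangle$ with $\widetilde{\langle X|Y\rangle}=\widetilde X+\widetilde Y$, $\langle X|Y\rangle=(-1)^{\widetilde X\widetilde Y}\langle Y|X\rangle$, $\langle fX+Y|Z\rangle=f\langle X|Z\rangle+\langle Y|Z\rangle$. Its kernel is $\ker(g)=\{X\in\mathrm{Vect}(M) : \langle X|Y\rangle=0\ \text{for all } Y\in\mathrm{Vect}(M)\}$; $g$ is degenerate if $\ker(g)\neq\{0\}$. The Lie derivative of $g$ is $(\mathcal{L}_Xg)(Y,Z)=X\langle Y|Z\rangle-\langle[X,Y]|Z\rangle-(-1)^{\widetilde X\widetilde Y}\langle Y|[X,Z]\rangle$. A super-null Riemannian manifold is a quadruple $(M,g,Q,P)$ where $M$ is a supermanifold of dimension $n|1$ ($n\ge 1$), $g$ is a degenerate (even) metric on $M$, $Q\in\mathrm{Vect}(M)$ is a non-singular odd vector field (i.e.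 its value in $T_mM$ is nonzero at every point $m\in|M|$) with $[Q,Q]=2P$ for an even vector field $P$, and $\ker(g)=\mathrm{Span}\{Q\}$ (the $C^\infty(M)$-span). It is part of the setting that the rank of the kernel is constant, equal to $0|1$ (at every point $m\in |M|$ the bilinear form induced by $g$ on $T_mM$ has kernel of dimension $0|1$), and that around every point of $|M|$ there are Shander coordinates $(x^a,t,\tau)$, with $x^a,t$ even and $\tau$ odd, in which $Q=\partial_\tau+\tau\partial_t$ and $P=\partial_t$. The super-null Lie algebra $\mathfrak{snull}(M,g,Q,P)$ is the Lie superalgebra of vector fields $X\in\mathrm{Vect}(M)$ with $\mathcal{L}_Xg=0$ and $\mathcal{L}_XQ=[X,Q]=0$.
   Formalization: The underlying space |M| is assumed to have finitely many connected components; without this the claim fails, e.g. for a countable disjoint union of copies of R^{1|1}, where all fields cP with c locally constant lie in snull(M,g,Q,P). *)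

theory Defs
  imports
    "HOL-Analysis.Analysis"
    "HOL-Library.Z2"
    "Jordan_Normal_Form.Missing_VectorSpace"
begin

section \<open>Super linear algebra\<close>

text \<open>Parities are elements of the two-element field \<^typ>\<open>bit\<close>.\<close>

definition koszul :: "bit \<Rightarrow> bit \<Rightarrow> real" where
  "koszul p q = (if p * q = 1 then - 1 else 1)"

definition real_ring :: "real ring" where
  "real_ring = \<lparr>carrier = UNIV, mult = (*), one = 1, zero = 0, add = (+)\<rparr>"

record 'a super_module = "(real, 'a) module" +
  grade :: "bit \<Rightarrow> 'a set"

record 'a super_bracket = "'a super_module" +
  bracket :: "'a \<Rightarrow> 'a \<Rightarrow> 'a"

locale super_vector_space = vectorspace real_ring V
  for V :: "('a, 'z) super_module_scheme" (structure) +
  assumes grade_subspace: "subspace real_ring (grade V p) V"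
    and grade_decomp: "x \<in> carrier V \<Longrightarrow>
      \<exists>!(u, w). u \<in> grade V 0 \<and> w \<in> grade V 1 \<and> x = u \<oplus> w"

definition component :: "('a, 'z) super_module_scheme \<Rightarrow> bit \<Rightarrow> 'a \<Rightarrow> 'a" where
  "component V p x = (THE u. u \<in> grade V p \<and> (\<exists>w \<in> grade V (p + 1). x = u \<oplus>\<^bsub>V\<^esub> w))"

definition graded_piece :: "('a, 'z) super_module_scheme \<Rightarrow> bit \<Rightarrow> ('a, 'z) super_module_scheme" where
  "graded_piece V p = V\<lparr>carrier := grade V p \<inter> carrier V\<rparr>"

text \<open>The finiteness clause is needed because \<^const>\<open>vectorspace.dim\<close> is unspecified
  on infinite-dimensional spaces.\<close>

definition has_superdim :: "('a, 'z) super_module_scheme \<Rightarrow> nat \<Rightarrow> nat \<Rightarrow> bool" where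
  "has_superdim V r s \<longleftrightarrow>
     (\<forall>p. vectorspace.fin_dim real_ring (graded_piece V p)) \<and>
     vectorspace.dim real_ring (graded_piece V 0) = r \<and>
     vectorspace.dim real_ring (graded_piece V 1) = s"

locale superalgebra = super_vector_space A + ring A
  for A :: "('a, 'z) super_module_scheme" (structure) +
  assumes smult_mult_left: "x \<in> carrier A \<Longrightarrow> y \<in> carrier A \<Longrightarrow> (c \<odot> x) \<otimes> y = c \<odot> (x \<otimes> y)"
    and smult_mult_right: "x \<in> carrier A \<Longrightarrow> y \<in> carrier A \<Longrightarrow> x \<otimes> (c \<odot> y) = c \<odot> (x \<otimes> y)"
    and one_even: "\<one> \<in> grade A 0"
    and mult_grade: "x \<in> grade A p \<Longrightarrow> y \<in> grade A q \<Longrightarrow> x \<otimes> y \<in> grade A (p + q)"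

locale comm_superalgebra = superalgebra +
  assumes supercomm: "x \<in> grade A p \<Longrightarrow> y \<in> grade A q \<Longrightarrow> x \<otimes> y = koszul p q \<odot> (y \<otimes> x)"

definition superalgebra_hom ::
    "('a, 'y) super_module_scheme \<Rightarrow> ('b, 'z) super_module_scheme \<Rightarrow> ('a \<Rightarrow> 'b) set" where
  "superalgebra_hom A B = {h \<in> ring_hom A B.
     (\<forall>c. \<forall>x \<in> carrier A. h (c \<odot>\<^bsub>A\<^esub> x) = c \<odot>\<^bsub>B\<^esub> h x) \<and>
     (\<forall>p. \<forall>x \<in> grade A p. h x \<in> grade B p)}"

locale lie_superalgebra = super_vector_space L
  for L :: "('a, 'z) super_bracket_scheme" (structure) +
  assumes bracket_closed: "x \<in> carrier L \<Longrightarrow> y \<in> carrier L \<Longrightarrow> bracket L x y \<in> carrier L"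
    and bracket_add_left: "x \<in> carrier L \<Longrightarrow> y \<in> carrier L \<Longrightarrow> z \<in> carrier L \<Longrightarrow>
      bracket L (x \<oplus> y) z = bracket L x z \<oplus> bracket L y z"
    and bracket_add_right: "x \<in> carrier L \<Longrightarrow> y \<in> carrier L \<Longrightarrow> z \<in> carrier L \<Longrightarrow>
      bracket L z (x \<oplus> y) = bracket L z x \<oplus> bracket L z y"
    and bracket_smult_left: "x \<in> carrier L \<Longrightarrow> y \<in> carrier L \<Longrightarrow>
      bracket L (c \<odot> x) y = c \<odot> bracket L x y"
    and bracket_smult_right: "x \<in> carrier L \<Longrightarrow> y \<in> carrier L \<Longrightarrow>
      bracket L x (c \<odot> y) = c \<odot> bracket L x y"
    and bracket_grade: "x \<in> grade L p \<Longrightarrow> y \<in> grade L q \<Longrightarrow> bracket L x y \<in> grade L (p + q)"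
    and bracket_antisym: "x \<in> grade L p \<Longrightarrow> y \<in> grade L q \<Longrightarrow>
      bracket L x y = \<ominus> (koszul p q \<odot> bracket L y x)"
    and jacobi: "x \<in> grade L p \<Longrightarrow> y \<in> grade L q \<Longrightarrow> z \<in> grade L r \<Longrightarrow>
      bracket L x (bracket L y z) =
        bracket L (bracket L x y) z \<oplus> koszul p q \<odot> bracket L y (bracket L x z)"


section \<open>Superringed spaces\<close>

text \<open>A presheaf \<open>(|M|, \<O>)\<close>: \<open>sect M U\<close> is \<open>\<O>(U)\<close> and \<open>restr M U V\<close> the restriction
  \<open>\<O>(U) \<rightarrow> \<O>(V)\<close>; both are relevant for open sets only.\<close>

record ('p, 'f) superspace =
  points :: "'p topology"
  sect :: "'p set \<Rightarrow> 'f super_module"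
  restr :: "'p set \<Rightarrow> 'p set \<Rightarrow> 'f \<Rightarrow> 'f"

locale superringed_space =
  fixes M :: "('p, 'f) superspace"
  assumes sect_superalgebra: "openin (points M) U \<Longrightarrow> comm_superalgebra (sect M U)"
    and restr_hom: "openin (points M) U \<Longrightarrow> openin (points M) V \<Longrightarrow> V \<subseteq> U \<Longrightarrow>
      restr M U V \<in> superalgebra_hom (sect M U) (sect M V)"
    and restr_id: "openin (points M) U \<Longrightarrow> f \<in> carrier (sect M U) \<Longrightarrow> restr M U U f = f"
    and restr_comp: "openin (points M) U \<Longrightarrow> openin (points M) V \<Longrightarrow> openin (points M) W \<Longrightarrow>
      W \<subseteq> V \<Longrightarrow> V \<subseteq> U \<Longrightarrow> f \<in> carrier (sect M U) \<Longrightarrow>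
      restr M V W (restr M U V f) = restr M U W f"
    and gluing: "(\<And>U. U \<in> \<U> \<Longrightarrow> openin (points M) U) \<Longrightarrow>
      (\<And>U. U \<in> \<U> \<Longrightarrow> s U \<in> carrier (sect M U)) \<Longrightarrow>
      (\<And>U V. U \<in> \<U> \<Longrightarrow> V \<in> \<U> \<Longrightarrow>
        restr M U (U \<inter> V) (s U) = restr M V (U \<inter> V) (s V)) \<Longrightarrow>
      \<exists>!f. f \<in> carrier (sect M (\<Union>\<U>)) \<and> (\<forall>U \<in> \<U>. restr M (\<Union>\<U>) U f = s U)"

definition open_subspace :: "('p, 'f) superspace \<Rightarrow> 'p set \<Rightarrow> ('p, 'f) superspace" where
  "open_subspace M U = M\<lparr>points := subtopology (points M) U\<rparr>"

text \<open>An isomorphism is a homeomorphism \<open>\<phi>\<close> of the underlying spaces together with natural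
  isomorphisms \<open>\<Phi> V : \<O>\<^sub>M(V) \<rightarrow> \<O>\<^sub>N(\<phi>(V))\<close> (inverse to the pullbacks along \<open>\<phi>\<close>).\<close>

definition superspace_iso ::
    "('p, 'f) superspace \<Rightarrow> ('r, 'h) superspace \<Rightarrow> ('p \<Rightarrow> 'r) \<Rightarrow> ('p set \<Rightarrow> 'f \<Rightarrow> 'h) \<Rightarrow> bool" where
  "superspace_iso M N \<phi> \<Phi> \<longleftrightarrow>
     homeomorphic_map (points M) (points N) \<phi> \<and>
     (\<forall>V. openin (points M) V \<longrightarrow>
        \<Phi> V \<in> superalgebra_hom (sect M V) (sect N (\<phi> ` V)) \<and>
        bij_betw (\<Phi> V) (carrier (sect M V)) (carrier (sect N (\<phi> ` V)))) \<and>
     (\<forall>V V'. openin (points M) V \<and> openin (points M) V' \<and> V' \<subseteq> V \<longrightarrow>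
        (\<forall>f \<in> carrier (sect M V).
           \<Phi> V' (restr M V V' f) = restr N (\<phi> ` V) (\<phi> ` V') (\<Phi> V f)))"


section \<open>Superdomains\<close>

definition partial :: "'n::finite \<Rightarrow> (real^'n \<Rightarrow> real) \<Rightarrow> real^'n \<Rightarrow> real" where
  "partial i f x = frechet_derivative f (at x) (axis i 1)"

primrec Ck_on :: "nat \<Rightarrow> (real^'n) set \<Rightarrow> (real^'n::finite \<Rightarrow> real) \<Rightarrow> bool" where
  "Ck_on 0 U f \<longleftrightarrow> continuous_on U f"
| "Ck_on (Suc k) U f \<longleftrightarrow> (\<forall>x \<in> U. f differentiable at x) \<and> (\<forall>i. Ck_on k U (partial i f))"

definition smooth_on :: "(real^'n::finite) set \<Rightarrow> (real^'n \<Rightarrow> real) \<Rightarrow> bool" where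
  "smooth_on U f \<longleftrightarrow> (\<forall>k. Ck_on k U f)"

text \<open>A section \<open>\<Sum>\<^sub>I F\<^sub>I(x) \<tau>\<^sup>I\<close> of \<open>C\<^sup>\<infinity>(U) \<otimes> \<Lambda>(\<tau>\<^sub>0, \<dots>, \<tau>\<^sub>q\<^sub>-\<^sub>1)\<close> is stored as its coefficient family,
  with \<open>\<tau>\<^sup>I\<close> the product of the \<open>\<tau>\<^sub>i\<close>, \<open>i \<in> I\<close>, in increasing order. Coefficients are
  extended by zero off \<open>U\<close> so that a section is determined by its values on \<open>U\<close>.\<close>

type_synonym 'n superfun = "nat set \<Rightarrow> real^'n \<Rightarrow> real"

definition superfuns :: "nat \<Rightarrow> (real^'n::finite) set \<Rightarrow> 'n superfun set" where
  "superfuns q U = {F. (\<forall>I. smooth_on U (F I)) \<and> (\<forall>I x. \<not> (I \<subseteq> {..<q} \<and> x \<in> U) \<longrightarrow> F I x = 0)}"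

text \<open>\<open>\<tau>\<^sup>I \<tau>\<^sup>J = shuffle_sign I J \<tau>\<^sup>I\<^sup>\<union>\<^sup>J\<close> for disjoint \<open>I\<close>, \<open>J\<close>.\<close>

definition shuffle_sign :: "nat set \<Rightarrow> nat set \<Rightarrow> real" where
  "shuffle_sign I J = (- 1) ^ card {(i, j). i \<in> I \<and> j \<in> J \<and> j < i}"

definition superfun_algebra :: "nat \<Rightarrow> (real^'n::finite) set \<Rightarrow> 'n superfun super_module" where
  "superfun_algebra q U = \<lparr>
     carrier = superfuns q U,
     mult = (\<lambda>F G K x. \<Sum>I \<in> Pow K. shuffle_sign I (K - I) * F I x * G (K - I) x),
     one = (\<lambda>I x. if I = {} \<and> x \<in> U then 1 else 0),
     zero = (\<lambda>I x. 0),
     add = (\<lambda>F G I x. F I x + G I x),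
     smult = (\<lambda>c F I x. c * F I x),
     grade = (\<lambda>p. {F \<in> superfuns q U. \<forall>I x. F I x \<noteq> 0 \<longrightarrow> of_nat (card I) = p})\<rparr>"

definition superdomain :: "nat \<Rightarrow> (real^'n::finite) set \<Rightarrow> (real^'n, 'n superfun) superspace" where
  "superdomain q W = \<lparr>
     points = top_of_set W,
     sect = superfun_algebra q,
     restr = (\<lambda>U V F I x. if x \<in> V then F I x else 0)\<rparr>"

definition even_partial :: "(real^'n::finite) set \<Rightarrow> 'n \<Rightarrow> 'n superfun \<Rightarrow> 'n superfun" where
  "even_partial U k F = (\<lambda>I x. if x \<in> U then partial k (F I) x else 0)"

text \<open>The left derivative \<open>\<partial>/\<partial>\<tau>\<^sub>j\<close>.\<close>

definition odd_partial :: "nat \<Rightarrow> 'n::finite superfun \<Rightarrow> 'n superfun" where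
  "odd_partial j F = (\<lambda>I x. if j \<in> I then 0 else (- 1) ^ card {i \<in> I. i < j} * F (insert j I) x)"

definition odd_coord :: "(real^'n::finite) set \<Rightarrow> nat \<Rightarrow> 'n superfun" where
  "odd_coord U j = (\<lambda>I x. if I = {j} \<and> x \<in> U then 1 else 0)"


section \<open>Supermanifolds\<close>

definition chart :: "('p, 'f) superspace \<Rightarrow> nat \<Rightarrow> 'p set \<Rightarrow> (real^'n::finite) set \<Rightarrow>
    ('p \<Rightarrow> real^'n) \<Rightarrow> ('p set \<Rightarrow> 'f \<Rightarrow> 'n superfun) \<Rightarrow> bool" where
  "chart M q U W \<phi> \<Phi> \<longleftrightarrow> openin (points M) U \<and> open W \<and>
     superspace_iso (open_subspace M U) (superdomain q W) \<phi> \<Phi>"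

text \<open>A supermanifold of dimension \<open>n|q\<close>; the even dimension \<open>n \<ge> 1\<close> is the cardinality of the
  index type \<open>'n\<close>. Locality of the stalks is inherited from the charts.\<close>

locale supermanifold = superringed_space M
  for n :: "'n::finite itself" and q :: nat and M :: "('p, 'f) superspace" +
  assumes hausdorff: "Hausdorff_space (points M)"
    and second_countable: "second_countable (points M)"
    and charts: "m \<in> topspace (points M) \<Longrightarrow>
      \<exists>U (W :: (real^'n) set) \<phi> \<Phi>. m \<in> U \<and> chart M q U W \<phi> \<Phi>"

definition Cinf :: "('p, 'f) superspace \<Rightarrow> 'f super_module" where
  "Cinf M = sect M (topspace (points M))"

text \<open>The value at \<open>m\<close> of a global function \<open>f\<close> is the image of its germ in the residue field \<open>\<real>\<close>
  of the stalk: the unique real \<open>r\<close> for which the germ of \<open>f - r\<close> is not invertible.\<close>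

definition fun_value :: "('p, 'f) superspace \<Rightarrow> 'p \<Rightarrow> 'f \<Rightarrow> real" where
  "fun_value M m f = (THE r. \<forall>V. openin (points M) V \<and> m \<in> V \<longrightarrow>
     restr M (topspace (points M)) V (f \<ominus>\<^bsub>Cinf M\<^esub> r \<odot>\<^bsub>Cinf M\<^esub> \<one>\<^bsub>Cinf M\<^esub>) \<notin> Units (sect M V))"


section \<open>Vector fields\<close>

text \<open>Superderivations of parity \<open>p\<close>; they are made extensional so that equality of derivations
  is equality of functions.\<close>

definition derivations :: "('f, 'z) super_module_scheme \<Rightarrow> bit \<Rightarrow> ('f \<Rightarrow> 'f) set" where
  "derivations A p = {X \<in> carrier A \<rightarrow>\<^sub>E carrier A.
     (\<forall>f \<in> carrier A. \<forall>h \<in> carrier A. X (f \<oplus>\<^bsub>A\<^esub> h) = X f \<oplus>\<^bsub>A\<^esub> X h) \<and>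
     (\<forall>c. \<forall>f \<in> carrier A. X (c \<odot>\<^bsub>A\<^esub> f) = c \<odot>\<^bsub>A\<^esub> X f) \<and>
     (\<forall>r. \<forall>f \<in> grade A r. X f \<in> grade A (p + r)) \<and>
     (\<forall>r. \<forall>f \<in> grade A r. \<forall>h \<in> carrier A.
        X (f \<otimes>\<^bsub>A\<^esub> h) = X f \<otimes>\<^bsub>A\<^esub> h \<oplus>\<^bsub>A\<^esub> koszul p r \<odot>\<^bsub>A\<^esub> (f \<otimes>\<^bsub>A\<^esub> X h))}"

definition Der :: "('f, 'z) super_module_scheme \<Rightarrow> ('f \<Rightarrow> 'f) super_module" where
  "Der A = \<lparr>
     carrier = {\<lambda>f \<in> carrier A. X f \<oplus>\<^bsub>A\<^esub> Y f | X Y. X \<in> derivations A 0 \<and> Y \<in> derivations A 1},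
     mult = undefined,
     one = undefined,
     zero = (\<lambda>f \<in> carrier A. \<zero>\<^bsub>A\<^esub>),
     add = (\<lambda>X Y. \<lambda>f \<in> carrier A. X f \<oplus>\<^bsub>A\<^esub> Y f),
     smult = (\<lambda>c X. \<lambda>f \<in> carrier A. c \<odot>\<^bsub>A\<^esub> X f),
     grade = derivations A\<rparr>"

definition Vect :: "('p, 'f) superspace \<Rightarrow> ('f \<Rightarrow> 'f) super_module" where
  "Vect M = Der (Cinf M)"

definition fun_scale :: "('p, 'f) superspace \<Rightarrow> 'f \<Rightarrow> ('f \<Rightarrow> 'f) \<Rightarrow> 'f \<Rightarrow> 'f" where
  "fun_scale M f X = (\<lambda>h \<in> carrier (Cinf M). f \<otimes>\<^bsub>Cinf M\<^esub> X h)"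

text \<open>The sign rule for homogeneous fields, extended bilinearly to all fields.\<close>

definition commutator :: "('p, 'f) superspace \<Rightarrow> ('f \<Rightarrow> 'f) \<Rightarrow> ('f \<Rightarrow> 'f) \<Rightarrow> 'f \<Rightarrow> 'f" where
  "commutator M X Y = (\<Oplus>\<^bsub>Vect M\<^esub>p \<in> UNIV. \<Oplus>\<^bsub>Vect M\<^esub>q \<in> UNIV.
     let X' = component (Vect M) p X; Y' = component (Vect M) q Y
     in (\<lambda>f \<in> carrier (Cinf M). X' (Y' f) \<ominus>\<^bsub>Cinf M\<^esub> koszul p q \<odot>\<^bsub>Cinf M\<^esub> Y' (X' f)))"

definition tangent_space :: "('p, 'f) superspace \<Rightarrow> 'p \<Rightarrow> ('f \<Rightarrow> real) super_module" where
  "tangent_space M m = (let A = Cinf M; T = {v \<in> extensional (carrier A).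
       (\<forall>f \<in> carrier A. \<forall>h \<in> carrier A. v (f \<oplus>\<^bsub>A\<^esub> h) = v f + v h) \<and>
       (\<forall>c. \<forall>f \<in> carrier A. v (c \<odot>\<^bsub>A\<^esub> f) = c * v f) \<and>
       (\<forall>f \<in> carrier A. \<forall>h \<in> carrier A.
          v (f \<otimes>\<^bsub>A\<^esub> h) = v f * fun_value M m h + fun_value M m f * v h)}
     in \<lparr>carrier = T,
         mult = undefined,
         one = undefined,
         zero = (\<lambda>f \<in> carrier A. 0),
         add = (\<lambda>v w. \<lambda>f \<in> carrier A. v f + w f),
         smult = (\<lambda>c v. \<lambda>f \<in> carrier A. c * v f),
         grade = (\<lambda>p. {v \<in> T. \<forall>f \<in> grade A (p + 1). v f = 0})\<rparr>)"

text \<open>No Koszul sign appears in the Leibniz rule above because odd functions have value \<open>0\<close>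
  at every point.\<close>

definition vector_at :: "('p, 'f) superspace \<Rightarrow> 'p \<Rightarrow> ('f \<Rightarrow> 'f) \<Rightarrow> 'f \<Rightarrow> real" where
  "vector_at M m X = (\<lambda>f \<in> carrier (Cinf M). fun_value M m (X f))"


section \<open>Metrics\<close>

definition metric :: "('p, 'f) superspace \<Rightarrow> (('f \<Rightarrow> 'f) \<Rightarrow> ('f \<Rightarrow> 'f) \<Rightarrow> 'f) \<Rightarrow> bool" where
  "metric M g \<longleftrightarrow>
     (\<forall>p q. \<forall>X \<in> grade (Vect M) p. \<forall>Y \<in> grade (Vect M) q.
        g X Y \<in> grade (Cinf M) (p + q) \<and> g X Y = koszul p q \<odot>\<^bsub>Cinf M\<^esub> g Y X) \<and>
     (\<forall>f \<in> carrier (Cinf M). \<forall>X \<in> carrier (Vect M). \<forall>Y \<in> carrier (Vect M). \<forall>Z \<in> carrier (Vect M).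
        g (fun_scale M f X \<oplus>\<^bsub>Vect M\<^esub> Y) Z = f \<otimes>\<^bsub>Cinf M\<^esub> g X Z \<oplus>\<^bsub>Cinf M\<^esub> g Y Z) \<and>
     (\<forall>X \<in> carrier (Vect M). \<forall>Y \<in> carrier (Vect M). \<forall>Z \<in> carrier (Vect M).
        g X (Y \<oplus>\<^bsub>Vect M\<^esub> Z) = g X Y \<oplus>\<^bsub>Cinf M\<^esub> g X Z)"

definition metric_kernel ::
    "('p, 'f) superspace \<Rightarrow> (('f \<Rightarrow> 'f) \<Rightarrow> ('f \<Rightarrow> 'f) \<Rightarrow> 'f) \<Rightarrow> ('f \<Rightarrow> 'f) set" where
  "metric_kernel M g = {X \<in> carrier (Vect M). \<forall>Y \<in> carrier (Vect M). g X Y = \<zero>\<^bsub>Cinf M\<^esub>}"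

text \<open>The bilinear form on the tangent space at \<open>m\<close> induced by \<open>g\<close>: every tangent vector is the
  value of a global field, and the value of the pairing at \<open>m\<close> depends on the values of its
  arguments only.\<close>

definition metric_at :: "('p, 'f) superspace \<Rightarrow> (('f \<Rightarrow> 'f) \<Rightarrow> ('f \<Rightarrow> 'f) \<Rightarrow> 'f) \<Rightarrow> 'p \<Rightarrow>
    ('f \<Rightarrow> real) \<Rightarrow> ('f \<Rightarrow> real) \<Rightarrow> real" where
  "metric_at M g m v w = (THE r. \<exists>X \<in> carrier (Vect M). \<exists>Y \<in> carrier (Vect M).
     vector_at M m X = v \<and> vector_at M m Y = w \<and> r = fun_value M m (g X Y))"

definition metric_kernel_at :: "('p, 'f) superspace \<Rightarrow> (('f \<Rightarrow> 'f) \<Rightarrow> ('f \<Rightarrow> 'f) \<Rightarrow> 'f) \<Rightarrow> 'p \<Rightarrow>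
    ('f \<Rightarrow> real) super_module" where
  "metric_kernel_at M g m = (let T = tangent_space M m; K = {v \<in> carrier T.
     \<forall>w \<in> carrier T. metric_at M g m v w = 0}
     in T\<lparr>carrier := K, grade := (\<lambda>p. grade T p \<inter> K)\<rparr>)"

text \<open>As for the commutator, the sign rule is stated for homogeneous \<open>X\<close>, \<open>Y\<close> and extended
  linearly.\<close>

definition lie_metric :: "('p, 'f) superspace \<Rightarrow> (('f \<Rightarrow> 'f) \<Rightarrow> ('f \<Rightarrow> 'f) \<Rightarrow> 'f) \<Rightarrow>
    ('f \<Rightarrow> 'f) \<Rightarrow> ('f \<Rightarrow> 'f) \<Rightarrow> ('f \<Rightarrow> 'f) \<Rightarrow> 'f" where
  "lie_metric M g X Y Z = (\<Oplus>\<^bsub>Cinf M\<^esub>p \<in> UNIV. \<Oplus>\<^bsub>Cinf M\<^esub>q \<in> UNIV.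
     let X' = component (Vect M) p X; Y' = component (Vect M) q Y
     in X' (g Y' Z) \<ominus>\<^bsub>Cinf M\<^esub> g (commutator M X' Y') Z
        \<ominus>\<^bsub>Cinf M\<^esub> koszul p q \<odot>\<^bsub>Cinf M\<^esub> g Y' (commutator M X' Z))"


section \<open>Super-null Riemannian manifolds\<close>

text \<open>In the chart, \<open>Q\<close> and \<open>P\<close> restrict to \<open>\<partial>\<^sub>\<tau> + \<tau> \<partial>\<^sub>t\<close> and \<open>\<partial>\<^sub>t\<close>, where \<open>t\<close> is the \<open>k\<close>-th even
  coordinate. A local field is determined by its effect on restrictions of global functions.\<close>

definition shander_chart :: "('p, 'f) superspace \<Rightarrow> ('f \<Rightarrow> 'f) \<Rightarrow> ('f \<Rightarrow> 'f) \<Rightarrow> 'p set \<Rightarrow>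
    (real^'n::finite) set \<Rightarrow> ('p \<Rightarrow> real^'n) \<Rightarrow> ('p set \<Rightarrow> 'f \<Rightarrow> 'n superfun) \<Rightarrow> 'n \<Rightarrow> bool" where
  "shander_chart M Q P U W \<phi> \<Phi> k \<longleftrightarrow> chart M 1 U W \<phi> \<Phi> \<and>
     (let A = superfun_algebra 1 W; loc = (\<lambda>f. \<Phi> U (restr M (topspace (points M)) U f))
      in \<forall>f \<in> carrier (Cinf M).
           loc (Q f) = odd_partial 0 (loc f) \<oplus>\<^bsub>A\<^esub> odd_coord W 0 \<otimes>\<^bsub>A\<^esub> even_partial W k (loc f) \<and>
           loc (P f) = even_partial W k (loc f))"

locale super_null_riemannian = supermanifold n 1 M
  for n :: "'n::finite itself" and M :: "('p, 'f) superspace"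
    and g :: "('f \<Rightarrow> 'f) \<Rightarrow> ('f \<Rightarrow> 'f) \<Rightarrow> 'f" and Q P :: "'f \<Rightarrow> 'f" +
  assumes metric: "metric M g"
    and degenerate: "metric_kernel M g \<noteq> {\<zero>\<^bsub>Vect M\<^esub>}"
    and Q_odd: "Q \<in> grade (Vect M) 1"
    and Q_nonsingular: "m \<in> topspace (points M) \<Longrightarrow> vector_at M m Q \<noteq> \<zero>\<^bsub>tangent_space M m\<^esub>"
    and P_even: "P \<in> grade (Vect M) 0"
    and Q_squared: "commutator M Q Q = 2 \<odot>\<^bsub>Vect M\<^esub> P"
    and kernel_span: "metric_kernel M g = {fun_scale M f Q | f. f \<in> carrier (Cinf M)}"
    and kernel_rank: "m \<in> topspace (points M) \<Longrightarrow> has_superdim (metric_kernel_at M g m) 0 1"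
    and shander: "m \<in> topspace (points M) \<Longrightarrow>
      \<exists>U (W :: (real^'n) set) \<phi> \<Phi> k. m \<in> U \<and> shander_chart M Q P U W \<phi> \<Phi> k"

definition snull :: "('p, 'f) superspace \<Rightarrow> (('f \<Rightarrow> 'f) \<Rightarrow> ('f \<Rightarrow> 'f) \<Rightarrow> 'f) \<Rightarrow>
    ('f \<Rightarrow> 'f) \<Rightarrow> ('f \<Rightarrow> 'f) \<Rightarrow> ('f \<Rightarrow> 'f) super_bracket" where
  "snull M g Q P = (let S = {X \<in> carrier (Vect M).
       (\<forall>Y \<in> carrier (Vect M). \<forall>Z \<in> carrier (Vect M). lie_metric M g X Y Z = \<zero>\<^bsub>Cinf M\<^esub>) \<and>
       commutator M X Q = \<zero>\<^bsub>Vect M\<^esub>}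
     in \<lparr>carrier = S,
         mult = undefined,
         one = undefined,
         zero = \<zero>\<^bsub>Vect M\<^esub>,
         add = add (Vect M),
         smult = smult (Vect M),
         grade = (\<lambda>p. grade (Vect M) p \<inter> S),
         bracket = commutator M\<rparr>)"

end

theory Submission
  imports Defs "HOL-Computational_Algebra.Polynomial"
begin

text \<open>The odd dimension is one, so \<open>Q\<close> provides a global odd function \<open>\<tau>\<close> with \<open>Q \<tau> = 1\<close>, and
  \<open>C\<^sup>\<infinity>(M) = C \<oplus> C \<tau>\<close>, where \<open>C\<close> is the algebra of smooth functions on \<open>|M|\<close>. Constant rank of
  the kernel makes the metric induced on \<open>|M|\<close> non-degenerate at every point.
  An even field commuting with \<open>Q\<close> annihilates \<open>\<tau>\<close>, hence comes from a vector field on \<open>|M|\<close>, and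
  preserving \<open>g\<close> makes it a Killing field, which is determined on a connected component by its
  1-jet at one point. An odd field \<open>X\<close> of the super-null algebra is determined by the function
  \<open>\<xi> = X(\<tau>)\<close>, and \<open>[X, X]\<close> is the Killing field \<open>- 2 \<xi>\<^sup>2 P\<close>: if \<open>\<xi>\<close> vanishes at a point, then so
  does the 1-jet of \<open>[X, X]\<close>, hence \<open>\<xi>\<close> vanishes on the whole component. So finitely many linear
  functionals separate the points of the algebra when there are finitely many components.\<close>

section \<open>Smooth functions on open subsets of a Euclidean space\<close>

text \<open>The detour through [X, X] is forced: an odd field does not descend to |M|, so the
  continuation theorem for Killing fields cannot be applied to it. The 1-jet comes for free because
  the descended field is quadratic in \<xi>, and \<xi> is recovered from it because P vanishes
  nowhere; hence a component contributes at most one odd dimension. A Killing field is determined by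
  its 1-jet because Killing's equation, solved with the nondegenerate metric, gives the second
  derivatives linearly in that 1-jet. Nondegeneracy comes from the rank 0|1: no nonzero even tangent
  vector lies in the kernel. \<tau> exists without partitions of unity: the value of Q f is the
  coefficient of the odd coordinate, so the odd coordinates of the Shander charts are characterised
  by value 0 and Q-value 1, agree on overlaps and glue. For the same reason \<open>val f\<close> and
  \<open>val (Q f)\<close> determine f, and most identities are checked on this pair. Finitely many
  components are assumed because fields on distinct components are independent of each
  other.\<close>

lemma has_derivative_partial:
  fixes f :: "real^'n::finite \<Rightarrow> real"
  assumes "f differentiable (at x)"
  shows "(f has_derivative (\<lambda>v. \<Sum>i\<in>UNIV. v $ i * partial i f x)) (at x)"
proof -
  let ?D = "frechet_derivative f (at x)"
  have D: "(f has_derivative ?D) (at x)"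
    using assms frechet_derivative_works by blast
  then interpret bounded_linear ?D by (rule has_derivative_bounded_linear)
  have "?D v = (\<Sum>i\<in>UNIV. v $ i * partial i f x)" for v :: "real^'n"
  proof -
    have "v = (\<Sum>i\<in>UNIV. v $ i *\<^sub>R axis i 1)"
      by (simp add: vec_eq_iff axis_def sum.delta if_distrib cong: if_cong)
    then have "?D v = ?D (\<Sum>i\<in>UNIV. v $ i *\<^sub>R axis i 1)" by simp
    also have "\<dots> = (\<Sum>i\<in>UNIV. v $ i * partial i f x)"
      by (simp add: sum scaleR partial_def)
    finally show ?thesis .
  qed
  then have "?D = (\<lambda>v. \<Sum>i\<in>UNIV. v $ i * partial i f x)" by blast
  with D show ?thesis by simp
qed

lemma partial_eqI: "(f has_derivative f') (at x) \<Longrightarrow> partial i f x = f' (axis i 1)"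
  by (simp add: partial_def frechet_derivative_at[symmetric])

lemma partial_cong:
  assumes "open U" "x \<in> U" "\<And>y. y \<in> U \<Longrightarrow> f y = h y"
  shows "partial i f x = partial i h x"
proof -
  \<comment> \<open>Equivalence for every candidate \<open>D\<close> makes the choice inside
    \<open>frechet_derivative\<close> the same for both functions, also at points where neither is
    differentiable.\<close>
  have "(f has_derivative D) (at x) \<longleftrightarrow> (h has_derivative D) (at x)" for D
    using assms has_derivative_transform_within_open[of f D x UNIV U h]
      has_derivative_transform_within_open[of h D x UNIV U f] by auto
  then show ?thesis by (simp add: partial_def frechet_derivative_def)
qed

lemma partial_const [simp]: "partial i (\<lambda>x. c) x = 0"
  by (rule partial_eqI[THEN trans]) (auto intro!: derivative_eq_intros)

lemma partial_nth: "partial i (\<lambda>x. x $ j) x = (if i = j then 1 else 0)"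
proof -
  have "((\<lambda>x. x $ j) has_derivative (\<lambda>x. x $ j)) (at x)"
    by (simp add: bounded_linear_imp_has_derivative bounded_linear_vec_nth)
  then show ?thesis by (simp add: partial_eqI axis_def)
qed

lemma partial_add:
  assumes "f differentiable (at x)" "h differentiable (at x)"
  shows "partial i (\<lambda>x. f x + h x) x = partial i f x + partial i h x"
  using partial_eqI[OF has_derivative_add[OF assms[THEN frechet_derivative_works[THEN iffD1]]]]
  by (simp add: partial_def)

lemma partial_mult:
  assumes "f differentiable (at x)" "h differentiable (at x)"
  shows "partial i (\<lambda>x. f x * h x) x = partial i f x * h x + f x * partial i h x"
  using partial_eqI[OF has_derivative_mult[OF assms[THEN frechet_derivative_works[THEN iffD1]]]]
  by (simp add: partial_def)

lemma partial_sum: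
  assumes "finite A" "\<And>a. a \<in> A \<Longrightarrow> f a differentiable (at x)"
  shows "partial i (\<lambda>x. \<Sum>a\<in>A. f a x) x = (\<Sum>a\<in>A. partial i (f a) x)"
  using assms
proof (induction rule: finite_induct)
  case (insert a A)
  have "(\<lambda>x. \<Sum>a\<in>A. f a x) differentiable (at x)"
    using insert by (intro differentiable_sum) auto
  then show ?case using insert by (simp add: partial_add)
qed simp

lemma Ck_on_cong:
  assumes "open U" "\<And>x. x \<in> U \<Longrightarrow> f x = h x"
  shows "Ck_on k U f \<longleftrightarrow> Ck_on k U h"
  using assms(2)
proof (induction k arbitrary: f h)
  case 0
  then show ?case by (simp cong: continuous_on_cong)
next
  case (Suc k)
  have "f differentiable at x \<longleftrightarrow> h differentiable at x" if "x \<in> U" for x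
  proof -
    have "(f has_derivative D) (at x) \<longleftrightarrow> (h has_derivative D) (at x)" for D
      using assms(1) Suc.prems that has_derivative_transform_within_open[of f D x UNIV U h]
        has_derivative_transform_within_open[of h D x UNIV U f] by auto
    then show ?thesis by (simp add: differentiable_def)
  qed
  moreover have "Ck_on k U (partial i f) \<longleftrightarrow> Ck_on k U (partial i h)" for i
    using Suc.prems assms(1) partial_cong by (intro Suc.IH) blast
  ultimately show ?case by simp
qed

lemma smooth_on_cong:
  "open U \<Longrightarrow> (\<And>x. x \<in> U \<Longrightarrow> f x = h x) \<Longrightarrow> smooth_on U f \<longleftrightarrow> smooth_on U h"
  unfolding smooth_on_def using Ck_on_cong by blast

lemma Ck_on_Suc_imp: "Ck_on (Suc k) U f \<Longrightarrow> Ck_on k U f"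
proof (induction k arbitrary: f)
  case 0
  then show ?case
    by (simp add: continuous_at_imp_continuous_on differentiable_imp_continuous_within)
next
  case (Suc k)
  then show ?case by (metis Ck_on.simps(2))
qed

lemma Ck_on_mono: "Ck_on k U f \<Longrightarrow> V \<subseteq> U \<Longrightarrow> Ck_on k V f"
  by (induction k arbitrary: f) (auto intro: continuous_on_subset)

text \<open>Lets a cut-off function be pieced together from a formula on a ball and the zero
  function away from a smaller closed ball.\<close>

lemma Ck_on_Un:
  assumes "open U" "open V" "Ck_on k U f" "Ck_on k V f"
  shows "Ck_on k (U \<union> V) f"
  using assms(3,4) by (induction k arbitrary: f) (auto intro: continuous_on_open_Un assms(1,2))

lemma Ck_on_const: "Ck_on k U (\<lambda>x. c)"
proof (induction k arbitrary: c)
  case (Suc k)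
  have "partial i (\<lambda>x::real^'a. c) = (\<lambda>x. 0)" for i :: 'a by (simp add: fun_eq_iff)
  then show ?case using Suc by simp
qed simp

lemma Ck_on_add:
  assumes "open U"
  shows "Ck_on k U f \<Longrightarrow> Ck_on k U h \<Longrightarrow> Ck_on k U (\<lambda>x. f x + h x)"
proof (induction k arbitrary: f h)
  case (Suc k)
  have "Ck_on k U (partial i (\<lambda>x. f x + h x))" for i
    using Ck_on_cong[OF assms, of "partial i (\<lambda>x. f x + h x)"] Suc by (simp add: partial_add)
  then show ?case using Suc.prems by simp
qed (auto intro: continuous_intros)

lemma Ck_on_mult:
  assumes "open U"
  shows "Ck_on k U f \<Longrightarrow> Ck_on k U h \<Longrightarrow> Ck_on k U (\<lambda>x. f x * h x)"
proof (induction k arbitrary: f h)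
  case (Suc k)
  have "Ck_on k U (\<lambda>x. partial i f x * h x + f x * partial i h x)" for i
    using Suc.prems Ck_on_Suc_imp[OF Suc.prems(1)] Ck_on_Suc_imp[OF Suc.prems(2)]
    by (intro Ck_on_add[OF assms] Suc.IH) auto
  then have "Ck_on k U (partial i (\<lambda>x. f x * h x))" for i
    using Ck_on_cong[OF assms, of "partial i (\<lambda>x. f x * h x)"] Suc.prems by (simp add: partial_mult)
  then show ?case using Suc.prems by simp
qed (auto intro: continuous_intros)

lemma Ck_on_sum:
  assumes "open U" "finite A" "\<And>a. a \<in> A \<Longrightarrow> Ck_on k U (f a)"
  shows "Ck_on k U (\<lambda>x. \<Sum>a\<in>A. f a x)"
  using assms(2,3) by (induction rule: finite_induct) (auto intro: Ck_on_const Ck_on_add assms(1))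

lemma Ck_on_nth: "Ck_on k U (\<lambda>x::real^'n::finite. x $ j)"
proof (cases k)
  case (Suc l)
  have "partial i (\<lambda>x::real^'n. x $ j) = (\<lambda>x. if i = j then 1 else 0)" for i
    by (simp add: fun_eq_iff partial_nth)
  moreover have "(\<lambda>x::real^'n. x $ j) differentiable at x" for x
    by (simp add: bounded_linear_imp_differentiable bounded_linear_vec_nth)
  ultimately show ?thesis using Suc by (simp add: Ck_on_const)
qed (auto intro: continuous_intros)

text \<open>The sequence \<open>d\<close> of iterated derivatives encodes smoothness of the outer function.\<close>

lemma Ck_on_compose_real:
  fixes d :: "nat \<Rightarrow> real \<Rightarrow> real"
  assumes "open U" and d: "\<And>j y. y \<in> S \<Longrightarrow> (d j has_real_derivative d (Suc j) y) (at y)"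
  shows "Ck_on k U u \<Longrightarrow> (\<And>x. x \<in> U \<Longrightarrow> u x \<in> S) \<Longrightarrow> Ck_on k U (\<lambda>x. d j (u x))"
proof (induction k arbitrary: j)
  case 0
  have "continuous_on S (d j)"
    using d DERIV_isCont continuous_at_imp_continuous_on by blast
  then show ?case using 0 by (auto intro: continuous_on_compose2)
next
  case (Suc k)
  have der: "((\<lambda>x. d j (u x)) has_derivative
      (\<lambda>v. d (Suc j) (u x) * (\<Sum>i\<in>UNIV. v $ i * partial i u x))) (at x)" if "x \<in> U" for x
  proof -
    have "(u has_derivative (\<lambda>v. \<Sum>i\<in>UNIV. v $ i * partial i u x)) (at x)"
      using Suc.prems that by (intro has_derivative_partial) auto
    moreover have "(d j has_derivative (\<lambda>h. d (Suc j) (u x) * h)) (at (u x))"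
      using d Suc.prems(2) that by (simp add: has_field_derivative_def)
    ultimately show ?thesis
      by (rule has_derivative_compose)
  qed
  have "partial i (\<lambda>x. d j (u x)) x = d (Suc j) (u x) * partial i u x" if "x \<in> U" for x i
    by (subst partial_eqI[OF der[OF that]])
      (simp add: axis_def if_distrib[of "\<lambda>c. c * _"] cong: if_cong)
  moreover have "Ck_on k U (\<lambda>x. d (Suc j) (u x) * partial i u x)" for i
    using Suc.prems Ck_on_Suc_imp[OF Suc.prems(1)] by (intro Ck_on_mult[OF assms(1)] Suc.IH) auto
  ultimately have "Ck_on k U (partial i (\<lambda>x. d j (u x)))" for i
    using Ck_on_cong[OF assms(1), of "partial i (\<lambda>x. d j (u x))"] by simp
  then show ?case using der by (auto simp: differentiable_def)
qed

lemma smooth_on_const [simp]: "smooth_on U (\<lambda>x. c)"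
  and smooth_on_nth: "smooth_on U (\<lambda>x. x $ j)"
  and smooth_on_add: "open U \<Longrightarrow> smooth_on U f \<Longrightarrow> smooth_on U h \<Longrightarrow> smooth_on U (\<lambda>x. f x + h x)"
  and smooth_on_mult: "open U \<Longrightarrow> smooth_on U f \<Longrightarrow> smooth_on U h \<Longrightarrow> smooth_on U (\<lambda>x. f x * h x)"
  and smooth_on_sum: "open U \<Longrightarrow> finite A \<Longrightarrow> (\<And>a. a \<in> A \<Longrightarrow> smooth_on U (F a)) \<Longrightarrow>
    smooth_on U (\<lambda>x. \<Sum>a\<in>A. F a x)"
  and smooth_on_Un: "open U \<Longrightarrow> open V \<Longrightarrow> smooth_on U f \<Longrightarrow> smooth_on V f \<Longrightarrow> smooth_on (U \<union> V) f"
  unfolding smooth_on_def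
  by (auto intro: Ck_on_const Ck_on_nth Ck_on_add Ck_on_mult Ck_on_sum Ck_on_Un)

lemma smooth_on_subset: "smooth_on U f \<Longrightarrow> V \<subseteq> U \<Longrightarrow> smooth_on V f"
  unfolding smooth_on_def by (blast intro: Ck_on_mono)

lemma smooth_on_partial: "smooth_on U f \<Longrightarrow> smooth_on U (partial i f)"
  unfolding smooth_on_def by (meson Ck_on.simps(2))

lemma smooth_on_differentiable: "smooth_on U f \<Longrightarrow> x \<in> U \<Longrightarrow> f differentiable at x"
  unfolding smooth_on_def by (meson Ck_on.simps(2))

lemma smooth_on_continuous: "smooth_on U f \<Longrightarrow> continuous_on U f"
  unfolding smooth_on_def by (meson Ck_on.simps(1))

lemma smooth_on_uminus: "open U \<Longrightarrow> smooth_on U f \<Longrightarrow> smooth_on U (\<lambda>x. - f x)"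
  using smooth_on_mult[of U "\<lambda>x. -1" f] by simp

lemma smooth_on_diff: "open U \<Longrightarrow> smooth_on U f \<Longrightarrow> smooth_on U h \<Longrightarrow> smooth_on U (\<lambda>x. f x - h x)"
  using smooth_on_add[of U f "\<lambda>x. - h x"] smooth_on_uminus[of U h] by simp

lemma smooth_on_compose_real:
  fixes d :: "nat \<Rightarrow> real \<Rightarrow> real"
  assumes "open U" "\<And>j y. y \<in> S \<Longrightarrow> (d j has_real_derivative d (Suc j) y) (at y)"
    and "smooth_on U u" "\<And>x. x \<in> U \<Longrightarrow> u x \<in> S"
  shows "smooth_on U (\<lambda>x. d j (u x))"
  using assms Ck_on_compose_real[of U S d] unfolding smooth_on_def by blast

lemma smooth_on_inverse:
  assumes "open U" "smooth_on U u" "\<And>x. x \<in> U \<Longrightarrow> u x \<noteq> 0"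
  shows "smooth_on U (\<lambda>x. inverse (u x))"
proof -
  \<comment> \<open>The j-th derivative of 1/y is (-1)^j j! / y^(j+1).\<close>
  define d :: "nat \<Rightarrow> real \<Rightarrow> real" where "d j y = (-1) ^ j * fact j / y ^ Suc j" for j y
  have "(d j has_real_derivative d (Suc j) y) (at y)" if "y \<in> - {0}" for j y
  proof -
    have "((\<lambda>y. y ^ Suc j) has_real_derivative (real (Suc j) * y ^ j)) (at y)"
      by (rule DERIV_cong[OF DERIV_pow]) simp
    from DERIV_cmult[OF DERIV_inverse_fun[OF this], of "(-1) ^ j * fact j"]
    have "(d j has_real_derivative (-1) ^ j * fact j *
        - (real (Suc j) * y ^ j * inverse ((y ^ Suc j)\<^sup>2))) (at y)"
      using that unfolding d_def[abs_def] by (simp add: divide_inverse power2_eq_square)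
    also have "(-1) ^ j * fact j * - (real (Suc j) * y ^ j * inverse ((y ^ Suc j)\<^sup>2)) = d (Suc j) y"
      using that by (simp add: d_def field_simps power2_eq_square)
    finally show ?thesis .
  qed
  then have "smooth_on U (\<lambda>x. d 0 (u x))"
    using assms(3) by (intro smooth_on_compose_real[OF assms(1) _ assms(2), of "- {0}"]) auto
  then show ?thesis by (simp add: d_def inverse_eq_divide)
qed

text \<open>The functions P(1/x) exp(-1/x), continued by zero. The polynomial parameter makes the
  family closed under differentiation, so that all derivatives of exp(-1/x) are available at
  once.\<close>

definition flat_poly_exp :: "real poly \<Rightarrow> real \<Rightarrow> real" where
  "flat_poly_exp P x = (if x > 0 then poly P (1 / x) * exp (- (1 / x)) else 0)"

lemma poly_times_exp_tendsto_0: "((\<lambda>y::real. poly P y * exp (- y)) \<longlongrightarrow> 0) at_top"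
proof -
  have "((\<lambda>y. coeff P i * (y ^ i / exp y)) \<longlongrightarrow> coeff P i * 0) at_top" for i
    by (intro tendsto_mult tendsto_const tendsto_power_div_exp_0)
  then have "((\<lambda>y. \<Sum>i\<le>degree P. coeff P i * (y ^ i / exp y)) \<longlongrightarrow> 0) at_top"
    by (intro tendsto_null_sum) simp
  moreover have "(\<Sum>i\<le>degree P. coeff P i * (y ^ i / exp y)) = poly P y * exp (- y)" for y
    unfolding poly_altdef sum_distrib_right by (simp add: exp_minus divide_inverse mult.assoc)
  ultimately show ?thesis by simp
qed

text \<open>With y = 1/x the operator d/dx is - y^2 d/dy, which turns P(y) exp(-y) into y^2 (P -
  P')(y) exp(-y). At 0 both one-sided difference quotients tend to 0.\<close>

lemma flat_poly_exp_derivative: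
  "(flat_poly_exp P has_real_derivative flat_poly_exp ([:0, 0, 1:] * (P - pderiv P)) x) (at x)"
proof (cases x "0::real" rule: linorder_cases)
  case less
  have "((\<lambda>x. 0) has_real_derivative 0) (at x)" by simp
  then have "(flat_poly_exp P has_real_derivative 0) (at x)"
    by (rule has_field_derivative_transform_within_open[of _ _ _ "{..<0}"])
      (use less in \<open>auto simp: flat_poly_exp_def\<close>)
  then show ?thesis using less by (simp add: flat_poly_exp_def)
next
  case greater
  define y where "y = 1 / x"
  have inv: "((\<lambda>x. 1 / x) has_real_derivative - (y * y)) (at x)"
    using greater by (auto intro!: derivative_eq_intros simp: y_def)
  have "((\<lambda>x. poly P (1 / x)) has_real_derivative poly (pderiv P) y * - (y * y)) (at x)"
    unfolding y_def using inv[unfolded y_def] by (rule DERIV_chain2[OF poly_DERIV])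
  moreover have "((\<lambda>x. exp (- (1 / x))) has_real_derivative exp (- y) * (y * y)) (at x)"
    by (rule DERIV_cong[OF DERIV_chain2[OF DERIV_exp DERIV_minus[OF inv]]]) (simp add: y_def)
  ultimately have "((\<lambda>x. poly P (1 / x) * exp (- (1 / x))) has_real_derivative
      flat_poly_exp ([:0, 0, 1:] * (P - pderiv P)) x) (at x)"
    by (rule DERIV_cong[OF DERIV_mult])
      (use greater in \<open>simp add: flat_poly_exp_def flip: y_def\<close>, simp add: algebra_simps)
  then show ?thesis
    by (rule has_field_derivative_transform_within_open[of _ _ _ "{0<..}"])
      (use greater in \<open>auto simp: flat_poly_exp_def\<close>)
next
  case equal
  have "((\<lambda>h. flat_poly_exp P h / h) \<longlongrightarrow> 0) (at_left 0)"
    by (rule tendsto_eventually) (auto simp: flat_poly_exp_def eventually_at_filter)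
  moreover have "((\<lambda>h. flat_poly_exp P h / h) \<longlongrightarrow> 0) (at_right 0)"
  proof -
    \<comment> \<open>\<open>pCons 0 P\<close> carries the extra factor 1/h, so this is the
      difference quotient at 0 from the right.\<close>
    have "((\<lambda>h. poly (pCons 0 P) (inverse h) * exp (- inverse h)) \<longlongrightarrow> 0) (at_right (0::real))"
      using poly_times_exp_tendsto_0 filterlim_inverse_at_top_right by (rule filterlim_compose)
    then show ?thesis
      by (rule Lim_transform_eventually)
        (auto simp: flat_poly_exp_def eventually_at_filter divide_inverse algebra_simps)
  qed
  ultimately have "((\<lambda>h. flat_poly_exp P h / h) \<longlongrightarrow> 0) (at 0)"
    by (rule filterlim_split_at)
  then show ?thesis using equal by (simp add: DERIV_def flat_poly_exp_def)
qed

lemma smooth_on_flat_exp: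
  assumes "open U" "smooth_on U u"
  shows "smooth_on U (\<lambda>x. flat_poly_exp 1 (u x))"
proof -
  define d where "d j = flat_poly_exp (((\<lambda>P. [:0, 0, 1:] * (P - pderiv P)) ^^ j) 1)" for j
  have "(d j has_real_derivative d (Suc j) y) (at y)" for j y
    unfolding d_def funpow.simps comp_def by (rule flat_poly_exp_derivative)
  then have "smooth_on U (\<lambda>x. d 0 (u x))"
    using assms by (intro smooth_on_compose_real[of U UNIV d u 0]) auto
  then show ?thesis by (simp add: d_def)
qed

lemma exists_bump:
  fixes p :: "real^'n::finite"
  assumes "r > 0"
  obtains \<psi> where "smooth_on UNIV \<psi>" "\<And>x. x \<in> cball p r \<Longrightarrow> \<psi> x = 1"
    "\<And>x. x \<notin> ball p (2 * r) \<Longrightarrow> \<psi> x = 0"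
proof
  \<comment> \<open>The squared distance to p, polynomial and hence smooth. \<open>a\<close> is
    positive exactly inside radius 2r and \<open>b\<close> exactly outside radius r; these regions
    cover the space, so a / (a + b) is defined everywhere.\<close>
  define s where "s x = (\<Sum>i\<in>UNIV. (x $ i - p $ i) * (x $ i - p $ i))" for x
  define a where "a x = flat_poly_exp 1 (4 * r * r - s x)" for x
  define b where "b x = flat_poly_exp 1 (s x - r * r)" for x
  have s: "s x = dist p x * dist p x" for x
    unfolding dist_norm power2_eq_square[symmetric] power2_norm_eq_inner
    by (simp add: s_def inner_vec_def algebra_simps)
  have pos: "a x + b x \<noteq> 0" for x
  proof -
    have "r * r < 4 * r * r" using assms by simp
    then have "4 * r * r - s x > 0 \<or> s x - r * r > 0" by linarith
    moreover have "a x \<ge> 0" "b x \<ge> 0" by (simp_all add: a_def b_def flat_poly_exp_def)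
    ultimately show ?thesis by (auto simp: a_def b_def flat_poly_exp_def add_nonneg_eq_0_iff)
  qed
  have "smooth_on UNIV s"
    unfolding s_def[abs_def]
    by (intro smooth_on_sum smooth_on_mult smooth_on_diff smooth_on_nth) auto
  then have "smooth_on UNIV a" "smooth_on UNIV b"
    unfolding a_def[abs_def] b_def[abs_def] by (intro smooth_on_flat_exp smooth_on_diff; simp)+
  then show "smooth_on UNIV (\<lambda>x. a x * inverse (a x + b x))"
    using pos by (intro smooth_on_mult smooth_on_inverse smooth_on_add) auto
  show "a x * inverse (a x + b x) = 1" if "x \<in> cball p r" for x
  proof -
    have "s x \<le> r * r" unfolding s using that assms by (intro mult_mono) auto
    then have "b x = 0" by (simp add: b_def flat_poly_exp_def)
    then show ?thesis using pos[of x] by simp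
  qed
  show "a x * inverse (a x + b x) = 0" if "x \<notin> ball p (2 * r)" for x
  proof -
    have "(2 * r) * (2 * r) \<le> s x" unfolding s using that assms by (intro mult_mono) auto
    then show ?thesis by (simp add: a_def flat_poly_exp_def)
  qed
qed

text \<open>The weight \<open>t ^ a\<close> makes the family of such integrals closed under
  differentiation: a derivative raises the exponent by one and replaces H by a partial derivative.
  Smoothness then follows by induction.\<close>

lemma has_derivative_integral_segment:
  fixes H :: "real^'n::finite \<Rightarrow> real"
  assumes H: "smooth_on (ball p r) H" and x0: "x0 \<in> ball p r"
  shows "((\<lambda>x. integral {0..1} (\<lambda>t. t ^ a * H (p + t *\<^sub>R (x - p)))) has_derivative
    (\<lambda>v. \<Sum>i\<in>UNIV. v $ i * integral {0..1} (\<lambda>t. t ^ Suc a * partial i H (p + t *\<^sub>R (x0 - p))))) (at x0)"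
proof -
  have seg: "p + t *\<^sub>R (x - p) \<in> ball p r" if "x \<in> ball p r" "t \<in> {0..1}" for x t
  proof -
    have "norm (t *\<^sub>R (x - p)) \<le> norm (x - p)"
      using that by (auto intro: mult_left_le_one_le)
    then show ?thesis using that(1) by (simp add: dist_norm norm_minus_commute)
  qed
  have cont: "continuous_on (ball p r \<times> {0..1}) (\<lambda>z. K (p + snd z *\<^sub>R (fst z - p)))"
    if "smooth_on (ball p r) K" for K :: "real^'n \<Rightarrow> real"
    by (rule continuous_on_compose2[OF smooth_on_continuous[OF that]])
      (auto intro!: continuous_intros seg simp del: mem_ball)
  have cont1: "continuous_on {0..1} (\<lambda>t. K (p + t *\<^sub>R (x - p)))"
    if "smooth_on (ball p r) K" "x \<in> ball p r" for K :: "real^'n \<Rightarrow> real" and x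
    by (rule continuous_on_compose2[OF smooth_on_continuous[OF that(1)]])
      (auto intro!: continuous_intros seg that simp del: mem_ball)
  \<comment> \<open>The Leibniz rule for parameter integrals wants the derivative as a continuous
    function into bounded linear maps, so the coordinate functionals are needed in that
    type.\<close>
  define \<pi> :: "'n \<Rightarrow> (real^'n) \<Rightarrow>\<^sub>L real" where "\<pi> i = blinfun_inner_right (axis i 1)" for i
  have \<pi>: "blinfun_apply (\<pi> i) v = v $ i" for i v
    by (simp add: \<pi>_def inner_axis inner_commute)
  define D where "D x t = (\<Sum>i\<in>UNIV. (t ^ Suc a * partial i H (p + t *\<^sub>R (x - p))) *\<^sub>R \<pi> i)" for x t
  have D: "blinfun_apply (D x t) v = (\<Sum>i\<in>UNIV. v $ i * (t ^ Suc a * partial i H (p + t *\<^sub>R (x - p))))" for x t v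
    by (simp add: D_def blinfun.sum_left blinfun.scaleR_left \<pi> algebra_simps)
  have "((\<lambda>x. integral (cbox 0 1) (\<lambda>t. t ^ a * H (p + t *\<^sub>R (x - p)))) has_derivative
      blinfun_apply (integral (cbox 0 1) (D x0))) (at x0 within ball p r)"
  proof (rule leibniz_rule)
    fix x and t :: real assume x: "x \<in> ball p r" and t: "t \<in> cbox 0 1"
    have "(H has_derivative (\<lambda>v. \<Sum>i\<in>UNIV. v $ i * partial i H (p + t *\<^sub>R (x - p)))) (at (p + t *\<^sub>R (x - p)))"
      using t by (intro has_derivative_partial smooth_on_differentiable[OF H] seg x) auto
    moreover have "((\<lambda>x. p + t *\<^sub>R (x - p)) has_derivative (\<lambda>v. t *\<^sub>R v)) (at x within ball p r)"
      by (auto intro!: derivative_eq_intros)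
    ultimately have "((\<lambda>x. H (p + t *\<^sub>R (x - p))) has_derivative
        (\<lambda>v. \<Sum>i\<in>UNIV. (t *\<^sub>R v) $ i * partial i H (p + t *\<^sub>R (x - p)))) (at x within ball p r)"
      using has_derivative_compose by blast
    from has_derivative_mult_right[OF this, of "t ^ a"]
    show "((\<lambda>x. t ^ a * H (p + t *\<^sub>R (x - p))) has_derivative blinfun_apply (D x t))
        (at x within ball p r)"
      by (rule has_derivative_eq_rhs) (simp add: fun_eq_iff D sum_distrib_left algebra_simps)
  next
    fix x assume "x \<in> ball p r"
    then show "(\<lambda>t. t ^ a * H (p + t *\<^sub>R (x - p))) integrable_on cbox 0 1"
      unfolding cbox_interval
      by (intro integrable_continuous_interval continuous_intros cont1[OF H])
  next
    show "continuous_on (ball p r \<times> cbox 0 1) (\<lambda>(x, t). D x t)"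
      unfolding D_def case_prod_beta cbox_interval
      by (intro continuous_intros cont smooth_on_partial H)
  qed (use x0 in auto)
  moreover have "blinfun_apply (integral (cbox 0 1) (D x0)) v =
      (\<Sum>i\<in>UNIV. v $ i * integral {0..1} (\<lambda>t. t ^ Suc a * partial i H (p + t *\<^sub>R (x0 - p))))" for v
  proof -
    have int: "(\<lambda>t. t ^ Suc a * partial i H (p + t *\<^sub>R (x0 - p))) integrable_on {0..1}" for i
      by (intro integrable_continuous_interval continuous_intros cont1 smooth_on_partial H x0)
    have "D x0 integrable_on cbox 0 1"
      unfolding D_def[abs_def] cbox_interval
      by (intro integrable_continuous_interval continuous_intros cont1 smooth_on_partial H x0)
    then have "blinfun_apply (integral (cbox 0 1) (D x0)) v = integral (cbox 0 1) (\<lambda>t. D x0 t v)"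
      by (rule blinfun_apply_integral)
    also have "\<dots> = (\<Sum>i\<in>UNIV. v $ i * integral {0..1} (\<lambda>t. t ^ Suc a * partial i H (p + t *\<^sub>R (x0 - p))))"
      unfolding D cbox_interval
      using int by (subst integral_sum) (auto simp del: power_Suc intro!: integrable_on_mult_right)
    finally show ?thesis .
  qed
  then have "blinfun_apply (integral (cbox 0 1) (D x0)) =
      (\<lambda>v. \<Sum>i\<in>UNIV. v $ i * integral {0..1} (\<lambda>t. t ^ Suc a * partial i H (p + t *\<^sub>R (x0 - p))))" ..
  ultimately show ?thesis
    unfolding cbox_interval at_within_open[OF x0 open_ball] by simp
qed

lemma smooth_on_integral_segment:
  fixes H :: "real^'n::finite \<Rightarrow> real"
  assumes "smooth_on (ball p r) H"
  shows "smooth_on (ball p r) (\<lambda>x. integral {0..1} (\<lambda>t. t ^ a * H (p + t *\<^sub>R (x - p))))"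
proof -
  have "Ck_on k (ball p r) (\<lambda>x. integral {0..1} (\<lambda>t. t ^ a * H (p + t *\<^sub>R (x - p))))" for k
    using assms
  proof (induction k arbitrary: a H)
    case 0
    show ?case
      unfolding Ck_on.simps(1) continuous_on_eq_continuous_at[OF open_ball]
      using has_derivative_continuous[OF has_derivative_integral_segment[OF 0]] by blast
  next
    case (Suc k)
    note d = has_derivative_integral_segment[OF Suc.prems]
    have "partial i (\<lambda>x. integral {0..1} (\<lambda>t. t ^ a * H (p + t *\<^sub>R (x - p)))) x =
        integral {0..1} (\<lambda>t. t ^ Suc a * partial i H (p + t *\<^sub>R (x - p)))" if "x \<in> ball p r" for i x
      by (subst partial_eqI[OF d[OF that]])
        (simp add: axis_def if_distrib[of "\<lambda>c. c * _"] cong: if_cong)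
    then have "Ck_on k (ball p r) (partial i (\<lambda>x. integral {0..1} (\<lambda>t. t ^ a * H (p + t *\<^sub>R (x - p)))))" for i
      using Suc.IH[OF smooth_on_partial[OF Suc.prems], of "Suc a"]
      by (subst Ck_on_cong[OF open_ball]) (auto simp del: power_Suc)
    then show ?case using differentiableI[OF d] by simp
  qed
  then show ?thesis by (simp add: smooth_on_def)
qed

text \<open>The fundamental theorem of calculus along the segment from p to x. It is the source of
  both the symmetry of second partial derivatives and the coordinate formula for
  derivations.\<close>

lemma hadamard:
  fixes F :: "real^'n::finite \<Rightarrow> real"
  assumes F: "smooth_on (ball p r) F"
  obtains G where "\<And>i. smooth_on (ball p r) (G i)"
    "\<And>x. x \<in> ball p r \<Longrightarrow> F x = F p + (\<Sum>i\<in>UNIV. (x $ i - p $ i) * G i x)"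
    "\<And>i. r > 0 \<Longrightarrow> G i p = partial i F p"
proof
  \<comment> \<open>The factor \<open>t ^ 0\<close> puts the integral into the shape of
    \<open>smooth_on_integral_segment\<close>.\<close>
  let ?G = "\<lambda>i x. integral {0..1} (\<lambda>t. t ^ 0 * partial i F (p + t *\<^sub>R (x - p)))"
  show "smooth_on (ball p r) (?G i)" for i
    by (intro smooth_on_integral_segment smooth_on_partial F)
  show "?G i p = partial i F p" if "r > 0" for i by simp
  show "F x = F p + (\<Sum>i\<in>UNIV. (x $ i - p $ i) * ?G i x)" if x: "x \<in> ball p r" for x
  proof -
    have seg: "p + t *\<^sub>R (x - p) \<in> ball p r" if "t \<in> {0..1}" for t
    proof -
      have "norm (t *\<^sub>R (x - p)) \<le> norm (x - p)"
        using that by (auto intro: mult_left_le_one_le)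
      then show ?thesis using x by (simp add: dist_norm norm_minus_commute)
    qed
    have cont: "continuous_on {0..1} (\<lambda>t. partial i F (p + t *\<^sub>R (x - p)))" for i
      by (rule continuous_on_compose2[OF smooth_on_continuous[OF smooth_on_partial[OF F]]])
        (auto intro!: continuous_intros seg simp del: mem_ball)
    have "((\<lambda>t. \<Sum>i\<in>UNIV. (x $ i - p $ i) * partial i F (p + t *\<^sub>R (x - p))) has_integral
        F (p + 1 *\<^sub>R (x - p)) - F (p + 0 *\<^sub>R (x - p))) {0..1}"
    proof (rule fundamental_theorem_of_calculus)
      fix t :: real assume t: "t \<in> {0..1}"
      have "(F has_derivative (\<lambda>v. \<Sum>i\<in>UNIV. v $ i * partial i F (p + t *\<^sub>R (x - p)))) (at (p + t *\<^sub>R (x - p)))"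
        using t by (intro has_derivative_partial smooth_on_differentiable[OF F] seg) auto
      moreover have "((\<lambda>t. p + t *\<^sub>R (x - p)) has_derivative (\<lambda>h. h *\<^sub>R (x - p))) (at t within {0..1})"
        by (auto intro!: derivative_eq_intros)
      ultimately have "((\<lambda>t. F (p + t *\<^sub>R (x - p))) has_derivative
          (\<lambda>h. \<Sum>i\<in>UNIV. (h *\<^sub>R (x - p)) $ i * partial i F (p + t *\<^sub>R (x - p)))) (at t within {0..1})"
        using has_derivative_compose by blast
      then show "((\<lambda>t. F (p + t *\<^sub>R (x - p))) has_vector_derivative
          (\<Sum>i\<in>UNIV. (x $ i - p $ i) * partial i F (p + t *\<^sub>R (x - p)))) (at t within {0..1})"
        unfolding has_vector_derivative_def
        by (rule has_derivative_eq_rhs) (simp add: fun_eq_iff sum_distrib_left algebra_simps)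
    qed simp
    then have "integral {0..1} (\<lambda>t. \<Sum>i\<in>UNIV. (x $ i - p $ i) * partial i F (p + t *\<^sub>R (x - p))) = F x - F p"
      by (simp add: integral_unique)
    moreover have "integral {0..1} (\<lambda>t. \<Sum>i\<in>UNIV. (x $ i - p $ i) * partial i F (p + t *\<^sub>R (x - p))) =
        (\<Sum>i\<in>UNIV. (x $ i - p $ i) * ?G i x)"
      by (subst integral_sum)
        (auto intro!: integrable_on_mult_right integrable_continuous_interval[OF cont])
    ultimately show ?thesis by simp
  qed
qed

section \<open>Unique continuation of Killing fields\<close>

lemma partial_diff_const: "partial i (\<lambda>x. f x - c) x = partial i f x"
proof -
  have "((\<lambda>x. f x - c) has_derivative D) (at x) \<longleftrightarrow> (f has_derivative D) (at x)" for D
    using has_derivative_add_const[of "\<lambda>x. f x - c" D "at x" c]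
      has_derivative_add_const[of f D "at x" "- c"] by auto
  then show ?thesis by (simp add: partial_def frechet_derivative_def)
qed

text \<open>Differentiating Hadamard's expansion F = F(p) + sum (x_i - p_i) G_i twice at p gives d_i
  G_j + d_j G_i, which is visibly symmetric.\<close>

lemma partial_commute:
  fixes F :: "real^'n::finite \<Rightarrow> real"
  assumes "open U" "smooth_on U F" "p \<in> U"
  shows "partial i (partial j F) p = partial j (partial i F) p"
proof -
  obtain r where r: "r > 0" "ball p r \<subseteq> U"
    using assms openE by blast
  obtain G where G: "\<And>i. smooth_on (ball p r) (G i)"
    and FG: "\<And>x. x \<in> ball p r \<Longrightarrow> F x = F p + (\<Sum>i\<in>UNIV. (x $ i - p $ i) * G i x)"
    by (rule hadamard[OF smooth_on_subset[OF assms(2) r(2)]]) blast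
  have Gd: "G i differentiable at x" if "x \<in> ball p r" for i x
    using G smooth_on_differentiable that by blast
  have nd: "(\<lambda>x. x $ i - p $ i) differentiable at x" for i x
    by (simp add: bounded_linear_imp_differentiable bounded_linear_vec_nth)
  have pn: "partial j (\<lambda>x. x $ i - p $ i) x = (if j = i then 1 else 0)" for i j x
    by (simp add: partial_diff_const partial_nth)
  have dF: "partial j F x = G j x + (\<Sum>i\<in>UNIV. (x $ i - p $ i) * partial j (G i) x)"
    if x: "x \<in> ball p r" for j x
  proof -
    have "partial j F x = partial j (\<lambda>x. F p + (\<Sum>i\<in>UNIV. (x $ i - p $ i) * G i x)) x"
      using FG x by (intro partial_cong[of "ball p r"]) auto
    also have "\<dots> = (\<Sum>i\<in>UNIV. partial j (\<lambda>x. (x $ i - p $ i) * G i x) x)"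
      using Gd[OF x] nd by (subst partial_add) (auto simp: partial_sum intro!: differentiable_sum differentiable_mult)
    also have "\<dots> = (\<Sum>i\<in>UNIV. (if j = i then 1 else 0) * G i x + (x $ i - p $ i) * partial j (G i) x)"
      using Gd[OF x] nd by (intro sum.cong) (auto simp: partial_mult pn)
    also have "\<dots> = G j x + (\<Sum>i\<in>UNIV. (x $ i - p $ i) * partial j (G i) x)"
      by (simp add: sum.distrib if_distrib[of "\<lambda>c. c * _"] cong: if_cong)
    finally show ?thesis .
  qed
  have "partial i (partial j F) p = partial i (G j) p + partial j (G i) p" for i j
  proof -
    have Gd': "partial j (G i) differentiable at p" for i j
      using smooth_on_differentiable[OF smooth_on_partial[OF G]] r(1) by simp
    have "partial i (partial j F) p =
        partial i (\<lambda>x. G j x + (\<Sum>i\<in>UNIV. (x $ i - p $ i) * partial j (G i) x)) p"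
      using dF r(1) by (intro partial_cong[of "ball p r"]) auto
    also have "\<dots> = partial i (G j) p + (\<Sum>k\<in>UNIV. partial i (\<lambda>x. (x $ k - p $ k) * partial j (G k) x) p)"
      using Gd[of p j] Gd' nd r(1)
      by (subst partial_add) (auto simp: partial_sum intro!: differentiable_sum differentiable_mult)
    also have "\<dots> = partial i (G j) p + (\<Sum>k\<in>UNIV. (if i = k then 1 else 0) * partial j (G k) p)"
      using Gd' nd by (simp add: partial_mult pn)
    also have "\<dots> = partial i (G j) p + partial j (G i) p"
      by (simp add: if_distrib[of "\<lambda>c. c * _"] cong: if_cong)
    finally show ?thesis .
  qed
  then show ?thesis by simp
qed

text \<open>A first-order linear differential inequality forces a solution with a zero to vanish
  nearby: on a ball so small that the mean value theorem halves the supremum of the solution.\<close>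

lemma vanishes_near_zero:
  fixes u :: "'a::finite \<Rightarrow> real^'n::finite \<Rightarrow> real"
  assumes "open U" "p \<in> U"
    and diff: "\<And>a x. x \<in> U \<Longrightarrow> u a differentiable at x"
    and bound: "\<And>a i x. x \<in> U \<Longrightarrow> \<bar>partial i (u a) x\<bar> \<le> K * (\<Sum>b\<in>UNIV. \<bar>u b x\<bar>)"
    and zero: "\<And>a. u a p = 0"
  obtains r where "r > 0" "\<And>x a. x \<in> ball p r \<Longrightarrow> u a x = 0"
proof -
  define s where "s x = (\<Sum>b\<in>UNIV. \<bar>u b x\<bar>)" for x
  define C where "C = real CARD('n) * \<bar>K\<bar>"
  have C: "C \<ge> 0" by (simp add: C_def)
  obtain e where e: "e > 0" "cball p e \<subseteq> U"
    using assms open_contains_cball by blast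
  \<comment> \<open>\<open>C * s y\<close> bounds the operator norm of the derivative on the ball,
    where \<open>s y\<close> is the maximum of s. The radius makes the sum over all components gain
    at most the factor \<open>CARD('a) * C * r\<close>, which is at most 1/2; the summand 1 keeps
    the denominator positive.\<close>
  define r where "r = min e (1 / (2 * (real CARD('a) * C + 1)))"
  have den: "2 * (real CARD('a) * C + 1) > 0" using C by (simp add: add_nonneg_pos)
  then have r0: "r > 0" using e by (simp add: r_def)
  have "r \<le> 1 / (2 * (real CARD('a) * C + 1))" by (simp add: r_def)
  then have "r * (2 * (real CARD('a) * C + 1)) \<le> 1" using den by (simp add: pos_le_divide_eq)
  then have small: "real CARD('a) * C * r \<le> 1 / 2" using r0 by (simp add: algebra_simps)
  have sub: "cball p r \<subseteq> U" using e by (auto simp: r_def)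
  have "continuous_on (cball p r) (u a)" for a
    by (intro continuous_at_imp_continuous_on ballI differentiable_imp_continuous_within diff)
      (use sub in blast)
  then have "continuous_on (cball p r) s"
    unfolding s_def[abs_def] by (intro continuous_intros)
  \<comment> \<open>At the maximum point y of s, the mean value theorem from the zero p will give s
    y at most half of s y.\<close>
  then obtain y where y: "y \<in> cball p r" "\<And>x. x \<in> cball p r \<Longrightarrow> s x \<le> s y"
    using continuous_attains_sup[of "cball p r" s] r0 by auto
  have s0: "s x \<ge> 0" for x by (simp add: s_def sum_nonneg)
  have le: "\<bar>u a x\<bar> \<le> C * s y * r" if x: "x \<in> cball p r" for a x
  proof -
    have "norm (u a x - u a p) \<le> C * s y * norm (x - p)"
    proof (rule differentiable_bound[of "cball p r" "u a" "\<lambda>x v. \<Sum>i\<in>UNIV. v $ i * partial i (u a) x"])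
      show "(u a has_derivative (\<lambda>v. \<Sum>i\<in>UNIV. v $ i * partial i (u a) z)) (at z within cball p r)"
        if "z \<in> cball p r" for z
        by (rule has_derivative_at_withinI[OF has_derivative_partial[OF diff[OF subsetD[OF sub that]]]])
      show "onorm (\<lambda>v. \<Sum>i\<in>UNIV. v $ i * partial i (u a) z) \<le> C * s y" if z: "z \<in> cball p r" for z
      proof (rule onorm_bound)
        show "0 \<le> C * s y" using C s0 by simp
        fix v :: "real^'n"
        have "\<bar>partial i (u a) z\<bar> \<le> \<bar>K\<bar> * s y" for i
        proof -
          have "\<bar>partial i (u a) z\<bar> \<le> K * s z" using bound z sub unfolding s_def by blast
          also have "\<dots> \<le> \<bar>K\<bar> * s z" using s0 by (intro mult_right_mono) auto
          also have "\<dots> \<le> \<bar>K\<bar> * s y" using y z by (intro mult_left_mono) auto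
          finally show ?thesis .
        qed
        then have "\<bar>v $ i * partial i (u a) z\<bar> \<le> norm v * (\<bar>K\<bar> * s y)" for i
          unfolding abs_mult using component_le_norm_cart s0
          by (intro mult_mono) auto
        then have "\<bar>\<Sum>i\<in>UNIV. v $ i * partial i (u a) z\<bar> \<le> (\<Sum>i\<in>(UNIV::'n set). norm v * (\<bar>K\<bar> * s y))"
          by (intro order_trans[OF sum_abs] sum_mono) auto
        then show "norm (\<Sum>i\<in>UNIV. v $ i * partial i (u a) z) \<le> C * s y * norm v"
          by (simp add: C_def algebra_simps)
      qed
    qed (use x r0 in auto)
    also have "\<dots> \<le> C * s y * r"
      using x C s0 by (intro mult_left_mono) (auto simp: dist_norm norm_minus_commute)
    finally show ?thesis using zero by simp
  qed
  have "s y \<le> (\<Sum>a\<in>(UNIV::'a set). C * s y * r)"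
    unfolding s_def[of y] using le[OF y(1)] by (intro sum_mono) (simp add: s_def)
  also have "\<dots> = (real CARD('a) * C * r) * s y" by simp
  also have "\<dots> \<le> 1 / 2 * s y" using small s0 by (intro mult_right_mono)
  finally have "s y = 0" using s0[of y] by linarith
  then have "u a x = 0" if "x \<in> ball p r" for a x
    using le[of x a] that by simp
  then show ?thesis using that r0 by blast
qed

text \<open>An injective linear map is bounded below, and a small perturbation keeps half of the
  bound. This allows solving for the components of v with one constant valid on a whole
  neighbourhood of p.\<close>

lemma nondegenerate_lower_bound:
  fixes \<gamma> :: "'n::finite \<Rightarrow> 'n \<Rightarrow> real^'n \<Rightarrow> real"
  assumes cont: "\<And>k j. isCont (\<gamma> k j) p"
    and nondeg: "\<And>v. (\<And>j. (\<Sum>k\<in>UNIV. v k * \<gamma> k j p) = 0) \<Longrightarrow> v = (\<lambda>k. 0)"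
  obtains c r where "c > 0" "r > 0"
    "\<And>x v k. x \<in> ball p r \<Longrightarrow> \<bar>v k\<bar> \<le> c * (\<Sum>j\<in>UNIV. \<bar>\<Sum>k\<in>UNIV. v k * \<gamma> k j x\<bar>)"
proof -
  define L where "L v = (\<chi> j. \<Sum>k\<in>UNIV. v $ k * \<gamma> k j p)" for v :: "real^'n"
  have lin: "linear L"
    by (rule linearI)
      (simp_all add: L_def vec_eq_iff sum.distrib sum_distrib_left algebra_simps)
  have "inj L"
  proof (subst linear_injective_0[OF lin], intro allI impI)
    fix v assume "L v = 0"
    then have "(\<lambda>k. v $ k) = (\<lambda>k. 0)" by (intro nondeg) (simp add: L_def vec_eq_iff)
    then show "v = 0" by (simp add: vec_eq_iff fun_eq_iff)
  qed
  then obtain B where B: "B > 0" "\<And>v. B * norm v \<le> norm (L v)"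
    using linear_inj_bounded_below_pos[OF lin] by blast
  define N where "N = real CARD('n)"
  have N: "N > 0" by (simp add: N_def)
  \<comment> \<open>Perturbing each coefficient by less than \<open>\<delta>\<close> changes the sum
    of the N components, each a sum of N terms, by at most
    \<open>N * (N * (\<delta> * norm w))\<close>, which is half of the lower bound
    \<open>B * norm w\<close>.\<close>
  define \<delta> where "\<delta> = B / (2 * (N * N))"
  have \<delta>: "\<delta> > 0" using B N by (simp add: \<delta>_def)
  have "\<forall>\<^sub>F x in nhds p. \<forall>k j. \<bar>\<gamma> k j x - \<gamma> k j p\<bar> < \<delta>"
  proof (intro eventually_all_finite)
    fix k j
    show "\<forall>\<^sub>F x in nhds p. \<bar>\<gamma> k j x - \<gamma> k j p\<bar> < \<delta>"
      using tendstoD[OF cont[of k j, unfolded isCont_def tendsto_at_iff_tendsto_nhds] \<delta>]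
      by (simp add: dist_real_def)
  qed
  then obtain r where r: "r > 0" "\<And>x k j. x \<in> ball p r \<Longrightarrow> \<bar>\<gamma> k j x - \<gamma> k j p\<bar> < \<delta>"
    unfolding eventually_nhds_metric by (auto simp: dist_commute)
  show ?thesis
  proof (rule that[of "2 / B" r])
    fix x and v :: "'n \<Rightarrow> real" and k assume x: "x \<in> ball p r"
    define w where "w = vec_lambda v"
    have w: "w $ k = v k" for k by (simp add: w_def)
    have "\<bar>L w $ j\<bar> \<le> \<bar>\<Sum>k\<in>UNIV. v k * \<gamma> k j x\<bar> + N * (\<delta> * norm w)" for j
    proof -
      have "\<bar>(\<Sum>k\<in>UNIV. v k * (\<gamma> k j x - \<gamma> k j p))\<bar> \<le> (\<Sum>k\<in>(UNIV::'n set). norm w * \<delta>)"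
      proof (intro order_trans[OF sum_abs] sum_mono)
        fix k
        show "\<bar>v k * (\<gamma> k j x - \<gamma> k j p)\<bar> \<le> norm w * \<delta>"
          unfolding abs_mult using r(2)[OF x, of k j] component_le_norm_cart[of w k]
          by (intro mult_mono) (auto simp: w)
      qed
      then have "\<bar>(\<Sum>k\<in>UNIV. v k * \<gamma> k j x) - L w $ j\<bar> \<le> N * (\<delta> * norm w)"
        by (simp add: L_def w sum_subtractf right_diff_distrib N_def mult.commute)
      then show ?thesis by linarith
    qed
    then have "(\<Sum>j\<in>UNIV. \<bar>L w $ j\<bar>) \<le>
        (\<Sum>j\<in>UNIV. \<bar>\<Sum>k\<in>UNIV. v k * \<gamma> k j x\<bar> + N * (\<delta> * norm w))"
      by (intro sum_mono) auto
    also have "\<dots> = (\<Sum>j\<in>UNIV. \<bar>\<Sum>k\<in>UNIV. v k * \<gamma> k j x\<bar>) + N * (N * (\<delta> * norm w))"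
      by (simp add: sum.distrib N_def)
    finally have "B * norm w \<le> (\<Sum>j\<in>UNIV. \<bar>\<Sum>k\<in>UNIV. v k * \<gamma> k j x\<bar>) + N * (N * (\<delta> * norm w))"
      using B(2)[of w] norm_le_l1_cart[of "L w"] by linarith
    moreover have "N * (N * (\<delta> * norm w)) = B / 2 * norm w"
      using N by (simp add: \<delta>_def field_simps)
    ultimately have "B / 2 * norm w \<le> (\<Sum>j\<in>UNIV. \<bar>\<Sum>k\<in>UNIV. v k * \<gamma> k j x\<bar>)" by linarith
    then have "norm w \<le> 2 / B * (\<Sum>j\<in>UNIV. \<bar>\<Sum>k\<in>UNIV. v k * \<gamma> k j x\<bar>)"
      using B(1) by (simp add: field_simps)
    then show "\<bar>v k\<bar> \<le> 2 / B * (\<Sum>j\<in>UNIV. \<bar>\<Sum>k\<in>UNIV. v k * \<gamma> k j x\<bar>)"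
      using component_le_norm_cart[of w k] by (simp add: w)
  qed (use B r in auto)
qed

text \<open>Killing's equation together with its first derivatives expresses the second derivatives of
  a Killing field linearly through its 1-jet (the Christoffel permutation trick).\<close>

lemma killing_field_vanishes_near:
  fixes X :: "'n::finite \<Rightarrow> real^'n \<Rightarrow> real" and \<gamma> :: "'n \<Rightarrow> 'n \<Rightarrow> real^'n \<Rightarrow> real"
  assumes U: "open U" "p \<in> U"
    and X: "\<And>k. smooth_on U (X k)" and \<gamma>: "\<And>i j. smooth_on U (\<gamma> i j)"
    and sym: "\<And>i j x. x \<in> U \<Longrightarrow> \<gamma> i j x = \<gamma> j i x"
    and killing: "\<And>i j x. x \<in> U \<Longrightarrow> (\<Sum>k\<in>UNIV. X k x * partial k (\<gamma> i j) x +
      partial i (X k) x * \<gamma> k j x + partial j (X k) x * \<gamma> i k x) = 0"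
    and nondeg: "\<And>v. (\<And>j. (\<Sum>k\<in>UNIV. v k * \<gamma> k j p) = 0) \<Longrightarrow> v = (\<lambda>k. 0)"
    and jet: "\<And>k. X k p = 0" "\<And>i k. partial i (X k) p = 0"
  obtains r where "r > 0" "\<And>x k. x \<in> ball p r \<Longrightarrow> X k x = 0"
proof -
  define N where "N = real CARD('n)"
  \<comment> \<open>The 1-jet as one finite family: \<open>(None, k)\<close> is a component of the
    field, \<open>(Some i, k)\<close> one of its partial derivatives.\<close>
  define u where "u a = (case a of (None, k) \<Rightarrow> X k | (Some i, k) \<Rightarrow> partial i (X k))" for a
  define s where "s x = (\<Sum>b\<in>UNIV. \<bar>u b x\<bar>)" for x
  have us: "\<bar>u b x\<bar> \<le> s x" for b x
    unfolding s_def by (rule member_le_sum) auto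
  have Xs: "\<bar>X k x\<bar> \<le> s x" "\<bar>partial i (X k) x\<bar> \<le> s x" for i k x
    using us[of "(None, k)"] us[of "(Some i, k)"] by (simp_all add: u_def)
  have s0: "s x \<ge> 0" for x by (simp add: s_def sum_nonneg)
  obtain c e0 where c: "c > 0" "e0 > 0"
    "\<And>x v k. x \<in> ball p e0 \<Longrightarrow> \<bar>v k\<bar> \<le> c * (\<Sum>j\<in>UNIV. \<bar>\<Sum>k\<in>UNIV. v k * \<gamma> k j x\<bar>)"
  proof (rule nondegenerate_lower_bound[where \<gamma> = \<gamma> and p = p])
    show "isCont (\<gamma> k j) p" for k j
      using smooth_on_continuous[OF \<gamma>] U continuous_on_eq_continuous_at by blast
  qed (use nondeg in blast)+
  obtain e1 where e1: "e1 > 0" "cball p e1 \<subseteq> U"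
    using U open_contains_cball by blast
  \<comment> \<open>A single continuous function dominating all first and second derivatives of the
    metric coefficients; its maximum on the closed ball serves as the common bound
    \<open>L\<close>.\<close>
  define h where "h x = (\<Sum>i\<in>UNIV. \<Sum>j\<in>UNIV. \<Sum>k\<in>UNIV. \<bar>partial k (\<gamma> i j) x\<bar>) +
    (\<Sum>i\<in>UNIV. \<Sum>j\<in>UNIV. \<Sum>k\<in>UNIV. \<Sum>l\<in>UNIV. \<bar>partial l (partial k (\<gamma> i j)) x\<bar>)" for x
  have "continuous_on (cball p e1) h"
    unfolding h_def[abs_def]
    by (intro continuous_intros smooth_on_continuous smooth_on_partial smooth_on_subset[OF \<gamma> e1(2)])
  then have "\<exists>y\<in>cball p e1. \<forall>x\<in>cball p e1. h x \<le> h y"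
    using e1(1) by (intro continuous_attains_sup) auto
  then obtain y where y: "\<And>x. x \<in> cball p e1 \<Longrightarrow> h x \<le> h y" by blast
  define L where "L = h y"
  have L1: "\<bar>partial k (\<gamma> i j) x\<bar> \<le> L" if "x \<in> cball p e1" for i j k x
  proof -
    have "\<bar>partial k (\<gamma> i j) x\<bar> \<le> (\<Sum>k\<in>UNIV. \<bar>partial k (\<gamma> i j) x\<bar>)"
      by (rule member_le_sum) auto
    also have "\<dots> \<le> (\<Sum>j\<in>UNIV. \<Sum>k\<in>UNIV. \<bar>partial k (\<gamma> i j) x\<bar>)"
      by (rule member_le_sum) (auto intro: sum_nonneg)
    also have "\<dots> \<le> (\<Sum>i\<in>UNIV. \<Sum>j\<in>UNIV. \<Sum>k\<in>UNIV. \<bar>partial k (\<gamma> i j) x\<bar>)"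
      by (rule member_le_sum[of i UNIV "\<lambda>i. \<Sum>j\<in>UNIV. \<Sum>k\<in>UNIV. \<bar>partial k (\<gamma> i j) x\<bar>"])
        (auto intro!: sum_nonneg)
    also have "\<dots> \<le> h x" by (simp add: h_def sum_nonneg)
    finally show ?thesis using y[OF that] by (simp add: L_def)
  qed
  have L2: "\<bar>partial l (partial k (\<gamma> i j)) x\<bar> \<le> L" if "x \<in> cball p e1" for i j k l x
  proof -
    have "\<bar>partial l (partial k (\<gamma> i j)) x\<bar> \<le> (\<Sum>l\<in>UNIV. \<bar>partial l (partial k (\<gamma> i j)) x\<bar>)"
      by (rule member_le_sum) auto
    also have "\<dots> \<le> (\<Sum>k\<in>UNIV. \<Sum>l\<in>UNIV. \<bar>partial l (partial k (\<gamma> i j)) x\<bar>)"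
      by (rule member_le_sum) (auto intro: sum_nonneg)
    also have "\<dots> \<le> (\<Sum>j\<in>UNIV. \<Sum>k\<in>UNIV. \<Sum>l\<in>UNIV. \<bar>partial l (partial k (\<gamma> i j)) x\<bar>)"
      by (rule member_le_sum[of j UNIV "\<lambda>j. \<Sum>k\<in>UNIV. \<Sum>l\<in>UNIV. \<bar>partial l (partial k (\<gamma> i j)) x\<bar>"])
        (auto intro!: sum_nonneg)
    also have "\<dots> \<le> (\<Sum>i\<in>UNIV. \<Sum>j\<in>UNIV. \<Sum>k\<in>UNIV. \<Sum>l\<in>UNIV. \<bar>partial l (partial k (\<gamma> i j)) x\<bar>)"
      by (rule member_le_sum[of i UNIV "\<lambda>i. \<Sum>j\<in>UNIV. \<Sum>k\<in>UNIV. \<Sum>l\<in>UNIV. \<bar>partial l (partial k (\<gamma> i j)) x\<bar>"])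
        (auto intro!: sum_nonneg)
    also have "\<dots> \<le> h x" by (simp add: h_def sum_nonneg)
    finally show ?thesis using y[OF that] by (simp add: L_def)
  qed
  have L0: "L \<ge> 0" using L1[of p] e1(1) by (meson abs_ge_zero centre_in_cball less_imp_le order_trans)
  \<comment> \<open>\<open>T\<close> holds the second derivatives of the field with the upper index
    lowered by the metric; \<open>R\<close> collects the terms of the differentiated Killing
    equation that involve only the 1-jet.\<close>
  define T where "T l i j x = (\<Sum>k\<in>UNIV. partial l (partial i (X k)) x * \<gamma> k j x)" for l i j x
  define R where "R l i j x = (\<Sum>k\<in>UNIV. partial l (X k) x * partial k (\<gamma> i j) x +
    X k x * partial l (partial k (\<gamma> i j)) x + partial i (X k) x * partial l (\<gamma> k j) x +
    partial j (X k) x * partial l (\<gamma> i k) x)" for l i j x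
  have TR: "T l i j x + T l j i x = - R l i j x" if x: "x \<in> U" for l i j x
  proof -
    have d: "X k differentiable at x" "\<gamma> i j differentiable at x" "partial i (X k) differentiable at x"
      "partial k (\<gamma> i j) differentiable at x" for i j k
      using x X \<gamma> smooth_on_partial smooth_on_differentiable by blast+
    have "0 = partial l (\<lambda>x. \<Sum>k\<in>UNIV. X k x * partial k (\<gamma> i j) x +
        partial i (X k) x * \<gamma> k j x + partial j (X k) x * \<gamma> i k x) x"
      using partial_cong[OF U(1) x, of "\<lambda>x. \<Sum>k\<in>UNIV. X k x * partial k (\<gamma> i j) x +
        partial i (X k) x * \<gamma> k j x + partial j (X k) x * \<gamma> i k x" "\<lambda>x. 0"] killing by simp
    also have "\<dots> = (\<Sum>k\<in>UNIV. (partial l (X k) x * partial k (\<gamma> i j) x + X k x * partial l (partial k (\<gamma> i j)) x) +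
        (partial l (partial i (X k)) x * \<gamma> k j x + partial i (X k) x * partial l (\<gamma> k j) x) +
        (partial l (partial j (X k)) x * \<gamma> i k x + partial j (X k) x * partial l (\<gamma> i k) x))"
      using d by (simp add: partial_sum partial_add partial_mult)
    also have "\<dots> = R l i j x + T l i j x + T l j i x"
      using sym[OF x] by (simp add: R_def T_def sum.distrib)
    finally show ?thesis by linarith
  qed
  have Tsym: "T l i j x = T i l j x" if "x \<in> U" for l i j x
    unfolding T_def using partial_commute[OF U(1) X that] by simp
  have T: "\<bar>T l i j x\<bar> \<le> 6 * N * L * s x" if x: "x \<in> cball p e1" for l i j x
  proof -
    have xU: "x \<in> U" using e1 x by blast
    have R: "\<bar>R l i j x\<bar> \<le> 4 * N * L * s x" for l i j
    proof -
      have prod: "\<bar>a * b\<bar> \<le> L * s x" if "\<bar>a\<bar> \<le> s x" "\<bar>b\<bar> \<le> L" for a b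
        using mult_mono[OF that] s0[of x] by (simp add: abs_mult mult.commute)
      have "\<bar>R l i j x\<bar> \<le> (\<Sum>k\<in>(UNIV::'n set). 4 * (L * s x))"
        unfolding R_def
      proof (intro order_trans[OF sum_abs] sum_mono)
        fix k
        show "\<bar>partial l (X k) x * partial k (\<gamma> i j) x + X k x * partial l (partial k (\<gamma> i j)) x +
            partial i (X k) x * partial l (\<gamma> k j) x + partial j (X k) x * partial l (\<gamma> i k) x\<bar> \<le> 4 * (L * s x)"
          using prod[OF Xs(2)[of l k x] L1[OF x, of k i j]] prod[OF Xs(1)[of k x] L2[OF x, of l k i j]]
            prod[OF Xs(2)[of i k x] L1[OF x, of l k j]] prod[OF Xs(2)[of j k x] L1[OF x, of l i k]]
          by linarith
      qed
      then show ?thesis by (simp add: N_def algebra_simps)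
    qed
    \<comment> \<open>The equations for (l,i,j) and (i,l,j) minus the one for (j,l,i); by symmetry
      of T in its first two indices everything but 2 T cancels. Half of three bounds 4 N L s gives
      the constant 6.\<close>
    have "2 * T l i j x = - R l i j x - R i l j x + R j l i x"
      using TR[OF xU, of l i j] TR[OF xU, of i l j] TR[OF xU, of j l i]
        Tsym[OF xU, of i l j] Tsym[OF xU, of i j l] Tsym[OF xU, of l j i] by linarith
    then show ?thesis using R[of l i j] R[of i l j] R[of j l i] by linarith
  qed
  \<comment> \<open>The summand 1 serves the field components, whose derivatives are themselves
    entries of the 1-jet; the other summand bounds the second derivatives.\<close>
  define K where "K = 1 + c * N * (6 * N * L)"
  define V where "V = ball p (min e0 e1)"
  have V: "V \<subseteq> U" "V \<subseteq> cball p e1" "V \<subseteq> ball p e0" "open V" "p \<in> V"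
    using e1 c(2) by (auto simp: V_def)
  have second: "\<bar>partial l (partial i (X k)) x\<bar> \<le> c * N * (6 * N * L) * s x" if "x \<in> V" for l i k x
  proof -
    have "\<bar>partial l (partial i (X k)) x\<bar> \<le> c * (\<Sum>j\<in>UNIV. \<bar>T l i j x\<bar>)"
      using c(3)[of x "\<lambda>k. partial l (partial i (X k)) x" k] that V by (auto simp: T_def)
    also have "\<dots> \<le> c * (\<Sum>j\<in>(UNIV::'n set). 6 * N * L * s x)"
      using T that V c(1) by (intro mult_left_mono sum_mono) auto
    finally show ?thesis by (simp add: N_def algebra_simps)
  qed
  have cN: "0 \<le> c * N * (6 * N * L)" using c(1) L0 by (simp add: N_def)
  have bound: "\<bar>partial l (u a) x\<bar> \<le> K * (\<Sum>b\<in>UNIV. \<bar>u b x\<bar>)" if x: "x \<in> V" for a l x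
  proof -
    have K: "s x \<le> K * s x" "c * N * (6 * N * L) * s x \<le> K * s x"
      using mult_nonneg_nonneg[OF cN s0[of x]] s0[of x] by (auto simp: K_def algebra_simps)
    have "\<bar>partial l (u (o', k)) x\<bar> \<le> K * s x" for o' k
    proof (cases o')
      case None
      then show ?thesis using order_trans[OF Xs(2) K(1)] by (simp add: u_def)
    next
      case (Some i)
      then show ?thesis using order_trans[OF second[OF x] K(2)] by (simp add: u_def)
    qed
    then show ?thesis unfolding s_def by (cases a) blast
  qed
  have diff: "u a differentiable at x" if "x \<in> V" for a x
  proof -
    have "smooth_on U (u a)"
      using X smooth_on_partial by (auto simp: u_def split: prod.split option.split)
    then show ?thesis using that V(1) smooth_on_differentiable by blast
  qed
  have zero: "u a p = 0" for a
    using jet by (auto simp: u_def split: prod.split option.split)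
  obtain r where r: "r > 0" "\<And>x a. x \<in> ball p r \<Longrightarrow> u a x = 0"
    using vanishes_near_zero[of V p u K, OF V(4,5) diff bound zero] by blast
  then have "X k x = 0" if "x \<in> ball p r" for k x
    using r(2)[OF that, of "(None, k)"] by (simp add: u_def)
  with r(1) that show ?thesis by blast
qed

section \<open>Manifolds through their algebra of smooth functions\<close>

text \<open>Smooth functions on an abstract manifold, seen as an algebra of real functions that are
  extended by zero off the underlying space.\<close>

locale smooth_function_algebra =
  fixes T :: "'p topology"
    and C :: "('p \<Rightarrow> real) set"
    and At :: "('p set \<times> (real^'n::finite) set \<times> ('p \<Rightarrow> real^'n)) set"
  assumes C_outside: "f \<in> C \<Longrightarrow> m \<notin> topspace T \<Longrightarrow> f m = 0"
    and C_const: "(\<lambda>m. if m \<in> topspace T then c else 0) \<in> C"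
    and C_add: "f \<in> C \<Longrightarrow> h \<in> C \<Longrightarrow> (\<lambda>m. f m + h m) \<in> C"
    and C_mult: "f \<in> C \<Longrightarrow> h \<in> C \<Longrightarrow> (\<lambda>m. f m * h m) \<in> C"
    and atlas_cover: "m \<in> topspace T \<Longrightarrow> \<exists>U W \<phi>. (U, W, \<phi>) \<in> At \<and> m \<in> U"
    and atlas_open: "(U, W, \<phi>) \<in> At \<Longrightarrow> openin T U \<and> open W"
    and atlas_homeo: "(U, W, \<phi>) \<in> At \<Longrightarrow> homeomorphic_map (subtopology T U) (top_of_set W) \<phi>"
    and C_smooth: "(U, W, \<phi>) \<in> At \<Longrightarrow> f \<in> C \<Longrightarrow> smooth_on W (\<lambda>x. f (inv_into U \<phi> x))"
    and C_extend: "(U, W, \<phi>) \<in> At \<Longrightarrow> smooth_on W F \<Longrightarrow> compact K \<Longrightarrow> K \<subseteq> W \<Longrightarrow>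
      (\<And>x. x \<in> W - K \<Longrightarrow> F x = 0) \<Longrightarrow> (\<lambda>m. if m \<in> U then F (\<phi> m) else 0) \<in> C"
begin

text \<open>Nothing is required off \<open>C\<close>, so derivations that agree on \<open>C\<close>
  may still differ as functions. \<open>G_cong\<close> and \<open>lift_cong\<close> deal with
  this.\<close>

definition der :: "(('p \<Rightarrow> real) \<Rightarrow> 'p \<Rightarrow> real) \<Rightarrow> bool" where
  "der D \<longleftrightarrow> (\<forall>f \<in> C. D f \<in> C) \<and>
    (\<forall>f \<in> C. \<forall>h \<in> C. D (\<lambda>m. f m + h m) = (\<lambda>m. D f m + D h m)) \<and>
    (\<forall>c. \<forall>f \<in> C. D (\<lambda>m. c * f m) = (\<lambda>m. c * D f m)) \<and>
    (\<forall>f \<in> C. \<forall>h \<in> C. D (\<lambda>m. f m * h m) = (\<lambda>m. D f m * h m + f m * D h m))"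

text \<open>Tangent vectors at m, as point derivations. Having them apart from \<open>der\<close>
  lets the coordinate formula apply to vectors not yet known to extend to fields.\<close>

definition pder :: "'p \<Rightarrow> (('p \<Rightarrow> real) \<Rightarrow> real) \<Rightarrow> bool" where
  "pder m w \<longleftrightarrow>
    (\<forall>f \<in> C. \<forall>h \<in> C. w (\<lambda>m. f m + h m) = w f + w h) \<and>
    (\<forall>c. \<forall>f \<in> C. w (\<lambda>m. c * f m) = c * w f) \<and>
    (\<forall>f \<in> C. \<forall>h \<in> C. w (\<lambda>m. f m * h m) = w f * h m + f m * w h)"

definition lie :: "(('p \<Rightarrow> real) \<Rightarrow> 'p \<Rightarrow> real) \<Rightarrow> (('p \<Rightarrow> real) \<Rightarrow> 'p \<Rightarrow> real) \<Rightarrow> ('p \<Rightarrow> real) \<Rightarrow> 'p \<Rightarrow> real" where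
  "lie X Y = (\<lambda>f m. X (Y f) m - Y (X f) m)"

lemma der_closed: "der D \<Longrightarrow> f \<in> C \<Longrightarrow> D f \<in> C"
  and der_plus: "der D \<Longrightarrow> f \<in> C \<Longrightarrow> h \<in> C \<Longrightarrow> D (\<lambda>m. f m + h m) = (\<lambda>m. D f m + D h m)"
  and der_cmult: "der D \<Longrightarrow> f \<in> C \<Longrightarrow> D (\<lambda>m. c * f m) = (\<lambda>m. c * D f m)"
  and der_leibniz: "der D \<Longrightarrow> f \<in> C \<Longrightarrow> h \<in> C \<Longrightarrow>
    D (\<lambda>m. f m * h m) = (\<lambda>m. D f m * h m + f m * D h m)"
  by (auto simp: der_def)

lemma pder_der: "der D \<Longrightarrow> pder m (\<lambda>f. D f m)"
  by (simp add: der_def pder_def)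

lemma C_zero: "(\<lambda>m. 0) \<in> C"
  using C_const[of 0] by simp

lemma C_cmult: "f \<in> C \<Longrightarrow> (\<lambda>m. c * f m) \<in> C"
proof -
  assume f: "f \<in> C"
  then have "(\<lambda>m. (if m \<in> topspace T then c else 0) * f m) = (\<lambda>m. c * f m)"
    using C_outside by fastforce
  with C_mult[OF C_const[of c] f] show ?thesis by simp
qed

lemma C_diff: "f \<in> C \<Longrightarrow> h \<in> C \<Longrightarrow> (\<lambda>m. f m - h m) \<in> C"
  using C_add[of f "\<lambda>m. - 1 * h m"] C_cmult[of h "-1"] by simp

lemma C_sum: "(\<And>a. a \<in> A \<Longrightarrow> f a \<in> C) \<Longrightarrow> (\<lambda>m. \<Sum>a\<in>A. f a m) \<in> C"
proof (induction A rule: infinite_finite_induct)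
  case (insert a A)
  then show ?case using C_add[of "f a" "\<lambda>m. \<Sum>a\<in>A. f a m"] by simp
qed (simp_all add: C_zero)

lemma der_add:
  assumes "der X" "der Y"
  shows "der (\<lambda>f m. X f m + Y f m)"
  using assms unfolding der_def by (auto simp: C_add algebra_simps fun_eq_iff)

lemma der_scale:
  assumes "f \<in> C" "der X"
  shows "der (\<lambda>h m. f m * X h m)"
  using assms unfolding der_def by (auto simp: C_mult algebra_simps fun_eq_iff)

lemma der_zero: "der (\<lambda>f m. 0)"
  by (simp add: der_def C_zero)

lemma der_sum: "(\<And>a. a \<in> A \<Longrightarrow> der (X a)) \<Longrightarrow> der (\<lambda>f m. \<Sum>a\<in>A. X a f m)"
proof (induction A rule: infinite_finite_induct)
  case (insert a A)
  then show ?case using der_add[of "X a" "\<lambda>f m. \<Sum>a\<in>A. X a f m"] by simp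
qed (simp_all add: der_zero)

lemma der_lie:
  assumes "der X" "der Y"
  shows "der (lie X Y)"
proof -
  have cl: "X f \<in> C" "Y f \<in> C" if "f \<in> C" for f
    using assms der_closed that by blast+
  note s = der_plus[OF assms(1)] der_plus[OF assms(2)] der_cmult[OF assms(1)] der_cmult[OF assms(2)]
    der_leibniz[OF assms(1)] der_leibniz[OF assms(2)]
  show ?thesis
    unfolding der_def lie_def
    by (auto simp: s cl C_add C_cmult C_mult C_diff algebra_simps fun_eq_iff)
qed

lemma pder_add: "pder m w \<Longrightarrow> f \<in> C \<Longrightarrow> h \<in> C \<Longrightarrow> w (\<lambda>m. f m + h m) = w f + w h"
  and pder_cmult: "pder m w \<Longrightarrow> f \<in> C \<Longrightarrow> w (\<lambda>m. c * f m) = c * w f"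
  and pder_mult: "pder m w \<Longrightarrow> f \<in> C \<Longrightarrow> h \<in> C \<Longrightarrow> w (\<lambda>m. f m * h m) = w f * h m + f m * w h"
  by (auto simp: pder_def)

lemma pder_const:
  assumes "pder m w" "m \<in> topspace T"
  shows "w (\<lambda>m. if m \<in> topspace T then c else 0) = 0"
proof -
  let ?e = "\<lambda>m. if m \<in> topspace T then 1 else 0 :: real"
  have "w (\<lambda>m. ?e m * ?e m) = w ?e * ?e m + ?e m * w ?e"
    by (rule pder_mult[OF assms(1) C_const C_const])
  moreover have "(\<lambda>m. ?e m * ?e m) = ?e" by auto
  ultimately have "w ?e = 0" using assms(2) by simp
  moreover have "w (\<lambda>m. c * ?e m) = c * w ?e"
    by (rule pder_cmult[OF assms(1) C_const])
  moreover have "(\<lambda>m. c * ?e m) = (\<lambda>m. if m \<in> topspace T then c else 0)" by auto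
  ultimately show ?thesis by simp
qed

lemma pder_sum:
  assumes "pder m w" "finite A" "\<And>a. a \<in> A \<Longrightarrow> f a \<in> C"
  shows "w (\<lambda>m. \<Sum>a\<in>A. f a m) = (\<Sum>a\<in>A. w (f a))"
  using assms(2,3)
proof (induction rule: finite_induct)
  case empty
  show ?case using pder_cmult[OF assms(1) C_zero, of 0] by simp
next
  case (insert a A)
  then show ?case by (simp add: pder_add[OF assms(1)] C_sum)
qed

lemma atlas_bij:
  assumes "(U, W, \<phi>) \<in> At"
  shows "\<phi> ` U = W" "inj_on \<phi> U"
proof -
  have "U \<subseteq> topspace T" using atlas_open[OF assms] openin_subset by blast
  then show "\<phi> ` U = W" "inj_on \<phi> U"
    using homeomorphic_imp_surjective_map[OF atlas_homeo[OF assms]]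
      homeomorphic_imp_injective_map[OF atlas_homeo[OF assms]] by (simp_all add: Int_absorb1)
qed

lemma atlas_inv:
  assumes "(U, W, \<phi>) \<in> At"
  shows "m \<in> U \<Longrightarrow> inv_into U \<phi> (\<phi> m) = m" "m \<in> U \<Longrightarrow> \<phi> m \<in> W"
    "x \<in> W \<Longrightarrow> inv_into U \<phi> x \<in> U" "x \<in> W \<Longrightarrow> \<phi> (inv_into U \<phi> x) = x"
  using atlas_bij[OF assms] by (auto simp: inv_into_into f_inv_into_f)

lemma atlas_subset: "(U, W, \<phi>) \<in> At \<Longrightarrow> m \<in> U \<Longrightarrow> m \<in> topspace T"
  using atlas_open openin_subset by blast

lemma openin_chart_preimage:
  assumes "(U, W, \<phi>) \<in> At" "open V"
  shows "openin T {m \<in> U. \<phi> m \<in> V}"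
proof -
  have "U \<subseteq> topspace T" using atlas_open[OF assms(1)] openin_subset by blast
  then have top: "topspace (subtopology T U) = U" by auto
  have "openin (top_of_set W) (V \<inter> W)" using assms(2) by (auto simp: openin_subtopology)
  from openin_continuous_map_preimage[OF homeomorphic_imp_continuous_map[OF atlas_homeo[OF assms(1)]] this]
  have "openin (subtopology T U) {m \<in> U. \<phi> m \<in> V \<inter> W}" unfolding top .
  then have "openin T {m \<in> U. \<phi> m \<in> V \<inter> W}"
    using atlas_open[OF assms(1)] openin_trans_full by blast
  moreover have "{m \<in> U. \<phi> m \<in> V \<inter> W} = {m \<in> U. \<phi> m \<in> V}"
    using atlas_inv[OF assms(1)] by auto
  ultimately show ?thesis by simp
qed

lemma openin_nonzero:
  assumes "f \<in> C"
  shows "openin T {m \<in> topspace T. f m \<noteq> 0}"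
proof (subst openin_subopen, intro ballI)
  fix m assume m: "m \<in> {m \<in> topspace T. f m \<noteq> 0}"
  then obtain U W \<phi> where ch: "(U, W, \<phi>) \<in> At" "m \<in> U" using atlas_cover by blast
  let ?V = "{x \<in> W. f (inv_into U \<phi> x) \<in> - {0}}"
  have "open ?V"
    using smooth_on_continuous[OF C_smooth[OF ch(1) assms]] atlas_open[OF ch(1)]
      continuous_open_preimage[of W "\<lambda>x. f (inv_into U \<phi> x)" "- {0}"]
    by (simp add: vimage_def Int_def open_Compl)
  then have "openin T {m \<in> U. \<phi> m \<in> ?V}" by (rule openin_chart_preimage[OF ch(1)])
  moreover have "m \<in> {m \<in> U. \<phi> m \<in> ?V}" using m ch atlas_inv[OF ch(1)] by auto
  moreover have "{m \<in> U. \<phi> m \<in> ?V} \<subseteq> {m \<in> topspace T. f m \<noteq> 0}"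
    using atlas_inv[OF ch(1)] atlas_subset[OF ch(1)] by auto
  ultimately show "\<exists>V. openin T V \<and> m \<in> V \<and> V \<subseteq> {m \<in> topspace T. f m \<noteq> 0}" by blast
qed

text \<open>Membership in \<open>C\<close> is a global condition, so a smooth function near a point
  must be multiplied by such an \<open>\<eta>\<close> before derivations can act on it.\<close>

lemma cutoff:
  assumes ch: "(U, W, \<phi>) \<in> At" and s: "s > 0" "ball x s \<subseteq> W"
  obtains \<eta> \<rho> where "0 < \<rho>" "\<rho> < s" "\<eta> \<in> C"
    "\<And>m. m \<in> U \<Longrightarrow> \<phi> m \<in> ball x \<rho> \<Longrightarrow> \<eta> m = 1"
    "\<And>m. m \<in> U \<Longrightarrow> \<phi> m \<notin> ball x s \<Longrightarrow> \<eta> m = 0" "\<And>m. m \<notin> U \<Longrightarrow> \<eta> m = 0"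
    "\<And>h. smooth_on (ball x s) h \<Longrightarrow> (\<lambda>m. \<eta> m * h (\<phi> m)) \<in> C"
proof -
  \<comment> \<open>The bump is 1 on radius s/4 and vanishes off radius s/2, which leaves a compact
    ball inside the open ball of radius s as the support required by
    \<open>C_extend\<close>.\<close>
  obtain b where b: "smooth_on UNIV b" "\<And>y. y \<in> cball x (s / 4) \<Longrightarrow> b y = 1"
    "\<And>y. y \<notin> ball x (2 * (s / 4)) \<Longrightarrow> b y = 0"
    using exists_bump[of "s / 4" x] s(1) by auto
  define \<eta> where "\<eta> m = (if m \<in> U then b (\<phi> m) else 0)" for m
  have sub: "cball x (s / 2) \<subseteq> ball x s" using s(1) by auto
  have zero: "b y = 0" if "y \<notin> cball x (s / 2)" for y using that by (intro b(3)) auto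
  have ext: "(\<lambda>m. \<eta> m * h (\<phi> m)) \<in> C" if h: "smooth_on (ball x s) h" for h
  proof -
    have "open W" using atlas_open[OF ch] by blast
    have "smooth_on (ball x s) (\<lambda>y. b y * h y)"
      by (intro smooth_on_mult h smooth_on_subset[OF b(1)]) auto
    moreover have "smooth_on (W - cball x (s / 2)) (\<lambda>y. b y * h y)"
      using smooth_on_cong[of "W - cball x (s / 2)" "\<lambda>y. b y * h y" "\<lambda>y. 0"] zero \<open>open W\<close>
      by (simp add: open_Diff)
    ultimately have "smooth_on (ball x s \<union> (W - cball x (s / 2))) (\<lambda>y. b y * h y)"
      using \<open>open W\<close> by (intro smooth_on_Un) (auto simp: open_Diff)
    moreover have "ball x s \<union> (W - cball x (s / 2)) = W" using sub s(2) by blast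
    ultimately have "smooth_on W (\<lambda>y. b y * h y)" by simp
    then have "(\<lambda>m. if m \<in> U then b (\<phi> m) * h (\<phi> m) else 0) \<in> C"
      by (rule C_extend[OF ch _ compact_cball[of x "s / 2"]]) (use sub s(2) zero in auto)
    moreover have "(\<lambda>m. if m \<in> U then b (\<phi> m) * h (\<phi> m) else 0) = (\<lambda>m. \<eta> m * h (\<phi> m))"
      by (auto simp: \<eta>_def)
    ultimately show ?thesis by simp
  qed
  show ?thesis
  proof (rule that[of "s / 4" \<eta>])
    show "\<eta> \<in> C" using ext[of "\<lambda>y. 1"] by simp
    show "\<eta> m = 0" if "m \<in> U" "\<phi> m \<notin> ball x s" for m
      using that(2) sub zero[of "\<phi> m"] by (auto simp: \<eta>_def simp del: mem_ball mem_cball)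
  qed (use s(1) b(2) ext in \<open>auto simp: \<eta>_def\<close>)
qed

end

text \<open>\<open>\<xi>\<close> and \<open>\<delta>\<close> are globally defined functions and fields that agree with the coordinates and
  the coordinate fields of the chart over \<open>ball p r\<close> only.\<close>

locale coordinate_frame = smooth_function_algebra T C At
  for T :: "'p topology" and C At +
  fixes U :: "'p set" and W :: "(real^'n::finite) set" and \<phi> p r
    and \<xi> :: "'n \<Rightarrow> 'p \<Rightarrow> real" and \<delta> :: "'n \<Rightarrow> ('p \<Rightarrow> real) \<Rightarrow> 'p \<Rightarrow> real"
  assumes chart: "(U, W, \<phi>) \<in> At" and r: "r > 0" "ball p r \<subseteq> W"
    and \<xi>_C: "\<xi> i \<in> C" and \<delta>_der: "der (\<delta> i)"
    and \<xi>: "x \<in> ball p r \<Longrightarrow> \<xi> i (inv_into U \<phi> x) = x $ i"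
    and \<delta>: "f \<in> C \<Longrightarrow> x \<in> ball p r \<Longrightarrow>
      \<delta> i f (inv_into U \<phi> x) = partial i (\<lambda>x. f (inv_into U \<phi> x)) x"
begin

abbreviation \<psi> where "\<psi> \<equiv> inv_into U \<phi>"

lemma ball_W: "x \<in> ball p r \<Longrightarrow> x \<in> W"
  using r by blast

lemma \<psi>: "x \<in> ball p r \<Longrightarrow> \<psi> x \<in> U" "x \<in> ball p r \<Longrightarrow> \<phi> (\<psi> x) = x"
    "x \<in> ball p r \<Longrightarrow> \<psi> x \<in> topspace T"
  using atlas_inv[OF chart] ball_W atlas_subset[OF chart] by auto

lemma rep_smooth: "f \<in> C \<Longrightarrow> smooth_on (ball p r) (\<lambda>x. f (\<psi> x))"
  using C_smooth[OF chart] smooth_on_subset r(2) by blast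

lemma cutoff_in_ball:
  assumes x: "x \<in> ball p r"
  obtains \<eta> s where "s > 0" "ball x s \<subseteq> ball p r" "\<eta> \<in> C" "\<eta> (\<psi> x) = 1"
    "\<And>m. \<eta> m \<noteq> 0 \<Longrightarrow> m \<in> U \<and> \<phi> m \<in> ball x s"
    "\<And>h. smooth_on (ball x s) h \<Longrightarrow> (\<lambda>m. \<eta> m * h (\<phi> m)) \<in> C"
proof -
  obtain s where s: "s > 0" "ball x s \<subseteq> ball p r"
    using x open_ball openE by blast
  have sub: "ball x s \<subseteq> W" using s(2) r(2) by blast
  obtain \<eta> \<rho> where \<eta>: "0 < \<rho>" "\<rho> < s" "\<eta> \<in> C"
    "\<And>m. m \<in> U \<Longrightarrow> \<phi> m \<in> ball x \<rho> \<Longrightarrow> \<eta> m = 1"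
    "\<And>m. m \<in> U \<Longrightarrow> \<phi> m \<notin> ball x s \<Longrightarrow> \<eta> m = 0" "\<And>m. m \<notin> U \<Longrightarrow> \<eta> m = 0"
    "\<And>h. smooth_on (ball x s) h \<Longrightarrow> (\<lambda>m. \<eta> m * h (\<phi> m)) \<in> C"
    by (rule cutoff[OF chart s(1) sub]) (rule that)
  show ?thesis
  proof (rule that[OF s \<eta>(3)])
    show "\<eta> (\<psi> x) = 1" using \<psi>[OF x] \<eta>(1,4) by simp
    show "m \<in> U \<and> \<phi> m \<in> ball x s" if "\<eta> m \<noteq> 0" for m using that \<eta>(5,6) by blast
  qed (rule \<eta>(7))
qed

text \<open>The classical argument: apply w to Hadamard's expansion; each factor y_i - x_i vanishes
  at the point, so by the Leibniz rule only its derivative w(\<xi>_i) survives, multiplied by the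
  partial derivative G_i(x).\<close>

lemma pder_formula:
  assumes x: "x \<in> ball p r" and w: "pder (\<psi> x) w" and f: "f \<in> C"
  shows "w f = (\<Sum>i\<in>UNIV. w (\<xi> i) * partial i (\<lambda>x. f (\<psi> x)) x)"
proof -
  define F where "F y = f (\<psi> y)" for y
  obtain \<eta> s where s: "s > 0" "ball x s \<subseteq> ball p r" and \<eta>: "\<eta> \<in> C" "\<eta> (\<psi> x) = 1"
    and supp: "\<And>m. \<eta> m \<noteq> 0 \<Longrightarrow> m \<in> U \<and> \<phi> m \<in> ball x s"
    and ext: "\<And>h. smooth_on (ball x s) h \<Longrightarrow> (\<lambda>m. \<eta> m * h (\<phi> m)) \<in> C"
    by (rule cutoff_in_ball[OF x]) (rule that)
  have "smooth_on (ball x s) F"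
    unfolding F_def by (rule smooth_on_subset[OF rep_smooth[OF f] s(2)])
  then obtain G where G: "\<And>i. smooth_on (ball x s) (G i)"
    and FG: "\<And>y. y \<in> ball x s \<Longrightarrow> F y = F x + (\<Sum>i\<in>UNIV. (y $ i - x $ i) * G i y)"
    and Gx: "\<And>i. G i x = partial i F x"
    using s(1) by (elim hadamard) blast
  define c where "c i m = (if m \<in> topspace T then - (x $ i) else 0)" for i m
  define u where "u i m = \<eta> m * (\<xi> i m + c i m)" for i m
  define v where "v i m = \<eta> m * G i (\<phi> m)" for i m
  have cC: "c i \<in> C" for i unfolding c_def[abs_def] by (rule C_const)
  have uC: "u i \<in> C" for i
    unfolding u_def[abs_def] by (intro C_mult C_add \<eta> \<xi>_C cC)
  have vC: "v i \<in> C" for i unfolding v_def[abs_def] by (rule ext[OF G])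
  have \<eta>\<eta>: "(\<lambda>m. \<eta> m * \<eta> m) \<in> C" by (intro C_mult \<eta>)
  \<comment> \<open>The expansion holds near the point only. Two factors \<open>\<eta>\<close> are
    needed to make it global: one goes into each of \<open>u i\<close> and \<open>v i\<close>, which
    must both lie in \<open>C\<close>.\<close>
  have id: "(\<lambda>m. (\<eta> m * \<eta> m) * f m) = (\<lambda>m. F x * (\<eta> m * \<eta> m) + (\<Sum>i\<in>UNIV. u i m * v i m))"
  proof
    fix m
    show "(\<eta> m * \<eta> m) * f m = F x * (\<eta> m * \<eta> m) + (\<Sum>i\<in>UNIV. u i m * v i m)"
    proof (cases "\<eta> m = 0")
      case False
      then have m: "m \<in> U" "\<phi> m \<in> ball x s" using supp by auto
      then have b: "\<phi> m \<in> ball p r" using s by blast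
      have inv: "\<psi> (\<phi> m) = m" using atlas_inv[OF chart] m by blast
      have "\<xi> i m = \<phi> m $ i" for i using \<xi>[OF b, of i] inv by simp
      then have "u i m * v i m = \<eta> m * \<eta> m * ((\<phi> m $ i - x $ i) * G i (\<phi> m))" for i
        using atlas_subset[OF chart m(1)] by (simp add: u_def v_def c_def)
      then have "(\<Sum>i\<in>UNIV. u i m * v i m) =
          \<eta> m * \<eta> m * (\<Sum>i\<in>UNIV. (\<phi> m $ i - x $ i) * G i (\<phi> m))"
        by (simp only: sum_distrib_left)
      moreover have "f m = F x + (\<Sum>i\<in>UNIV. (\<phi> m $ i - x $ i) * G i (\<phi> m))"
        using FG[OF m(2)] inv by (simp add: F_def)
      ultimately show ?thesis by (simp add: distrib_left mult.commute)
    qed (simp add: u_def)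
  qed
  have wu: "w (\<lambda>m. u i m * v i m) = w (\<xi> i) * G i x" for i
  proof -
    have u0: "u i (\<psi> x) = 0" using \<xi>[OF x] \<psi>(3)[OF x] by (simp add: u_def c_def)
    have v0: "v i (\<psi> x) = G i x" using \<eta>(2) \<psi>(2)[OF x] by (simp add: v_def)
    have "w (u i) = w \<eta> * (\<xi> i (\<psi> x) + c i (\<psi> x)) + \<eta> (\<psi> x) * w (\<lambda>m. \<xi> i m + c i m)"
      unfolding u_def[abs_def] using pder_mult[OF w \<eta>(1) C_add[OF \<xi>_C cC]] by simp
    also have "w (\<lambda>m. \<xi> i m + c i m) = w (\<xi> i)"
      using pder_add[OF w \<xi>_C cC] pder_const[OF w \<psi>(3)[OF x]] by (simp add: c_def[abs_def])
    finally have "w (u i) = w (\<xi> i)"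
      using \<eta>(2) \<xi>[OF x] \<psi>(3)[OF x] by (simp add: c_def)
    then show ?thesis using pder_mult[OF w uC vC] u0 v0 by simp
  qed
  \<comment> \<open>The unknown number w(\<eta>^2) times f at the point occurs on both sides and
    cancels.\<close>
  have "w (\<lambda>m. \<eta> m * \<eta> m) * f (\<psi> x) + w f = w (\<lambda>m. (\<eta> m * \<eta> m) * f m)"
    using pder_mult[OF w \<eta>\<eta> f] \<eta>(2) by simp
  also have "\<dots> = F x * w (\<lambda>m. \<eta> m * \<eta> m) + (\<Sum>i\<in>UNIV. w (\<lambda>m. u i m * v i m))"
    unfolding id
    by (simp add: pder_add[OF w] pder_sum[OF w] pder_cmult[OF w] C_cmult C_sum C_mult uC vC \<eta>\<eta>)
  also have "\<dots> = F x * w (\<lambda>m. \<eta> m * \<eta> m) + (\<Sum>i\<in>UNIV. w (\<xi> i) * partial i F x)"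
    by (simp add: wu Gx)
  finally show ?thesis by (simp add: F_def[abs_def])
qed

lemma der_formula:
  "der X \<Longrightarrow> f \<in> C \<Longrightarrow> x \<in> ball p r \<Longrightarrow>
    X f (\<psi> x) = (\<Sum>i\<in>UNIV. X (\<xi> i) (\<psi> x) * partial i (\<lambda>x. f (\<psi> x)) x)"
  using pder_formula[OF _ pder_der] by blast

text \<open>Derivations are local, since the coordinate formula involves f only through its partial
  derivatives at x.\<close>

lemma der_locally_zero:
  assumes "der X" "f \<in> C" "open V" "x \<in> V" "V \<subseteq> ball p r" "\<And>y. y \<in> V \<Longrightarrow> f (\<psi> y) = c"
  shows "X f (\<psi> x) = 0"
proof -
  have "partial i (\<lambda>x. f (\<psi> x)) x = partial i (\<lambda>x. c) x" for i
    using assms by (intro partial_cong) auto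
  then show ?thesis using der_formula[of X f x] assms by auto
qed

end

context smooth_function_algebra
begin

lemma frame_exists:
  assumes "m \<in> topspace T"
  obtains U W \<phi> r \<xi> \<delta> where "m \<in> U" "coordinate_frame T C At U W \<phi> (\<phi> m) r \<xi> \<delta>"
proof -
  obtain U W \<phi> where ch: "(U, W, \<phi>) \<in> At" "m \<in> U" using atlas_cover assms by blast
  have W: "open W" "\<phi> m \<in> W" using atlas_open[OF ch(1)] atlas_inv[OF ch(1)] ch(2) by auto
  then obtain s where s: "s > 0" "ball (\<phi> m) s \<subseteq> W" using openE by blast
  obtain \<eta> r where r: "0 < r" "r < s" and \<eta>: "\<eta> \<in> C"
    "\<And>m'. m' \<in> U \<Longrightarrow> \<phi> m' \<in> ball (\<phi> m) r \<Longrightarrow> \<eta> m' = 1"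
    "\<And>m'. m' \<in> U \<Longrightarrow> \<phi> m' \<notin> ball (\<phi> m) s \<Longrightarrow> \<eta> m' = 0" "\<And>m'. m' \<notin> U \<Longrightarrow> \<eta> m' = 0"
    and ext: "\<And>h. smooth_on (ball (\<phi> m) s) h \<Longrightarrow> (\<lambda>m. \<eta> m * h (\<phi> m)) \<in> C"
    by (rule cutoff[OF ch(1) s]) (rule that)
  let ?\<psi> = "inv_into U \<phi>"
  define \<xi> where "\<xi> i m = \<eta> m * \<phi> m $ i" for i m
  define \<delta> where "\<delta> i f m = \<eta> m * partial i (\<lambda>x. f (?\<psi> x)) (\<phi> m)" for i f m
  have diff: "(\<lambda>x. f (?\<psi> x)) differentiable at (\<phi> m')" if "f \<in> C" "\<eta> m' \<noteq> 0" for f m'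
    using smooth_on_differentiable[OF C_smooth[OF ch(1) that(1)]] \<eta>(4)[of m'] that(2)
      atlas_inv(2)[OF ch(1)] by blast
  have inv: "?\<psi> (\<phi> m') = m'" if "\<eta> m' \<noteq> 0" for m'
    using \<eta>(4) that atlas_inv(1)[OF ch(1)] by blast
  have one: "\<eta> (?\<psi> x) = 1" "\<phi> (?\<psi> x) = x" if "x \<in> ball (\<phi> m) r" for x
  proof -
    have "x \<in> W" using that s r by auto
    then show "\<eta> (?\<psi> x) = 1" "\<phi> (?\<psi> x) = x"
      using atlas_inv(3,4)[OF ch(1)] \<eta>(2)[of "?\<psi> x"] that by auto
  qed
  have "coordinate_frame T C At U W \<phi> (\<phi> m) r \<xi> \<delta>"
  proof
    show "(U, W, \<phi>) \<in> At" "r > 0" by fact+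
    show "ball (\<phi> m) r \<subseteq> W" using s r by auto
    show "\<xi> i \<in> C" for i
      unfolding \<xi>_def[abs_def] by (rule ext[OF smooth_on_nth])
    show "der (\<delta> i)" for i
      unfolding der_def
    proof (intro conjI ballI allI)
      fix f assume f: "f \<in> C"
      show "\<delta> i f \<in> C"
        unfolding \<delta>_def
        by (intro ext smooth_on_partial smooth_on_subset[OF C_smooth[OF ch(1) f] s(2)])
      show "\<delta> i (\<lambda>m. c * f m) = (\<lambda>m. c * \<delta> i f m)" for c
      proof
        fix m'
        show "\<delta> i (\<lambda>m. c * f m) m' = c * \<delta> i f m'"
          using diff[OF f] by (cases "\<eta> m' = 0") (auto simp: \<delta>_def partial_mult)
      qed
      fix h assume h: "h \<in> C"
      show "\<delta> i (\<lambda>m. f m + h m) = (\<lambda>m. \<delta> i f m + \<delta> i h m)"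
      proof
        fix m'
        show "\<delta> i (\<lambda>m. f m + h m) m' = \<delta> i f m' + \<delta> i h m'"
          using diff[OF f] diff[OF h]
          by (cases "\<eta> m' = 0") (auto simp: \<delta>_def partial_add algebra_simps)
      qed
      show "\<delta> i (\<lambda>m. f m * h m) = (\<lambda>m. \<delta> i f m * h m + f m * \<delta> i h m)"
      proof
        fix m'
        show "\<delta> i (\<lambda>m. f m * h m) m' = \<delta> i f m' * h m' + f m' * \<delta> i h m'"
          using diff[OF f] diff[OF h] inv
          by (cases "\<eta> m' = 0") (auto simp: \<delta>_def partial_mult algebra_simps)
      qed
    qed
    show "\<xi> i (?\<psi> x) = x $ i" if "x \<in> ball (\<phi> m) r" for i x
      using one[OF that] by (simp add: \<xi>_def)
    show "\<delta> i f (?\<psi> x) = partial i (\<lambda>x. f (?\<psi> x)) x" if "x \<in> ball (\<phi> m) r" for i f x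
      using one[OF that] by (simp add: \<delta>_def)
  qed
  with that ch(2) show ?thesis by blast
qed

end

section \<open>Metrics, Killing fields and their 1-jets on the underlying manifold\<close>

locale smooth_pairing = smooth_function_algebra T C At
  for T :: "'p topology" and C and At :: "('p set \<times> (real^'n::finite) set \<times> ('p \<Rightarrow> real^'n)) set" +
  fixes G :: "(('p \<Rightarrow> real) \<Rightarrow> 'p \<Rightarrow> real) \<Rightarrow> (('p \<Rightarrow> real) \<Rightarrow> 'p \<Rightarrow> real) \<Rightarrow> 'p \<Rightarrow> real"
  assumes G_C: "der X \<Longrightarrow> der Y \<Longrightarrow> G X Y \<in> C"
    and G_cong: "der X \<Longrightarrow> der X' \<Longrightarrow> der Y \<Longrightarrow> (\<And>f. f \<in> C \<Longrightarrow> X f = X' f) \<Longrightarrow> G X Y = G X' Y"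
    and G_sym: "der X \<Longrightarrow> der Y \<Longrightarrow> G X Y = G Y X"
    and G_add: "der X \<Longrightarrow> der X' \<Longrightarrow> der Y \<Longrightarrow>
      G (\<lambda>f m. X f m + X' f m) Y = (\<lambda>m. G X Y m + G X' Y m)"
    and G_scale: "f \<in> C \<Longrightarrow> der X \<Longrightarrow> der Y \<Longrightarrow> G (\<lambda>h m. f m * X h m) Y = (\<lambda>m. f m * G X Y m)"
begin

lemma G_zero: "der Y \<Longrightarrow> G (\<lambda>f m. 0) Y = (\<lambda>m. 0)"
  using G_scale[OF C_zero der_zero] by simp

lemma G_sum:
  assumes "finite A" "\<And>a. a \<in> A \<Longrightarrow> der (X a)" "der Y"
  shows "G (\<lambda>f m. \<Sum>a\<in>A. X a f m) Y = (\<lambda>m. \<Sum>a\<in>A. G (X a) Y m)"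
  using assms(1,2)
proof (induction rule: finite_induct)
  case empty
  then show ?case using G_zero[OF assms(3)] by simp
next
  case (insert a A)
  then have "der (X a)" "der (\<lambda>f m. \<Sum>a\<in>A. X a f m)" by (auto intro: der_sum)
  from G_add[OF this assms(3)] insert show ?case by simp
qed

text \<open>Tensoriality: cut off by \<open>\<eta>\<close>, the expansion of X in the frame becomes
  an identity of global fields, to which linearity over \<open>C\<close> applies; evaluation at a
  point where \<open>\<eta>\<close> is 1 removes the cutoff.\<close>

lemma G_frame:
  assumes "coordinate_frame T C At U W \<phi> p r \<xi> \<delta>" and x: "x \<in> ball p r" and X: "der X" "der Z"
  shows "G X Z (inv_into U \<phi> x) = (\<Sum>i\<in>UNIV. X (\<xi> i) (inv_into U \<phi> x) * G (\<delta> i) Z (inv_into U \<phi> x))"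
proof -
  interpret coordinate_frame T C At U W \<phi> p r \<xi> \<delta> by fact
  obtain \<eta> s where s: "s > 0" "ball x s \<subseteq> ball p r" and \<eta>: "\<eta> \<in> C" "\<eta> (\<psi> x) = 1"
    and supp: "\<And>m. \<eta> m \<noteq> 0 \<Longrightarrow> m \<in> U \<and> \<phi> m \<in> ball x s"
    and ext: "\<And>h. smooth_on (ball x s) h \<Longrightarrow> (\<lambda>m. \<eta> m * h (\<phi> m)) \<in> C"
    by (rule cutoff_in_ball[OF x]) (rule that)
  define c where "c i m = \<eta> m * X (\<xi> i) m" for i m
  have c: "c i \<in> C" for i
    unfolding c_def[abs_def] by (intro C_mult \<eta> der_closed[OF X(1)] \<xi>_C)
  have "G (\<lambda>h m. \<eta> m * X h m) Z = G (\<lambda>h m. \<Sum>i\<in>UNIV. c i m * \<delta> i h m) Z"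
  proof (rule G_cong)
    fix f assume f: "f \<in> C"
    show "(\<lambda>m. \<eta> m * X f m) = (\<lambda>m. \<Sum>i\<in>UNIV. c i m * \<delta> i f m)"
    proof
      fix m
      show "\<eta> m * X f m = (\<Sum>i\<in>UNIV. c i m * \<delta> i f m)"
      proof (cases "\<eta> m = 0")
        case False
        then have m: "m \<in> U" "\<phi> m \<in> ball p r" using supp s by blast+
        then have inv: "\<psi> (\<phi> m) = m" using atlas_inv[OF chart] by blast
        have "X f m = (\<Sum>i\<in>UNIV. X (\<xi> i) m * \<delta> i f m)"
          using der_formula[OF X(1) f m(2)] \<delta>[OF f m(2)] by (simp add: inv)
        then show ?thesis by (simp add: c_def sum_distrib_left mult.assoc)
      qed (simp add: c_def)
    qed
  qed (intro der_scale der_sum \<eta> c X \<delta>_der)+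
  also have "\<dots> = (\<lambda>m. \<Sum>i\<in>UNIV. G (\<lambda>h m. c i m * \<delta> i h m) Z m)"
    by (rule G_sum) (auto intro: der_scale c \<delta>_der X)
  finally have "(\<lambda>m. \<eta> m * G X Z m) = (\<lambda>m. \<Sum>i\<in>UNIV. c i m * G (\<delta> i) Z m)"
    by (simp add: G_scale \<eta> c \<delta>_der X)
  from fun_cong[OF this, of "\<psi> x"] show ?thesis using \<eta>(2) by (simp add: c_def)
qed

end

locale smooth_metric = smooth_pairing T C At G
  for T :: "'p topology" and C and At :: "('p set \<times> (real^'n::finite) set \<times> ('p \<Rightarrow> real^'n)) set" and G +
  assumes G_nondeg: "m \<in> topspace T \<Longrightarrow> der X \<Longrightarrow> (\<And>Y. der Y \<Longrightarrow> G X Y m = 0) \<Longrightarrow> f \<in> C \<Longrightarrow>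
      X f m = 0"
begin

definition killing :: "(('p \<Rightarrow> real) \<Rightarrow> 'p \<Rightarrow> real) \<Rightarrow> bool" where
  "killing X \<longleftrightarrow> der X \<and>
    (\<forall>Y Z. der Y \<longrightarrow> der Z \<longrightarrow> X (G Y Z) = (\<lambda>m. G (lie X Y) Z m + G Y (lie X Z) m))"

text \<open>Vanishing of the 1-jet of X at m, expressed without coordinates so that it can be
  compared between charts.\<close>

definition flat_at :: "(('p \<Rightarrow> real) \<Rightarrow> 'p \<Rightarrow> real) \<Rightarrow> 'p \<Rightarrow> bool" where
  "flat_at X m \<longleftrightarrow> (\<forall>f \<in> C. X f m = 0 \<and> (\<forall>Y. der Y \<longrightarrow> Y (X f) m = 0))"

lemma killing_frame:
  assumes "coordinate_frame T C At U W \<phi> p r \<xi> \<delta>" and x: "x \<in> ball p r" and X: "killing X"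
  defines "\<psi> \<equiv> inv_into U \<phi>"
  shows "(\<Sum>k\<in>UNIV. X (\<xi> k) (\<psi> x) * partial k (\<lambda>x. G (\<delta> i) (\<delta> j) (\<psi> x)) x +
    partial i (\<lambda>x. X (\<xi> k) (\<psi> x)) x * G (\<delta> k) (\<delta> j) (\<psi> x) +
    partial j (\<lambda>x. X (\<xi> k) (\<psi> x)) x * G (\<delta> i) (\<delta> k) (\<psi> x)) = 0"
proof -
  interpret coordinate_frame T C At U W \<phi> p r \<xi> \<delta> by fact
  have dX: "der X" using X by (simp add: killing_def)
  \<comment> \<open>The bracket with a coordinate field has components - d_i X^k, because X kills
    \<open>\<delta> i (\<xi> k)\<close>: that function is constant near the point, though not
    globally.\<close>
  have lie: "lie X (\<delta> i) (\<xi> k) (\<psi> x) = - partial i (\<lambda>x. X (\<xi> k) (\<psi> x)) x" for i k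
  proof -
    have "\<delta> i (\<xi> k) (\<psi> y) = (if i = k then 1 else 0)" if "y \<in> ball p r" for y
    proof -
      have "\<delta> i (\<xi> k) (\<psi> y) = partial i (\<lambda>x. \<xi> k (\<psi> x)) y"
        using \<delta>[OF \<xi>_C that] by (simp add: \<psi>_def)
      also have "\<dots> = partial i (\<lambda>x. x $ k) y"
        using \<xi> that by (intro partial_cong[of "ball p r"]) (auto simp: \<psi>_def)
      finally show ?thesis by (simp add: partial_nth)
    qed
    then have "X (\<delta> i (\<xi> k)) (\<psi> x) = 0"
      using der_locally_zero[OF dX der_closed[OF \<delta>_der \<xi>_C] open_ball x] by (simp add: \<psi>_def)
    then show ?thesis
      using \<delta>[OF der_closed[OF dX \<xi>_C] x] by (simp add: lie_def \<psi>_def)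
  qed
  have G: "G (\<delta> i) (\<delta> j) \<in> C" by (intro G_C \<delta>_der)
  have "X (G (\<delta> i) (\<delta> j)) (\<psi> x) = G (lie X (\<delta> i)) (\<delta> j) (\<psi> x) + G (\<delta> i) (lie X (\<delta> j)) (\<psi> x)"
    using X \<delta>_der by (simp add: killing_def)
  also have "G (\<delta> i) (lie X (\<delta> j)) = G (lie X (\<delta> j)) (\<delta> i)"
    by (intro G_sym der_lie dX \<delta>_der)
  finally have "(\<Sum>k\<in>UNIV. X (\<xi> k) (\<psi> x) * partial k (\<lambda>x. G (\<delta> i) (\<delta> j) (\<psi> x)) x) =
      (\<Sum>k\<in>UNIV. - partial i (\<lambda>x. X (\<xi> k) (\<psi> x)) x * G (\<delta> k) (\<delta> j) (\<psi> x)) +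
      (\<Sum>k\<in>UNIV. - partial j (\<lambda>x. X (\<xi> k) (\<psi> x)) x * G (\<delta> k) (\<delta> i) (\<psi> x))"
    using der_formula[OF dX G x] G_frame[OF assms(1) x der_lie[OF dX \<delta>_der] \<delta>_der] lie
    by (simp add: \<psi>_def)
  moreover have "G (\<delta> k) (\<delta> i) = G (\<delta> i) (\<delta> k)" for k by (intro G_sym \<delta>_der)
  ultimately show ?thesis by (simp add: sum.distrib sum_negf)
qed

text \<open>Local unique continuation, transported to the manifold through a frame centred at
  m.\<close>

lemma flat_spreads:
  assumes X: "killing X" and m: "m \<in> topspace T" and flat: "flat_at X m"
  obtains V where "openin T V" "m \<in> V" "\<And>m'. m' \<in> V \<Longrightarrow> flat_at X m'"
proof -
  obtain U W \<phi> r \<xi> \<delta> where mU: "m \<in> U" and fr: "coordinate_frame T C At U W \<phi> (\<phi> m) r \<xi> \<delta>"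
    using frame_exists[OF m] .
  then interpret coordinate_frame T C At U W \<phi> "\<phi> m" r \<xi> \<delta> by simp
  have dX: "der X" using X by (simp add: killing_def)
  have \<psi>m: "\<psi> (\<phi> m) = m" using atlas_inv[OF chart] mU by blast
  have c: "\<phi> m \<in> ball (\<phi> m) r" using r by simp
  obtain e where e: "e > 0" "\<And>x k. x \<in> ball (\<phi> m) e \<Longrightarrow> X (\<xi> k) (\<psi> x) = 0"
  proof (rule killing_field_vanishes_near[of "ball (\<phi> m) r" "\<phi> m" "\<lambda>k x. X (\<xi> k) (\<psi> x)"
        "\<lambda>i j x. G (\<delta> i) (\<delta> j) (\<psi> x)"])
    show "smooth_on (ball (\<phi> m) r) (\<lambda>x. X (\<xi> k) (\<psi> x))" for k
      by (intro rep_smooth der_closed[OF dX] \<xi>_C)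
    show "smooth_on (ball (\<phi> m) r) (\<lambda>x. G (\<delta> i) (\<delta> j) (\<psi> x))" for i j
      by (intro rep_smooth G_C \<delta>_der)
    show "G (\<delta> i) (\<delta> j) (\<psi> x) = G (\<delta> j) (\<delta> i) (\<psi> x)" for i j x
      using G_sym[OF \<delta>_der \<delta>_der] by simp
    show "(\<Sum>k\<in>UNIV. X (\<xi> k) (\<psi> x) * partial k (\<lambda>x. G (\<delta> i) (\<delta> j) (\<psi> x)) x +
        partial i (\<lambda>x. X (\<xi> k) (\<psi> x)) x * G (\<delta> k) (\<delta> j) (\<psi> x) +
        partial j (\<lambda>x. X (\<xi> k) (\<psi> x)) x * G (\<delta> i) (\<delta> k) (\<psi> x)) = 0"
      if "x \<in> ball (\<phi> m) r" for i j x
      by (rule killing_frame[OF fr that X])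
    \<comment> \<open>Nondegeneracy is a statement about global fields, so the coefficient vector v
      is realised by a field \<open>V\<close> with constant coefficients in the frame; expanding an
      arbitrary Y in the frame shows that V pairs to 0 with it at m.\<close>
    show "v = (\<lambda>k. 0)" if v: "\<And>j. (\<Sum>k\<in>UNIV. v k * G (\<delta> k) (\<delta> j) (\<psi> (\<phi> m))) = 0" for v
    proof
      fix k
      define c where "c k m = (if m \<in> topspace T then v k else 0)" for k m
      define V where "V f m = (\<Sum>k\<in>UNIV. c k m * \<delta> k f m)" for f m
      have cC: "c k \<in> C" for k unfolding c_def[abs_def] by (rule C_const)
      have dV: "der V" unfolding V_def[abs_def] by (intro der_sum der_scale cC \<delta>_der)
      have \<xi>V: "V (\<xi> i) (\<psi> (\<phi> m)) = v i" for i
      proof -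
        have "\<delta> k (\<xi> i) (\<psi> (\<phi> m)) = (if k = i then 1 else 0)" for k
        proof -
          have "\<delta> k (\<xi> i) (\<psi> (\<phi> m)) = partial k (\<lambda>x. x $ i) (\<phi> m)"
            unfolding \<delta>[OF \<xi>_C c] using \<xi> c by (intro partial_cong[of "ball (\<phi> m) r"]) auto
          then show ?thesis by (simp add: partial_nth)
        qed
        then show ?thesis
          using m by (simp add: V_def c_def \<psi>m if_distrib[of "\<lambda>z. _ * z"] cong: if_cong)
      qed
      have "G V Y m = 0" if Y: "der Y" for Y
      proof -
        have "G V Y m = (\<Sum>i\<in>UNIV. v i * G (\<delta> i) Y m)"
          using G_frame[OF fr c dV Y] \<xi>V \<psi>m by simp
        also have "\<dots> = (\<Sum>i\<in>UNIV. v i * (\<Sum>j\<in>UNIV. Y (\<xi> j) m * G (\<delta> j) (\<delta> i) m))"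
          using G_sym[OF \<delta>_der Y] G_frame[OF fr c Y \<delta>_der] \<psi>m by simp
        also have "\<dots> = (\<Sum>i\<in>UNIV. \<Sum>j\<in>UNIV. Y (\<xi> j) m * (v i * G (\<delta> i) (\<delta> j) m))"
          using G_sym[OF \<delta>_der \<delta>_der] by (simp add: sum_distrib_left mult_ac)
        also have "\<dots> = (\<Sum>j\<in>UNIV. Y (\<xi> j) m * (\<Sum>i\<in>UNIV. v i * G (\<delta> i) (\<delta> j) m))"
          unfolding sum_distrib_left by (rule sum.swap)
        also have "\<dots> = 0" using v \<psi>m by simp
        finally show ?thesis .
      qed
      from G_nondeg[OF m dV this \<xi>_C] show "v k = 0" using \<xi>V \<psi>m by simp
    qed
    show "X (\<xi> k) (\<psi> (\<phi> m)) = 0" for k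
      using flat \<xi>_C by (simp add: flat_at_def \<psi>m)
    show "partial i (\<lambda>x. X (\<xi> k) (\<psi> x)) (\<phi> m) = 0" for i k
    proof -
      have "\<delta> i (X (\<xi> k)) m = 0" using flat \<xi>_C \<delta>_der unfolding flat_at_def by blast
      then show ?thesis using \<delta>[OF der_closed[OF dX \<xi>_C] c] by (simp add: \<psi>m)
    qed
  qed (use r in auto)
  define V where "V = ball (\<phi> m) (min e r)"
  have V: "open V" "\<phi> m \<in> V" "V \<subseteq> ball (\<phi> m) e" "V \<subseteq> ball (\<phi> m) r" using e r by (auto simp: V_def)
  have zero: "X f (\<psi> x) = 0" if "f \<in> C" "x \<in> V" for f x
    using der_formula[OF dX that(1)] e(2) that(2) V by (simp add: subset_iff)
  show ?thesis
  proof (rule that[of "{m' \<in> U. \<phi> m' \<in> V}"])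
    show "openin T {m' \<in> U. \<phi> m' \<in> V}" by (rule openin_chart_preimage[OF chart V(1)])
    show "m \<in> {m' \<in> U. \<phi> m' \<in> V}" using mU V by simp
    fix m' assume "m' \<in> {m' \<in> U. \<phi> m' \<in> V}"
    then have m': "\<phi> m' \<in> V" "\<psi> (\<phi> m') = m'" using atlas_inv[OF chart] by auto
    show "flat_at X m'"
      unfolding flat_at_def
    proof (intro ballI conjI allI impI)
      fix f assume f: "f \<in> C"
      then show "X f m' = 0" using zero[OF f m'(1)] m' by simp
      show "Y (X f) m' = 0" if "der Y" for Y
        using der_locally_zero[OF that der_closed[OF dX f] V(1) m'(1) V(4) zero[OF f]] m' by simp
    qed
  qed
qed

text \<open>The points where the 1-jet vanishes form an open set by unique continuation, and a
  closed one because failure is witnessed by a function in \<open>C\<close>, which stays nonzero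
  nearby.\<close>

theorem killing_flat_on_component:
  assumes X: "killing X" and c: "c \<in> connected_components_of T" "m \<in> c" "flat_at X m"
  shows "m' \<in> c \<Longrightarrow> f \<in> C \<Longrightarrow> X f m' = 0"
proof -
  assume m': "m' \<in> c" and f: "f \<in> C"
  have dX: "der X" using X by (simp add: killing_def)
  have sub: "c \<subseteq> topspace T" using c(1) connected_components_of_subset by blast
  define S where "S = {m \<in> topspace T. flat_at X m}"
  have "openin T S"
  proof (subst openin_subopen, intro ballI)
    fix m assume "m \<in> S"
    then obtain V where "openin T V" "m \<in> V" "\<And>m'. m' \<in> V \<Longrightarrow> flat_at X m'"
      using flat_spreads[OF X] unfolding S_def by blast
    then show "\<exists>V. openin T V \<and> m \<in> V \<and> V \<subseteq> S"
      using openin_subset unfolding S_def by blast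
  qed
  moreover have "openin T (topspace T - S)"
  proof (subst openin_subopen, intro ballI)
    fix m assume "m \<in> topspace T - S"
    then have m: "m \<in> topspace T" "\<not> flat_at X m" by (auto simp: S_def)
    \<comment> \<open>Both ways of not being flat are of the form h(m) \<noteq> 0 with h in
      \<open>C\<close> vanishing at all flat points: h = X f, or h = Y (X f).\<close>
    obtain h where h: "h \<in> C" "h m \<noteq> 0" "\<And>m'. flat_at X m' \<Longrightarrow> h m' = 0"
    proof -
      from m(2) obtain f where "f \<in> C" "X f m \<noteq> 0 \<or> (\<exists>Y. der Y \<and> Y (X f) m \<noteq> 0)"
        unfolding flat_at_def by blast
      then show ?thesis
        using that[of "X f"] that[of "_ (X f)"] der_closed dX unfolding flat_at_def by metis
    qed
    have "{m \<in> topspace T. h m \<noteq> 0} \<subseteq> topspace T - S" using h(3) by (auto simp: S_def)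
    then show "\<exists>V. openin T V \<and> m \<in> V \<and> V \<subseteq> topspace T - S"
      using openin_nonzero[OF h(1)] m(1) h(2) by blast
  qed
  moreover have "connectedin T c" using c(1) connectedin_connected_components_of by blast
  moreover have "m \<in> S" using c(2,3) sub by (auto simp: S_def)
  ultimately have "c \<subseteq> S"
    using c(2) sub unfolding connectedin by blast
  then show "X f m' = 0" using m' f by (auto simp: S_def flat_at_def)
qed

text \<open>Reduces the 1-jet to finitely many linear conditions, tested on the coordinates and the
  coordinate fields. In the derivative of X f = sum X(\<xi>_i) d_i f the terms with second
  derivatives of f drop out, as their coefficients vanish at m.\<close>

lemma flat_at_finite_test:
  assumes m: "m \<in> topspace T"
  obtains A B where "finite A" "A \<subseteq> C" "finite B" "\<And>Y. Y \<in> B \<Longrightarrow> der Y"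
    "\<And>X. der X \<Longrightarrow> (\<And>a. a \<in> A \<Longrightarrow> X a m = 0) \<Longrightarrow> (\<And>a Y. a \<in> A \<Longrightarrow> Y \<in> B \<Longrightarrow> Y (X a) m = 0) \<Longrightarrow>
      flat_at X m"
proof -
  obtain U W \<phi> r \<xi> \<delta> where mU: "m \<in> U" and fr: "coordinate_frame T C At U W \<phi> (\<phi> m) r \<xi> \<delta>"
    using frame_exists[OF m] .
  then interpret coordinate_frame T C At U W \<phi> "\<phi> m" r \<xi> \<delta> by simp
  have \<psi>m: "\<psi> (\<phi> m) = m" using atlas_inv[OF chart] mU by blast
  have c: "\<phi> m \<in> ball (\<phi> m) r" using r by simp
  show ?thesis
  proof (rule that[of "range \<xi>" "range \<delta>"])
    fix X assume dX: "der X" and X0: "\<And>a. a \<in> range \<xi> \<Longrightarrow> X a m = 0"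
      and X1: "\<And>a Y. a \<in> range \<xi> \<Longrightarrow> Y \<in> range \<delta> \<Longrightarrow> Y (X a) m = 0"
    show "flat_at X m"
      unfolding flat_at_def
    proof (intro ballI conjI allI impI)
      fix f assume f: "f \<in> C"
      show "X f m = 0"
        using der_formula[OF dX f c] X0 by (simp add: \<psi>m)
      fix Y assume dY: "der Y"
      have "partial j (\<lambda>x. X f (\<psi> x)) (\<phi> m) = 0" for j
      proof -
        let ?P = "\<lambda>i. partial i (\<lambda>x. f (\<psi> x))"
        have sm: "smooth_on (ball (\<phi> m) r) (\<lambda>x. X (\<xi> i) (\<psi> x))" "smooth_on (ball (\<phi> m) r) (?P i)" for i
          by (intro rep_smooth der_closed[OF dX] \<xi>_C smooth_on_partial f)+
        have d: "(\<lambda>x. X (\<xi> i) (\<psi> x)) differentiable at (\<phi> m)" "?P i differentiable at (\<phi> m)" for i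
          using sm smooth_on_differentiable c by blast+
        have "partial j (\<lambda>x. X f (\<psi> x)) (\<phi> m) =
            partial j (\<lambda>x. \<Sum>i\<in>UNIV. X (\<xi> i) (\<psi> x) * ?P i x) (\<phi> m)"
          using der_formula[OF dX f] c by (intro partial_cong[of "ball (\<phi> m) r"]) auto
        also have "\<dots> = (\<Sum>i\<in>UNIV. partial j (\<lambda>x. X (\<xi> i) (\<psi> x)) (\<phi> m) * ?P i (\<phi> m) +
            X (\<xi> i) (\<psi> (\<phi> m)) * partial j (?P i) (\<phi> m))"
          using d by (subst partial_sum) (auto simp: partial_mult intro: differentiable_mult)
        also have "\<dots> = 0"
          using X0 X1[OF rangeI rangeI] \<delta>[OF der_closed[OF dX \<xi>_C] c, symmetric] by (simp add: \<psi>m)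
        finally show ?thesis .
      qed
      then show "Y (X f) m = 0"
        using der_formula[OF dY der_closed[OF dX f] c] by (simp add: \<psi>m)
    qed
  qed (use \<xi>_C \<delta>_der in auto)
qed

end

section \<open>Functions on a supermanifold of odd dimension one\<close>

lemma real_ring_simps [simp]:
  "carrier real_ring = UNIV" "x \<oplus>\<^bsub>real_ring\<^esub> y = x + y" "x \<otimes>\<^bsub>real_ring\<^esub> y = x * y"
  "\<zero>\<^bsub>real_ring\<^esub> = 0" "\<one>\<^bsub>real_ring\<^esub> = 1"
  by (simp_all add: real_ring_def)

context super_vector_space
begin

lemma smult_simps:
  "x \<in> carrier V \<Longrightarrow> c \<odot> x \<in> carrier V"
  "x \<in> carrier V \<Longrightarrow> 1 \<odot> x = x" "x \<in> carrier V \<Longrightarrow> 0 \<odot> x = \<zero>"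
  "x \<in> carrier V \<Longrightarrow> a \<odot> (b \<odot> x) = (a * b) \<odot> x"
  "x \<in> carrier V \<Longrightarrow> y \<in> carrier V \<Longrightarrow> c \<odot> (x \<oplus> y) = c \<odot> x \<oplus> c \<odot> y"
  "x \<in> carrier V \<Longrightarrow> (a + b) \<odot> x = a \<odot> x \<oplus> b \<odot> x"
  using smult_closed[of c x] smult_one[of x] smult_l_null[of x] smult_assoc1[of a b x]
    smult_r_distr[of c x y] smult_l_distr[of a b x] by simp_all

lemma a_inv_smult: "x \<in> carrier V \<Longrightarrow> \<ominus> x = (-1) \<odot> x"
proof -
  assume x: "x \<in> carrier V"
  have "(-1) \<odot> x \<oplus> 1 \<odot> x = ((-1) + 1) \<odot> x" using x by (simp only: smult_simps(6))
  then have "(-1) \<odot> x \<oplus> x = \<zero>" using x by (simp add: smult_simps(2,3))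
  then show ?thesis using x by (simp add: minus_equality smult_simps(1))
qed

lemma minus_smult: "x \<in> carrier V \<Longrightarrow> y \<in> carrier V \<Longrightarrow> x \<ominus> y = x \<oplus> (-1) \<odot> y"
  by (simp add: a_minus_def a_inv_smult)

lemma grade_carrier: "x \<in> grade V p \<Longrightarrow> x \<in> carrier V"
  using grade_subspace[of p] submodule.subset unfolding subspace_def submodule_def by blast

lemma grade_add: "x \<in> grade V p \<Longrightarrow> y \<in> grade V p \<Longrightarrow> x \<oplus> y \<in> grade V p"
  and grade_smult: "x \<in> grade V p \<Longrightarrow> c \<odot> x \<in> grade V p"
  and grade_zero: "\<zero> \<in> grade V p"
  using grade_subspace[of p] by (auto simp: VectorSpace.subspace_def submodule_def subgroup_def)

end

text \<open>Keeps the odd dimension in the form \<open>1\<close> in which it occurs in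
  \<open>superfuns 1 W\<close> and in the facts about charts.\<close>

declare One_nat_def [simp del]

lemma superalgebra_homD:
  assumes "h \<in> superalgebra_hom A B"
  shows "x \<in> carrier A \<Longrightarrow> h x \<in> carrier B"
    "x \<in> carrier A \<Longrightarrow> y \<in> carrier A \<Longrightarrow> h (x \<oplus>\<^bsub>A\<^esub> y) = h x \<oplus>\<^bsub>B\<^esub> h y"
    "x \<in> carrier A \<Longrightarrow> y \<in> carrier A \<Longrightarrow> h (x \<otimes>\<^bsub>A\<^esub> y) = h x \<otimes>\<^bsub>B\<^esub> h y"
    "x \<in> carrier A \<Longrightarrow> h (c \<odot>\<^bsub>A\<^esub> x) = c \<odot>\<^bsub>B\<^esub> h x"
    "h \<one>\<^bsub>A\<^esub> = \<one>\<^bsub>B\<^esub>"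
    "z \<in> grade A p \<Longrightarrow> h z \<in> grade B p"
  using assms by (auto simp: superalgebra_hom_def ring_hom_def)

lemma lessThan_one: "{..<1::nat} = {0}" by auto

lemma shuffle_sign_simps [simp]: "shuffle_sign {} J = 1" "shuffle_sign I {} = 1"
  by (simp_all add: shuffle_sign_def)

lemma superfun_one_odd_mult:
  "(F \<otimes>\<^bsub>superfun_algebra q W\<^esub> H) {} x = F {} x * H {} x"
  "(F \<otimes>\<^bsub>superfun_algebra q W\<^esub> H) {i} x = F {} x * H {i} x + F {i} x * H {} x"
  by (simp_all add: superfun_algebra_def Pow_insert insert_Diff_if)

lemma superfun_simps:
  "(F \<oplus>\<^bsub>superfun_algebra q W\<^esub> H) I x = F I x + H I x"
  "(c \<odot>\<^bsub>superfun_algebra q W\<^esub> F) I x = c * F I x"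
  "\<zero>\<^bsub>superfun_algebra q W\<^esub> I x = 0"
  "\<one>\<^bsub>superfun_algebra q W\<^esub> I x = (if I = {} \<and> x \<in> W then 1 else 0)"
  "carrier (superfun_algebra q W) = superfuns q W"
  by (simp_all add: superfun_algebra_def)

lemma superfun_grade_odd: "F \<in> grade (superfun_algebra q W) 1 \<Longrightarrow> F {} x = 0"
  by (auto simp: superfun_algebra_def)

lemma superfuns_outside: "F \<in> superfuns 1 W \<Longrightarrow> \<not> ((I = {} \<or> I = {0}) \<and> x \<in> W) \<Longrightarrow> F I x = 0"
  by (auto simp: superfuns_def lessThan_one subset_singleton_iff)

lemma superfuns_eqI:
  assumes "F \<in> superfuns 1 W" "H \<in> superfuns 1 W"
    "\<And>x. x \<in> W \<Longrightarrow> F {} x = H {} x" "\<And>x. x \<in> W \<Longrightarrow> F {0} x = H {0} x"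
  shows "F = H"
proof (intro ext)
  fix I x
  show "F I x = H I x"
    using assms superfuns_outside[of F W I x] superfuns_outside[of H W I x]
    by (cases "(I = {} \<or> I = {0}) \<and> x \<in> W") auto
qed

text \<open>The section a + b \<tau> over W in one odd coordinate.\<close>

definition superfun_of :: "(real^'n::finite) set \<Rightarrow> (real^'n \<Rightarrow> real) \<Rightarrow> (real^'n \<Rightarrow> real) \<Rightarrow> 'n superfun" where
  "superfun_of W a b = (\<lambda>I x. if x \<in> W then (if I = {} then a x else if I = {0} then b x else 0) else 0)"

lemma superfun_of_simps:
  "x \<in> W \<Longrightarrow> superfun_of W a b {} x = a x" "x \<in> W \<Longrightarrow> superfun_of W a b {0} x = b x"
  by (simp_all add: superfun_of_def)

lemma superfun_of_superfuns:
  assumes "open W" "smooth_on W a" "smooth_on W b"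
  shows "superfun_of W a b \<in> superfuns 1 W"
proof -
  have "smooth_on W (superfun_of W a b I)" for I
    using assms smooth_on_cong[OF assms(1), of "superfun_of W a b I"
        "if I = {} then a else if I = {0} then b else (\<lambda>x. 0)"]
    by (auto simp: superfun_of_def)
  then show ?thesis by (auto simp: superfuns_def superfun_of_def)
qed

lemma superfuns_smooth: "F \<in> superfuns q W \<Longrightarrow> smooth_on W (F I)"
  by (simp add: superfuns_def)

context superringed_space
begin

abbreviation pts where "pts \<equiv> topspace (points M)"

lemma sect_alg: "openin (points M) U \<Longrightarrow> comm_superalgebra (sect M U)"
  by (rule sect_superalgebra)

lemma sect_closed:
  assumes "openin (points M) U"
  shows "\<zero>\<^bsub>sect M U\<^esub> \<in> carrier (sect M U)" "\<one>\<^bsub>sect M U\<^esub> \<in> carrier (sect M U)"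
    "x \<in> carrier (sect M U) \<Longrightarrow> y \<in> carrier (sect M U) \<Longrightarrow> x \<otimes>\<^bsub>sect M U\<^esub> y \<in> carrier (sect M U)"
    "x \<in> carrier (sect M U) \<Longrightarrow> 0 \<odot>\<^bsub>sect M U\<^esub> x = \<zero>\<^bsub>sect M U\<^esub>"
proof -
  interpret comm_superalgebra "sect M U" by (rule sect_alg[OF assms])
  show "\<zero>\<^bsub>sect M U\<^esub> \<in> carrier (sect M U)" "\<one>\<^bsub>sect M U\<^esub> \<in> carrier (sect M U)"
    "x \<in> carrier (sect M U) \<Longrightarrow> y \<in> carrier (sect M U) \<Longrightarrow> x \<otimes>\<^bsub>sect M U\<^esub> y \<in> carrier (sect M U)"
    "x \<in> carrier (sect M U) \<Longrightarrow> 0 \<odot>\<^bsub>sect M U\<^esub> x = \<zero>\<^bsub>sect M U\<^esub>"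
    by (auto simp: smult_simps)
qed

lemmas restr_homD = superalgebra_homD[OF restr_hom]

lemma restr_zero:
  assumes "openin (points M) U" "openin (points M) V" "V \<subseteq> U"
  shows "restr M U V \<zero>\<^bsub>sect M U\<^esub> = \<zero>\<^bsub>sect M V\<^esub>"
  using restr_homD(4)[OF assms sect_closed(1)[OF assms(1)], where c = 0]
    restr_homD(1)[OF assms sect_closed(1)[OF assms(1)]] sect_closed(1,4) assms by simp

text \<open>The separation half of the sheaf axiom, extracted from the uniqueness in
  \<open>gluing\<close>: both a and b glue the restrictions of a.\<close>

lemma sections_eq_locally:
  assumes V: "openin (points M) V" and a: "a \<in> carrier (sect M V)" "b \<in> carrier (sect M V)"
    and loc: "\<And>m. m \<in> V \<Longrightarrow> \<exists>N. openin (points M) N \<and> m \<in> N \<and> N \<subseteq> V \<and> restr M V N a = restr M V N b"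
  shows "a = b"
proof -
  define \<U> where "\<U> = {N. openin (points M) N \<and> N \<subseteq> V \<and> restr M V N a = restr M V N b}"
  have UV: "\<Union>\<U> = V" using loc by (auto simp: \<U>_def)
  have "\<exists>!f. f \<in> carrier (sect M (\<Union>\<U>)) \<and> (\<forall>U\<in>\<U>. restr M (\<Union>\<U>) U f = restr M V U a)"
  proof (rule gluing)
    fix U U' assume "U \<in> \<U>" "U' \<in> \<U>"
    then have "openin (points M) U" "openin (points M) U'" "U \<subseteq> V" "U' \<subseteq> V" by (auto simp: \<U>_def)
    then show "restr M U (U \<inter> U') (restr M V U a) = restr M U' (U \<inter> U') (restr M V U' a)"
      using restr_comp[OF V _ openin_Int] a by (metis inf_le1 inf_le2)
  qed (use V a restr_homD(1) in \<open>auto simp: \<U>_def\<close>)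
  moreover have "\<forall>U\<in>\<U>. restr M V U b = restr M V U a" by (auto simp: \<U>_def)
  ultimately show ?thesis unfolding UV using a by blast
qed

end

section \<open>Charts of odd dimension one: values of functions and extension by zero\<close>

locale superchart = superringed_space M
  for M :: "('p, 'f) superspace" +
  fixes U :: "'p set" and W :: "(real^'n::finite) set" and \<phi> and \<Phi>
  assumes chart: "chart M 1 U W \<phi> \<Phi>"
begin

lemma U_open: "openin (points M) U" and W_open: "open W"
  and iso: "superspace_iso (open_subspace M U) (superdomain 1 W) \<phi> \<Phi>"
  using chart by (auto simp: chart_def)

lemma U_sub: "U \<subseteq> pts"
  using U_open openin_subset by blast

lemma homeo: "homeomorphic_map (subtopology (points M) U) (top_of_set W) \<phi>"
  using iso by (simp add: superspace_iso_def open_subspace_def superdomain_def)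

lemma \<phi>_bij: "\<phi> ` U = W" "inj_on \<phi> U"
  using homeomorphic_imp_surjective_map[OF homeo] homeomorphic_imp_injective_map[OF homeo] U_sub
  by (simp_all add: Int_absorb1)

lemma sub_open: "openin (points M) V \<Longrightarrow> V \<subseteq> U \<Longrightarrow> openin (subtopology (points M) U) V"
  by (simp add: openin_open_subtopology[OF U_open])

lemma preimage_open:
  assumes "open B"
  shows "openin (points M) {m \<in> U. \<phi> m \<in> B}"
proof -
  have pts: "topspace (subtopology (points M) U) = U" using U_sub by auto
  have "openin (top_of_set W) (B \<inter> W)" using assms by (auto simp: openin_subtopology)
  from openin_continuous_map_preimage[OF homeomorphic_imp_continuous_map[OF homeo] this]
  have "openin (subtopology (points M) U) {m \<in> U. \<phi> m \<in> B \<inter> W}" unfolding pts .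
  then have "openin (points M) {m \<in> U. \<phi> m \<in> B \<inter> W}"
    using U_open openin_trans_full by blast
  moreover have "{m \<in> U. \<phi> m \<in> B \<inter> W} = {m \<in> U. \<phi> m \<in> B}" using \<phi>_bij by auto
  ultimately show ?thesis by simp
qed

lemma \<Phi>_hom: "openin (points M) V \<Longrightarrow> V \<subseteq> U \<Longrightarrow> \<Phi> V \<in> superalgebra_hom (sect M V) (superfun_algebra 1 (\<phi> ` V))"
  and \<Phi>_bij: "openin (points M) V \<Longrightarrow> V \<subseteq> U \<Longrightarrow> bij_betw (\<Phi> V) (carrier (sect M V)) (superfuns 1 (\<phi> ` V))"
  using iso sub_open by (auto simp: superspace_iso_def open_subspace_def superdomain_def superfun_simps)

lemma \<Phi>_restr: "openin (points M) V \<Longrightarrow> openin (points M) V' \<Longrightarrow> V \<subseteq> U \<Longrightarrow> V' \<subseteq> V \<Longrightarrow> f \<in> carrier (sect M V) \<Longrightarrow>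
    \<Phi> V' (restr M V V' f) I x = (if x \<in> \<phi> ` V' then \<Phi> V f I x else 0)"
proof -
  assume a: "openin (points M) V" "openin (points M) V'" "V \<subseteq> U" "V' \<subseteq> V" "f \<in> carrier (sect M V)"
  have "\<Phi> V' (restr M V V' f) = (\<lambda>I x. if x \<in> \<phi> ` V' then \<Phi> V f I x else 0)"
    using iso a sub_open[of V] sub_open[of V']
    unfolding superspace_iso_def open_subspace_def superdomain_def by simp
  then show ?thesis by simp
qed

definition loc :: "'f \<Rightarrow> 'n superfun" where
  "loc f = \<Phi> U (restr M pts U f)"

lemma restr_top_carrier: "openin (points M) V \<Longrightarrow> f \<in> carrier (Cinf M) \<Longrightarrow> restr M pts V f \<in> carrier (sect M V)"
  using restr_homD(1)[OF openin_topspace _ openin_subset] unfolding Cinf_def by blast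

lemma loc_superfuns: "f \<in> carrier (Cinf M) \<Longrightarrow> loc f \<in> superfuns 1 W"
  using superalgebra_homD(1)[OF \<Phi>_hom[OF U_open]] restr_top_carrier[OF U_open] \<phi>_bij
  by (simp add: loc_def superfun_simps)

lemma loc_hom: "loc \<in> superalgebra_hom (Cinf M) (superfun_algebra 1 W)"
proof -
  have h: "restr M pts U \<in> superalgebra_hom (Cinf M) (sect M U)"
    unfolding Cinf_def by (rule restr_hom[OF openin_topspace U_open U_sub])
  have k: "\<Phi> U \<in> superalgebra_hom (sect M U) (superfun_algebra 1 W)"
    using \<Phi>_hom[OF U_open] \<phi>_bij by simp
  show ?thesis
    unfolding superalgebra_hom_def[of "Cinf M"] ring_hom_def[of "Cinf M"] loc_def
    by (auto simp: superalgebra_homD[OF h] superalgebra_homD[OF k])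
qed

lemma \<Phi>_loc: "openin (points M) V \<Longrightarrow> V \<subseteq> U \<Longrightarrow> f \<in> carrier (Cinf M) \<Longrightarrow>
    \<Phi> V (restr M pts V f) I x = (if x \<in> \<phi> ` V then loc f I x else 0)"
proof -
  assume V: "openin (points M) V" "V \<subseteq> U" and f: "f \<in> carrier (Cinf M)"
  have "restr M pts V f = restr M U V (restr M pts U f)"
    using restr_comp[OF openin_topspace U_open V(1) V(2) U_sub] f by (simp add: Cinf_def)
  then show ?thesis
    using \<Phi>_restr[OF U_open V(1) _ V(2) restr_top_carrier[OF U_open f]] by (simp add: loc_def)
qed

lemma restr_eq_iff:
  assumes V: "openin (points M) V" "V \<subseteq> U" and f: "f \<in> carrier (Cinf M)" and s: "s \<in> carrier (sect M U)"
  shows "restr M pts V f = restr M U V s \<longleftrightarrow>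
    (\<forall>m \<in> V. loc f {} (\<phi> m) = \<Phi> U s {} (\<phi> m) \<and> loc f {0} (\<phi> m) = \<Phi> U s {0} (\<phi> m))"
proof -
  have c: "restr M pts V f \<in> carrier (sect M V)" "restr M U V s \<in> carrier (sect M V)"
    using restr_top_carrier[OF V(1) f] restr_homD(1)[OF U_open V s] by auto
  have "restr M pts V f = restr M U V s \<longleftrightarrow> \<Phi> V (restr M pts V f) = \<Phi> V (restr M U V s)"
    using inj_on_eq_iff[OF bij_betw_imp_inj_on[OF \<Phi>_bij[OF V]] c] by simp
  also have "\<dots> \<longleftrightarrow> (\<forall>x \<in> \<phi> ` V. loc f {} x = \<Phi> U s {} x \<and> loc f {0} x = \<Phi> U s {0} x)"
  proof
    assume "\<Phi> V (restr M pts V f) = \<Phi> V (restr M U V s)"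
    then show "\<forall>x \<in> \<phi> ` V. loc f {} x = \<Phi> U s {} x \<and> loc f {0} x = \<Phi> U s {0} x"
      using \<Phi>_loc[OF V f] \<Phi>_restr[OF U_open V(1) _ V(2) s] by (metis order_refl)
  next
    assume "\<forall>x \<in> \<phi> ` V. loc f {} x = \<Phi> U s {} x \<and> loc f {0} x = \<Phi> U s {0} x"
    then show "\<Phi> V (restr M pts V f) = \<Phi> V (restr M U V s)"
      using bij_betwE[OF \<Phi>_bij[OF V]] c \<Phi>_loc[OF V f] \<Phi>_restr[OF U_open V(1) _ V(2) s]
      by (intro superfuns_eqI[of _ "\<phi> ` V"]) auto
  qed
  finally show ?thesis by blast
qed

lemma \<Phi>_zero: "openin (points M) V \<Longrightarrow> V \<subseteq> U \<Longrightarrow> \<Phi> V \<zero>\<^bsub>sect M V\<^esub> I x = 0"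
proof -
  assume V: "openin (points M) V" "V \<subseteq> U"
  have "\<Phi> V (0 \<odot>\<^bsub>sect M V\<^esub> \<zero>\<^bsub>sect M V\<^esub>) = 0 \<odot>\<^bsub>superfun_algebra 1 (\<phi> ` V)\<^esub> \<Phi> V \<zero>\<^bsub>sect M V\<^esub>"
    using superalgebra_homD(4)[OF \<Phi>_hom[OF V]] sect_closed(1)[OF V(1)] by blast
  then have "\<Phi> V \<zero>\<^bsub>sect M V\<^esub> = 0 \<odot>\<^bsub>superfun_algebra 1 (\<phi> ` V)\<^esub> \<Phi> V \<zero>\<^bsub>sect M V\<^esub>"
    using sect_closed(1,4)[OF V(1)] by simp
  then show ?thesis by (metis mult_zero_left superfun_simps(2))
qed

lemma restr_zero_iff:
  assumes V: "openin (points M) V" "V \<subseteq> U" and f: "f \<in> carrier (Cinf M)"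
  shows "restr M pts V f = \<zero>\<^bsub>sect M V\<^esub> \<longleftrightarrow>
    (\<forall>m \<in> V. loc f {} (\<phi> m) = 0 \<and> loc f {0} (\<phi> m) = 0)"
  using restr_eq_iff[OF V f sect_closed(1)[OF U_open]] restr_zero[OF U_open V] \<Phi>_zero[OF U_open]
  by simp

text \<open>A section a + b \<tau> is invertible exactly where a has no zero, so f - r fails to be
  invertible on every neighbourhood of m for exactly one r, the value of a at m.\<close>

lemma fun_value_loc:
  assumes m: "m \<in> U" and f: "f \<in> carrier (Cinf M)"
  shows "fun_value M m f = loc f {} (\<phi> m)"
proof -
  interpret A: comm_superalgebra "Cinf M" unfolding Cinf_def by (rule sect_alg) simp
  define h where "h r = f \<ominus>\<^bsub>Cinf M\<^esub> r \<odot>\<^bsub>Cinf M\<^esub> \<one>\<^bsub>Cinf M\<^esub>" for r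
  have h: "h r \<in> carrier (Cinf M)" for r using f by (simp add: h_def A.minus_smult A.smult_simps)
  have loc_h: "loc (h r) {} x = loc f {} x - r" "loc (h r) {0} x = loc f {0} x" if "x \<in> W" for r x
  proof -
    have "h r = f \<oplus>\<^bsub>Cinf M\<^esub> (- r) \<odot>\<^bsub>Cinf M\<^esub> \<one>\<^bsub>Cinf M\<^esub>"
      using f by (simp add: h_def A.minus_smult A.smult_simps)
    then show "loc (h r) {} x = loc f {} x - r" "loc (h r) {0} x = loc f {0} x"
      using superalgebra_homD[OF loc_hom] f A.one_closed A.smult_simps(1)[OF A.one_closed] that
      by (simp_all add: superfun_simps)
  qed
  let ?ok = "\<lambda>r. \<forall>V. openin (points M) V \<and> m \<in> V \<longrightarrow> restr M pts V (h r) \<notin> Units (sect M V)"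
  \<comment> \<open>An inverse, restricted to the overlap with the chart, would make the product of
    the even coefficients 1 at m, where the coefficient of f - r is 0.\<close>
  have "?ok (loc f {} (\<phi> m))"
  proof (intro allI impI notI)
    fix V assume V: "openin (points M) V \<and> m \<in> V"
      and u: "restr M pts V (h (loc f {} (\<phi> m))) \<in> Units (sect M V)"
    let ?h = "h (loc f {} (\<phi> m))" and ?V = "V \<inter> U"
    have V': "openin (points M) ?V" "?V \<subseteq> U" using V U_open by auto
    obtain b where b: "b \<in> carrier (sect M V)" "b \<otimes>\<^bsub>sect M V\<^esub> restr M pts V ?h = \<one>\<^bsub>sect M V\<^esub>"
      using u by (auto simp: Units_def)
    have cV: "restr M pts V ?h \<in> carrier (sect M V)" using restr_top_carrier V h by blast
    have rV: "restr M V ?V (restr M pts V ?h) = restr M pts ?V ?h"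
      using restr_comp[OF openin_topspace, of V ?V ?h] V V' h openin_subset[of "points M" V]
      by (simp add: Cinf_def)
    have hV: "restr M V ?V \<in> superalgebra_hom (sect M V) (sect M ?V)" using restr_hom V V' by blast
    have "\<one>\<^bsub>sect M ?V\<^esub> = restr M V ?V (b \<otimes>\<^bsub>sect M V\<^esub> restr M pts V ?h)"
      unfolding b(2) using superalgebra_homD(5)[OF hV] by simp
    also have "\<dots> = restr M V ?V b \<otimes>\<^bsub>sect M ?V\<^esub> restr M pts ?V ?h"
      using superalgebra_homD(3)[OF hV b(1) cV] rV by simp
    finally have "\<Phi> ?V (restr M V ?V b \<otimes>\<^bsub>sect M ?V\<^esub> restr M pts ?V ?h) = \<Phi> ?V \<one>\<^bsub>sect M ?V\<^esub>" by simp
    then have "\<Phi> ?V (restr M V ?V b) \<otimes>\<^bsub>superfun_algebra 1 (\<phi> ` ?V)\<^esub> \<Phi> ?V (restr M pts ?V ?h) =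
        \<one>\<^bsub>superfun_algebra 1 (\<phi> ` ?V)\<^esub>"
      using superalgebra_homD(3)[OF \<Phi>_hom[OF V'] superalgebra_homD(1)[OF hV b(1)] restr_top_carrier[OF V'(1) h]]
        superalgebra_homD(5)[OF \<Phi>_hom[OF V']] by simp
    then have "\<Phi> ?V (restr M V ?V b) {} (\<phi> m) * \<Phi> ?V (restr M pts ?V ?h) {} (\<phi> m) = 1"
      using V m by (metis IntI image_eqI superfun_one_odd_mult(1) superfun_simps(4))
    moreover have "\<Phi> ?V (restr M pts ?V ?h) {} (\<phi> m) = 0"
      using \<Phi>_loc[OF V' h] loc_h(1)[of "\<phi> m"] m \<phi>_bij by auto
    ultimately show False by simp
  qed
  moreover have "r = loc f {} (\<phi> m)" if "?ok r" for r
  proof (rule ccontr)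
    assume r: "r \<noteq> loc f {} (\<phi> m)"
    let ?B = "{x \<in> W. loc f {} x \<in> - {r}}" and ?V = "{m \<in> U. \<phi> m \<in> {x \<in> W. loc f {} x \<in> - {r}}}"
    have "open ?B"
      using continuous_open_preimage[OF smooth_on_continuous[OF superfuns_smooth[OF loc_superfuns[OF f]]] W_open, of "- {r}"]
      by (simp add: vimage_def Int_def open_Compl)
    then have V: "openin (points M) ?V" by (rule preimage_open)
    have VU: "?V \<subseteq> U" by auto
    have im: "\<phi> ` ?V = ?B" using \<phi>_bij by auto
    let ?H = "\<Phi> ?V (restr M pts ?V (h r))"
    \<comment> \<open>As \<tau>^2 = 0, the inverse of a + b \<tau> is 1/a - (b/a^2) \<tau>.\<close>
    let ?K = "superfun_of ?B (\<lambda>x. inverse (?H {} x)) (\<lambda>x. - (?H {0} x * (inverse (?H {} x) * inverse (?H {} x))))"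
    have H: "?H {} x = loc f {} x - r" "?H {0} x = loc f {0} x" if "x \<in> ?B" for x
      using \<Phi>_loc[OF V VU h] im that loc_h[of x r] by auto
    have Hs: "?H \<in> superfuns 1 ?B"
      using bij_betwE[OF \<Phi>_bij[OF V VU]] restr_top_carrier[OF V h] unfolding im by blast
    have K: "?K \<in> superfuns 1 ?B"
      using superfuns_smooth[OF Hs] \<open>open ?B\<close> H(1)
      by (intro superfun_of_superfuns smooth_on_uminus smooth_on_mult smooth_on_inverse) auto
    have one: "\<one>\<^bsub>superfun_algebra 1 ?B\<^esub> \<in> superfuns 1 ?B"
      using superalgebra_homD(1)[OF \<Phi>_hom[OF V VU] sect_closed(2)[OF V]]
        superalgebra_homD(5)[OF \<Phi>_hom[OF V VU]]
      unfolding im by (simp add: superfun_simps)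
    obtain y where y: "y \<in> carrier (sect M ?V)" "\<Phi> ?V y = ?K"
    proof -
      have "?K \<in> \<Phi> ?V ` carrier (sect M ?V)"
        unfolding bij_betw_imp_surj_on[OF \<Phi>_bij[OF V VU]] im by (rule K)
      then show ?thesis using that by force
    qed
    have c: "restr M pts ?V (h r) \<in> carrier (sect M ?V)" by (rule restr_top_carrier[OF V h])
    have inj: "u = v" if "u \<in> carrier (sect M ?V)" "v \<in> carrier (sect M ?V)" "\<Phi> ?V u = \<Phi> ?V v" for u v
      using \<Phi>_bij[OF V VU] that by (meson bij_betw_imp_inj_on inj_on_eq_iff)
    have prod: "\<Phi> ?V (y \<otimes>\<^bsub>sect M ?V\<^esub> restr M pts ?V (h r)) = \<Phi> ?V \<one>\<^bsub>sect M ?V\<^esub>"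
      "\<Phi> ?V (restr M pts ?V (h r) \<otimes>\<^bsub>sect M ?V\<^esub> y) = \<Phi> ?V \<one>\<^bsub>sect M ?V\<^esub>"
    proof -
      have one_im: "\<Phi> ?V \<one>\<^bsub>sect M ?V\<^esub> = \<one>\<^bsub>superfun_algebra 1 ?B\<^esub>"
        using superalgebra_homD(5)[OF \<Phi>_hom[OF V VU]] unfolding im .
      have cl: "\<Phi> ?V z \<in> superfuns 1 ?B" if "z \<in> carrier (sect M ?V)" for z
        using bij_betwE[OF \<Phi>_bij[OF V VU]] that unfolding im by blast
      have "\<Phi> ?V (y \<otimes>\<^bsub>sect M ?V\<^esub> restr M pts ?V (h r)) = ?K \<otimes>\<^bsub>superfun_algebra 1 ?B\<^esub> ?H"
        using superalgebra_homD(3)[OF \<Phi>_hom[OF V VU] y(1) c] y(2) unfolding im by simp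
      then show "\<Phi> ?V (y \<otimes>\<^bsub>sect M ?V\<^esub> restr M pts ?V (h r)) = \<Phi> ?V \<one>\<^bsub>sect M ?V\<^esub>"
        unfolding one_im using cl[OF sect_closed(3)[OF V y(1) c]] one H(1)
        by (intro superfuns_eqI[of _ ?B])
          (auto simp: superfun_one_odd_mult superfun_simps superfun_of_simps)
      have "\<Phi> ?V (restr M pts ?V (h r) \<otimes>\<^bsub>sect M ?V\<^esub> y) = ?H \<otimes>\<^bsub>superfun_algebra 1 ?B\<^esub> ?K"
        using superalgebra_homD(3)[OF \<Phi>_hom[OF V VU] c y(1)] y(2) unfolding im by simp
      then show "\<Phi> ?V (restr M pts ?V (h r) \<otimes>\<^bsub>sect M ?V\<^esub> y) = \<Phi> ?V \<one>\<^bsub>sect M ?V\<^esub>"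
        unfolding one_im using cl[OF sect_closed(3)[OF V c y(1)]] one H(1)
        by (intro superfuns_eqI[of _ ?B])
          (auto simp: superfun_one_odd_mult superfun_simps superfun_of_simps)
    qed
    have "restr M pts ?V (h r) \<in> Units (sect M ?V)"
      unfolding Units_def using c y(1) inj[OF _ _ prod(1)] inj[OF _ _ prod(2)] sect_closed(2,3)[OF V] by blast
    moreover have "m \<in> ?V" using m \<phi>_bij r by auto
    ultimately show False using that V by blast
  qed
  ultimately show ?thesis
    unfolding fun_value_def h_def[symmetric] by (rule the_equality)
qed

text \<open>The preimage of K is compact in a Hausdorff space, hence closed, so its complement is
  open and the section can be glued with zero there.\<close>

lemma extend_by_zero:
  assumes haus: "Hausdorff_space (points M)"
    and F: "F \<in> superfuns 1 W" and K: "compact K" "K \<subseteq> W"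
    and zero: "\<And>I x. x \<in> W - K \<Longrightarrow> F I x = 0"
  obtains f where "f \<in> carrier (Cinf M)" "loc f = F"
    "\<And>m. m \<in> pts - U \<Longrightarrow> \<exists>V. openin (points M) V \<and> m \<in> V \<and> restr M pts V f = \<zero>\<^bsub>sect M V\<^esub>"
proof -
  define K' where "K' = inv_into U \<phi> ` K"
  define O' where "O' = pts - K'"
  have K'U: "K' \<subseteq> U" using K(2) \<phi>_bij unfolding K'_def by (auto simp: inv_into_into)
  have imK: "\<phi> ` K' = K" using K(2) \<phi>_bij unfolding K'_def by (force simp: f_inv_into_f image_image)
  obtain g where g: "homeomorphic_maps (subtopology (points M) U) (top_of_set W) \<phi> g"
    using homeo homeomorphic_map_maps by blast
  have gx: "g x = inv_into U \<phi> x" if "x \<in> W" for x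
  proof -
    have "g x \<in> U" "\<phi> (g x) = x"
      using g that U_sub by (auto simp: homeomorphic_maps_def continuous_map_def)
    then show ?thesis using \<phi>_bij by (metis inv_into_f_f)
  qed
  have "compactin (top_of_set W) K" using K by (simp add: compactin_subtopology)
  then have "compactin (subtopology (points M) U) (g ` K)"
    using g image_compactin unfolding homeomorphic_maps_def by blast
  moreover have "g ` K = K'" using gx K(2) unfolding K'_def by (auto intro!: image_cong)
  ultimately have "compactin (points M) K'" by (simp add: compactin_subtopology)
  then have "closedin (points M) K'" using haus compactin_imp_closedin by blast
  then have O': "openin (points M) O'" unfolding O'_def by blast
  obtain a where a: "a \<in> carrier (sect M U)" "\<Phi> U a = F"
    using F bij_betw_imp_surj_on[OF \<Phi>_bij[OF U_open]] \<phi>_bij(1) by (metis imageE order_refl)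
  \<comment> \<open>The family is indexed by open sets, so it gives \<open>a\<close> on
    \<open>O'\<close> if \<open>O'\<close> equals \<open>U\<close>; in that case no point lies
    outside U and the last conclusion is vacuous.\<close>
  define s where "s V = (if V = U then a else \<zero>\<^bsub>sect M V\<^esub>)" for V
  have Un: "\<Union>{U, O'} = pts" using K'U U_sub by (auto simp: O'_def)
  have restr_a: "restr M U (U \<inter> O') a = \<zero>\<^bsub>sect M (U \<inter> O')\<^esub>"
  proof -
    have V: "openin (points M) (U \<inter> O')" "U \<inter> O' \<subseteq> U" using U_open O' by auto
    have c: "restr M U (U \<inter> O') a \<in> carrier (sect M (U \<inter> O'))" using restr_homD(1)[OF U_open V a(1)] .
    have "\<Phi> (U \<inter> O') (restr M U (U \<inter> O') a) = \<Phi> (U \<inter> O') \<zero>\<^bsub>sect M (U \<inter> O')\<^esub>"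
    proof (intro ext)
      fix I x
      have "F I x = 0" if "x \<in> \<phi> ` (U \<inter> O')"
      proof (rule zero)
        obtain m where m: "m \<in> U" "m \<notin> K'" "x = \<phi> m" using \<open>x \<in> \<phi> ` (U \<inter> O')\<close> by (auto simp: O'_def)
        have "x \<notin> K"
        proof
          assume "x \<in> K"
          then have "\<phi> m \<in> \<phi> ` K'" using m(3) imK by simp
          then obtain m' where "\<phi> m = \<phi> m'" "m' \<in> K'" by (rule imageE)
          then show False using m(1,2) K'U inj_onD[OF \<phi>_bij(2), of m m'] by blast
        qed
        then show "x \<in> W - K" using m \<phi>_bij by auto
      qed
      then show "\<Phi> (U \<inter> O') (restr M U (U \<inter> O') a) I x = \<Phi> (U \<inter> O') \<zero>\<^bsub>sect M (U \<inter> O')\<^esub> I x"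
        using \<Phi>_restr[OF U_open V(1) _ V(2) a(1)] a(2) \<Phi>_zero[OF V] by simp
    qed
    then show ?thesis
      using \<Phi>_bij[OF V] c sect_closed(1)[OF V(1)] by (meson bij_betw_imp_inj_on inj_on_eq_iff)
  qed
  have "\<exists>!f. f \<in> carrier (sect M (\<Union>{U, O'})) \<and> (\<forall>V\<in>{U, O'}. restr M (\<Union>{U, O'}) V f = s V)"
  proof (rule gluing)
    fix V V' assume "V \<in> {U, O'}" "V' \<in> {U, O'}"
    then show "restr M V (V \<inter> V') (s V) = restr M V' (V \<inter> V') (s V')"
      using restr_a restr_zero[OF O' openin_Int[OF U_open O']] by (auto simp: s_def Int_commute)
  qed (use a U_open O' sect_closed(1) in \<open>auto simp: s_def\<close>)
  then obtain f where f: "f \<in> carrier (sect M pts)" "restr M pts U f = s U" "restr M pts O' f = s O'"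
    unfolding Un by blast
  show ?thesis
  proof (rule that[of f])
    show "f \<in> carrier (Cinf M)" using f by (simp add: Cinf_def)
    show "loc f = F" using f(2) a(2) by (simp add: loc_def s_def)
    show "\<exists>V. openin (points M) V \<and> m \<in> V \<and> restr M pts V f = \<zero>\<^bsub>sect M V\<^esub>" if m: "m \<in> pts - U" for m
    proof -
      have "m \<in> O'" using m K'U by (auto simp: O'_def)
      then have "s O' = \<zero>\<^bsub>sect M O'\<^esub>" using m by (auto simp: s_def)
      then show ?thesis using f(3) O' \<open>m \<in> O'\<close> by auto
    qed
  qed
qed

end

lemma derivationsD:
  assumes "X \<in> derivations A p"
  shows "f \<in> carrier A \<Longrightarrow> X f \<in> carrier A"
    "f \<in> carrier A \<Longrightarrow> h \<in> carrier A \<Longrightarrow> X (f \<oplus>\<^bsub>A\<^esub> h) = X f \<oplus>\<^bsub>A\<^esub> X h"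
    "f \<in> carrier A \<Longrightarrow> X (c \<odot>\<^bsub>A\<^esub> f) = c \<odot>\<^bsub>A\<^esub> X f"
    "f \<in> grade A r \<Longrightarrow> X f \<in> grade A (p + r)"
    "f \<in> grade A r \<Longrightarrow> h \<in> carrier A \<Longrightarrow>
      X (f \<otimes>\<^bsub>A\<^esub> h) = X f \<otimes>\<^bsub>A\<^esub> h \<oplus>\<^bsub>A\<^esub> koszul p r \<odot>\<^bsub>A\<^esub> (f \<otimes>\<^bsub>A\<^esub> X h)"
    "f \<notin> carrier A \<Longrightarrow> X f = undefined"
    "X \<in> extensional (carrier A)"
  using assms by (auto simp: derivations_def PiE_def extensional_def)

lemma koszul_simps [simp]: "koszul 0 q = 1" "koszul p 0 = 1" "koszul 1 1 = -1"
  by (simp_all add: koszul_def)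

section \<open>Global functions: the value and the odd coefficient\<close>

sublocale super_null_riemannian \<subseteq> A: comm_superalgebra "Cinf M"
  unfolding Cinf_def by (rule sect_alg) simp

context super_null_riemannian
begin

abbreviation A where "A \<equiv> Cinf M"

lemma Q_der: "Q \<in> derivations A 1" and P_der: "P \<in> derivations A 0"
  using Q_odd P_even by (simp_all add: Vect_def Der_def)

lemma Q_closed: "f \<in> carrier A \<Longrightarrow> Q f \<in> carrier A" and P_closed: "f \<in> carrier A \<Longrightarrow> P f \<in> carrier A"
  using derivationsD(1)[OF Q_der] derivationsD(1)[OF P_der] by auto

definition val :: "'f \<Rightarrow> 'p \<Rightarrow> real" where
  "val f m = (if m \<in> pts then fun_value M m f else 0)"

definition atlas :: "('p set \<times> (real^'n) set \<times> ('p \<Rightarrow> real^'n)) set" where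
  "atlas = {(U, W, \<phi>). \<exists>\<Phi> k. shander_chart M Q P U W \<phi> \<Phi> k}"

end

locale shander_coordinates = super_null_riemannian n M g Q P
  for n :: "'n::finite itself" and M :: "('p, 'f) superspace" and g Q P +
  fixes U :: "'p set" and W :: "(real^'n) set" and \<phi> and \<Phi> and k :: 'n
  assumes shander_chart: "shander_chart M Q P U W \<phi> \<Phi> k"

sublocale shander_coordinates \<subseteq> superchart M U W \<phi> \<Phi>
  using shander_chart by unfold_locales (simp add: shander_chart_def)

context shander_coordinates
begin

lemma in_atlas: "(U, W, \<phi>) \<in> atlas"
  using shander_chart by (auto simp: atlas_def)

lemma val_loc: "m \<in> U \<Longrightarrow> f \<in> carrier A \<Longrightarrow> val f m = loc f {} (\<phi> m)"
  using U_sub fun_value_loc by (auto simp: val_def)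

lemma loc_Q: "f \<in> carrier A \<Longrightarrow> x \<in> W \<Longrightarrow> loc (Q f) {} x = loc f {0} x"
  and loc_P: "f \<in> carrier A \<Longrightarrow> x \<in> W \<Longrightarrow> loc (P f) {} x = partial k (loc f {}) x"
  using shander_chart
  by (auto simp: shander_chart_def loc_def[symmetric] Let_def superfun_simps superfun_one_odd_mult
      odd_partial_def odd_coord_def even_partial_def)

lemma \<phi>_W: "m \<in> U \<Longrightarrow> \<phi> m \<in> W"
  using \<phi>_bij by auto

text \<open>Since Q is the odd coordinate derivative plus \<tau> times an even one, the value of Q f
  is the \<tau>-coefficient of f. Thus this coefficient does not depend on the Shander
  chart.\<close>

lemma val_Q: "m \<in> U \<Longrightarrow> f \<in> carrier A \<Longrightarrow> val (Q f) m = loc f {0} (\<phi> m)"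
  using val_loc[OF _ Q_closed] loc_Q \<phi>_W by auto

lemma \<psi>: "x \<in> W \<Longrightarrow> inv_into U \<phi> x \<in> U" "x \<in> W \<Longrightarrow> \<phi> (inv_into U \<phi> x) = x"
    "m \<in> U \<Longrightarrow> inv_into U \<phi> (\<phi> m) = m"
  using \<phi>_bij by (auto simp: inv_into_into f_inv_into_f)

lemma val_\<psi>: "f \<in> carrier A \<Longrightarrow> x \<in> W \<Longrightarrow> val f (inv_into U \<phi> x) = loc f {} x"
  using val_loc \<psi> by auto

lemma val_smooth: "f \<in> carrier A \<Longrightarrow> smooth_on W (\<lambda>x. val f (inv_into U \<phi> x))"
  using smooth_on_cong[OF W_open val_\<psi>] superfuns_smooth[OF loc_superfuns] by simp

lemma val_P: "f \<in> carrier A \<Longrightarrow> x \<in> W \<Longrightarrow>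
    val (P f) (inv_into U \<phi> x) = partial k (\<lambda>x. val f (inv_into U \<phi> x)) x"
  using val_\<psi>[OF P_closed] loc_P partial_cong[OF W_open _ val_\<psi>] by auto

lemma restr_eq_val:
  assumes "openin (points M) V" "V \<subseteq> U" "f \<in> carrier A" "s \<in> carrier (sect M U)"
  shows "restr M pts V f = restr M U V s \<longleftrightarrow>
    (\<forall>m \<in> V. val f m = \<Phi> U s {} (\<phi> m) \<and> val (Q f) m = \<Phi> U s {0} (\<phi> m))"
  using restr_eq_iff[OF assms] val_loc[OF _ assms(3)] val_Q[OF _ assms(3)] assms(2)
  by (simp add: subset_iff)

lemma restr_zero_val:
  assumes "openin (points M) V" "V \<subseteq> U" "f \<in> carrier A" "restr M pts V f = \<zero>\<^bsub>sect M V\<^esub>" "m \<in> V"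
  shows "val f m = 0" "val (Q f) m = 0"
  using restr_zero_iff[OF assms(1-3)] assms(2,4,5) val_loc[OF _ assms(3)] val_Q[OF _ assms(3)]
  by (auto simp: subset_iff)

end

context super_null_riemannian
begin

lemma shander_at:
  assumes "m \<in> pts"
  obtains U and W :: "(real^'n) set" and \<phi> \<Phi> k where "m \<in> U" "shander_coordinates M g Q P U W \<phi> \<Phi> k"
proof -
  obtain U and W :: "(real^'n) set" and \<phi> \<Phi> k where "m \<in> U" "shander_chart M Q P U W \<phi> \<Phi> k"
    using shander[OF assms] by blast
  then show ?thesis
    by (intro that[of U W \<phi> \<Phi> k] shander_coordinates.intro shander_coordinates_axioms.intro
        super_null_riemannian_axioms)
qed

lemma val_outside: "m \<notin> pts \<Longrightarrow> val f m = 0"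
  by (simp add: val_def)

lemma val_add: "f \<in> carrier A \<Longrightarrow> h \<in> carrier A \<Longrightarrow> val (f \<oplus>\<^bsub>A\<^esub> h) m = val f m + val h m"
  and val_smult: "f \<in> carrier A \<Longrightarrow> val (c \<odot>\<^bsub>A\<^esub> f) m = c * val f m"
  and val_mult: "f \<in> carrier A \<Longrightarrow> h \<in> carrier A \<Longrightarrow> val (f \<otimes>\<^bsub>A\<^esub> h) m = val f m * val h m"
  and val_one: "val \<one>\<^bsub>A\<^esub> m = (if m \<in> pts then 1 else 0)"
  and val_odd: "f \<in> grade A 1 \<Longrightarrow> val f m = 0"
proof -
  have "(f \<in> carrier A \<longrightarrow> h \<in> carrier A \<longrightarrow> val (f \<oplus>\<^bsub>A\<^esub> h) m = val f m + val h m) \<and>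
    (f \<in> carrier A \<longrightarrow> val (c \<odot>\<^bsub>A\<^esub> f) m = c * val f m) \<and>
    (f \<in> carrier A \<longrightarrow> h \<in> carrier A \<longrightarrow> val (f \<otimes>\<^bsub>A\<^esub> h) m = val f m * val h m) \<and>
    val \<one>\<^bsub>A\<^esub> m = (if m \<in> pts then 1 else 0) \<and> (f \<in> grade A 1 \<longrightarrow> val f m = 0)"
  proof (cases "m \<in> pts")
    case True
    obtain U and W :: "(real^'n) set" and \<phi> \<Phi> k where m: "m \<in> U" "shander_coordinates M g Q P U W \<phi> \<Phi> k"
      using shander_at[OF True] .
    then interpret shander_coordinates n M g Q P U W \<phi> \<Phi> k by simp
    note h = superalgebra_homD[OF loc_hom]
    have "loc f {} (\<phi> m) = 0" if "f \<in> grade A 1"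
      using superfun_grade_odd[OF h(6)[OF that]] .
    then show ?thesis
      using m True \<phi>_W A.grade_carrier
      by (auto simp: val_loc h superfun_simps superfun_one_odd_mult A.smult_simps)
  qed (simp add: val_outside)
  then show "f \<in> carrier A \<Longrightarrow> h \<in> carrier A \<Longrightarrow> val (f \<oplus>\<^bsub>A\<^esub> h) m = val f m + val h m"
    "f \<in> carrier A \<Longrightarrow> val (c \<odot>\<^bsub>A\<^esub> f) m = c * val f m"
    "f \<in> carrier A \<Longrightarrow> h \<in> carrier A \<Longrightarrow> val (f \<otimes>\<^bsub>A\<^esub> h) m = val f m * val h m"
    "val \<one>\<^bsub>A\<^esub> m = (if m \<in> pts then 1 else 0)" "f \<in> grade A 1 \<Longrightarrow> val f m = 0"
    by blast+
qed

lemma val_zero: "val \<zero>\<^bsub>A\<^esub> m = 0"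
  using val_smult[of "\<zero>\<^bsub>A\<^esub>" 0 m] A.smult_simps(3)[of "\<zero>\<^bsub>A\<^esub>"] by simp

text \<open>In every Shander chart the two hypotheses compare both coefficients. This is the method
  by which most equations between global functions are verified.\<close>

lemma val_eqI:
  assumes "f \<in> carrier A" "h \<in> carrier A"
    and "\<And>m. val f m = val h m" "\<And>m. val (Q f) m = val (Q h) m"
  shows "f = h"
proof (rule sections_eq_locally[OF openin_topspace])
  show "f \<in> carrier (sect M pts)" "h \<in> carrier (sect M pts)"
    using assms by (simp_all add: Cinf_def)
  fix m assume "m \<in> pts"
  then obtain U and W :: "(real^'n) set" and \<phi> \<Phi> k where m: "m \<in> U" "shander_coordinates M g Q P U W \<phi> \<Phi> k"
    by (rule shander_at)
  then interpret shander_coordinates n M g Q P U W \<phi> \<Phi> k by simp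
  have s: "restr M pts U h \<in> carrier (sect M U)" by (rule restr_top_carrier[OF U_open assms(2)])
  have "restr M pts U f = restr M U U (restr M pts U h)"
    using assms(3,4) val_loc[OF _ assms(2)] val_Q[OF _ assms(2)]
    by (subst restr_eq_val[OF U_open _ assms(1) s]) (auto simp: loc_def[symmetric])
  then have "restr M pts U f = restr M pts U h" using restr_id[OF U_open s] by simp
  then show "\<exists>N. openin (points M) N \<and> m \<in> N \<and> N \<subseteq> pts \<and> restr M pts N f = restr M pts N h"
    using m U_open U_sub by blast
qed

lemma val_Q_add: "f \<in> carrier A \<Longrightarrow> h \<in> carrier A \<Longrightarrow> val (Q (f \<oplus>\<^bsub>A\<^esub> h)) m = val (Q f) m + val (Q h) m"
  and val_Q_smult: "f \<in> carrier A \<Longrightarrow> val (Q (c \<odot>\<^bsub>A\<^esub> f)) m = c * val (Q f) m"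
  by (simp_all add: derivationsD[OF Q_der] val_add val_smult Q_closed)

lemma val_Q_even: "f \<in> grade A 0 \<Longrightarrow> val (Q f) m = 0"
  using val_odd derivationsD(4)[OF Q_der, of f 0] by simp

lemma decompose:
  assumes "f \<in> carrier A"
  obtains f0 f1 where "f0 \<in> grade A 0" "f1 \<in> grade A 1" "f = f0 \<oplus>\<^bsub>A\<^esub> f1"
  using A.grade_decomp[OF assms] by blast

text \<open>The Leibniz rule without sign: the Koszul sign sits only on the term with the odd part
  of f as a factor, and that part has value 0.\<close>

lemma val_Q_mult:
  assumes "f \<in> carrier A" "h \<in> carrier A"
  shows "val (Q (f \<otimes>\<^bsub>A\<^esub> h)) m = val (Q f) m * val h m + val f m * val (Q h) m"
proof -
  obtain f0 f1 where f: "f0 \<in> grade A 0" "f1 \<in> grade A 1" "f = f0 \<oplus>\<^bsub>A\<^esub> f1"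
    using decompose[OF assms(1)] .
  have c: "f0 \<in> carrier A" "f1 \<in> carrier A" using f A.grade_carrier by auto
  have "Q (f0 \<otimes>\<^bsub>A\<^esub> h) = Q f0 \<otimes>\<^bsub>A\<^esub> h \<oplus>\<^bsub>A\<^esub> 1 \<odot>\<^bsub>A\<^esub> (f0 \<otimes>\<^bsub>A\<^esub> Q h)"
    "Q (f1 \<otimes>\<^bsub>A\<^esub> h) = Q f1 \<otimes>\<^bsub>A\<^esub> h \<oplus>\<^bsub>A\<^esub> (-1) \<odot>\<^bsub>A\<^esub> (f1 \<otimes>\<^bsub>A\<^esub> Q h)"
    using derivationsD(5)[OF Q_der f(1) assms(2)] derivationsD(5)[OF Q_der f(2) assms(2)] by simp_all
  moreover have "Q (f \<otimes>\<^bsub>A\<^esub> h) = Q (f0 \<otimes>\<^bsub>A\<^esub> h) \<oplus>\<^bsub>A\<^esub> Q (f1 \<otimes>\<^bsub>A\<^esub> h)"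
    using c assms(2) by (simp add: f(3) A.l_distr derivationsD(2)[OF Q_der])
  ultimately show ?thesis
    using c assms(2) val_odd[OF f(2)] val_Q_even[OF f(1)]
    by (simp add: f(3) val_add val_smult val_mult val_Q_add Q_closed A.smult_simps(1) algebra_simps)
qed

lemma val_Q_one: "val (Q \<one>\<^bsub>A\<^esub>) m = 0"
  using val_Q_even[OF A.one_even] .

lemma grade_odd_iff: "f \<in> grade A 1 \<longleftrightarrow> f \<in> carrier A \<and> (\<forall>m. val f m = 0)"
proof safe
  assume f: "f \<in> carrier A" "\<forall>m. val f m = 0"
  obtain f0 f1 where d: "f0 \<in> grade A 0" "f1 \<in> grade A 1" "f = f0 \<oplus>\<^bsub>A\<^esub> f1"
    using decompose[OF f(1)] .
  have c: "f0 \<in> carrier A" "f1 \<in> carrier A" using d A.grade_carrier by auto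
  have "f = f1"
    using f c d(3) val_odd[OF d(2)] val_Q_even[OF d(1)]
    by (intro val_eqI) (auto simp: val_Q_add)
  then show "f \<in> grade A 1" using d by simp
qed (use A.grade_carrier val_odd in auto)

lemma grade_even_iff: "f \<in> grade A 0 \<longleftrightarrow> f \<in> carrier A \<and> (\<forall>m. val (Q f) m = 0)"
proof safe
  assume f: "f \<in> carrier A" "\<forall>m. val (Q f) m = 0"
  obtain f0 f1 where d: "f0 \<in> grade A 0" "f1 \<in> grade A 1" "f = f0 \<oplus>\<^bsub>A\<^esub> f1"
    using decompose[OF f(1)] .
  have c: "f0 \<in> carrier A" "f1 \<in> carrier A" using d A.grade_carrier by auto
  have "f = f0"
    using f c d(3) val_odd[OF d(2)] val_Q_even[OF d(1)]
    by (intro val_eqI) (auto simp: val_add)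
  then show "f \<in> grade A 0" using d by simp
qed (use A.grade_carrier val_Q_even in auto)

lemma val_extend:
  assumes "(U, W, \<phi>) \<in> atlas" and ab: "smooth_on W a" "smooth_on W b"
    and K: "compact K" "K \<subseteq> W" "\<And>x. x \<in> W - K \<Longrightarrow> a x = 0" "\<And>x. x \<in> W - K \<Longrightarrow> b x = 0"
  obtains f where "f \<in> carrier A" "val f = (\<lambda>m. if m \<in> U then a (\<phi> m) else 0)"
    "val (Q f) = (\<lambda>m. if m \<in> U then b (\<phi> m) else 0)"
proof -
  obtain \<Phi> k where "shander_chart M Q P U W \<phi> \<Phi> k" using assms(1) by (auto simp: atlas_def)
  then interpret ch: shander_coordinates n M g Q P U W \<phi> \<Phi> k
    by (intro shander_coordinates.intro shander_coordinates_axioms.intro super_null_riemannian_axioms)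
  have F: "superfun_of W a b \<in> superfuns 1 W"
    by (rule superfun_of_superfuns[OF ch.W_open ab])
  have "superfun_of W a b I x = 0" if "x \<in> W - K" for I x
    using K(3,4) that by (auto simp: superfun_of_def)
  from ch.extend_by_zero[OF hausdorff F K(1,2) this]
  obtain f where f: "f \<in> carrier A" "ch.loc f = superfun_of W a b"
    "\<And>m. m \<in> pts - U \<Longrightarrow> \<exists>V. openin (points M) V \<and> m \<in> V \<and> restr M pts V f = \<zero>\<^bsub>sect M V\<^esub>"
    by blast
  \<comment> \<open>Outside \<open>U\<close> the extension is known to be zero as a section near m;
    another Shander chart around m turns this into the two values.\<close>
  have "val f m = 0 \<and> val (Q f) m = 0" if m: "m \<notin> U" for m
  proof (cases "m \<in> pts")
    case True
    then obtain V where V: "openin (points M) V" "m \<in> V" "restr M pts V f = \<zero>\<^bsub>sect M V\<^esub>"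
      using f(3) m by blast
    obtain U' and W' :: "(real^'n) set" and \<phi>' \<Phi>' k' where m': "m \<in> U'" "shander_coordinates M g Q P U' W' \<phi>' \<Phi>' k'"
      using shander_at[OF True] .
    interpret ch': shander_coordinates n M g Q P U' W' \<phi>' \<Phi>' k' by (rule m'(2))
    let ?V = "V \<inter> U'"
    have oV: "openin (points M) ?V" using V(1) ch'.U_open by blast
    have "restr M pts ?V f = restr M V ?V (restr M pts V f)"
      using restr_comp[OF openin_topspace V(1) oV] f(1) openin_subset[OF V(1)] by (simp add: Cinf_def)
    also have "\<dots> = \<zero>\<^bsub>sect M ?V\<^esub>" using V(3) restr_zero[OF V(1) oV] by simp
    finally show ?thesis
      using ch'.restr_zero_val[OF oV _ f(1)] V(2) m'(1) by blast
  qed (simp add: val_outside)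
  then have "val f = (\<lambda>m. if m \<in> U then a (\<phi> m) else 0)"
    "val (Q f) = (\<lambda>m. if m \<in> U then b (\<phi> m) else 0)"
    using f(2) ch.val_loc[OF _ f(1)] ch.val_Q[OF _ f(1)] ch.\<phi>_W by (auto simp: superfun_of_simps)
  with f(1) that show ?thesis by blast
qed

text \<open>The smooth functions on |M|. Taking values of even functions only loses nothing
  (\<open>val_C\<close>), and each element then has exactly one even representative.\<close>

definition C :: "('p \<Rightarrow> real) set" where "C = val ` grade A 0"

lemma smooth_functions: "smooth_function_algebra (points M) C atlas"
proof
  fix f m assume "f \<in> C" "m \<notin> pts"
  then show "f m = 0" by (auto simp: C_def val_outside)
next
  fix c
  have "val (c \<odot>\<^bsub>A\<^esub> \<one>\<^bsub>A\<^esub>) = (\<lambda>m. if m \<in> pts then c else 0)"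
    by (auto simp: val_smult val_one)
  then show "(\<lambda>m. if m \<in> pts then c else 0) \<in> C"
    using A.grade_smult[OF A.one_even, of c] unfolding C_def by (metis imageI)
next
  fix f h assume "f \<in> C" "h \<in> C"
  then obtain a b where ab: "a \<in> grade A 0" "b \<in> grade A 0" "f = val a" "h = val b"
    by (auto simp: C_def)
  have "(\<lambda>m. f m + h m) = val (a \<oplus>\<^bsub>A\<^esub> b)" "(\<lambda>m. f m * h m) = val (a \<otimes>\<^bsub>A\<^esub> b)"
    using ab A.grade_carrier by (auto simp: val_add val_mult)
  then show "(\<lambda>m. f m + h m) \<in> C" "(\<lambda>m. f m * h m) \<in> C"
    using A.grade_add[OF ab(1,2)] A.mult_grade[OF ab(1,2)] by (auto simp: C_def)
next
  fix m assume "m \<in> pts"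
  then obtain U and W :: "(real^'n) set" and \<phi> \<Phi> k where m: "m \<in> U" "shander_coordinates M g Q P U W \<phi> \<Phi> k"
    by (rule shander_at)
  then show "\<exists>U W \<phi>. (U, W, \<phi>) \<in> atlas \<and> m \<in> U"
    using shander_coordinates.in_atlas by blast
next
  fix U and W :: "(real^'n) set" and \<phi> assume at: "(U, W, \<phi>) \<in> atlas"
  then obtain \<Phi> k where "shander_chart M Q P U W \<phi> \<Phi> k" by (auto simp: atlas_def)
  then interpret ch: shander_coordinates n M g Q P U W \<phi> \<Phi> k
    by (intro shander_coordinates.intro shander_coordinates_axioms.intro super_null_riemannian_axioms)
  show "openin (points M) U \<and> open W" using ch.U_open ch.W_open by blast
  show "homeomorphic_map (subtopology (points M) U) (top_of_set W) \<phi>" by (rule ch.homeo)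
  show "smooth_on W (\<lambda>x. f (inv_into U \<phi> x))" if "f \<in> C" for f
    using that ch.val_smooth A.grade_carrier by (auto simp: C_def)
  show "(\<lambda>m. if m \<in> U then F (\<phi> m) else 0) \<in> C"
    if F: "smooth_on W F" and K: "compact K" "K \<subseteq> W" "\<And>x. x \<in> W - K \<Longrightarrow> F x = 0" for F K
  proof -
    obtain f where "f \<in> carrier A" "val f = (\<lambda>m. if m \<in> U then F (\<phi> m) else 0)"
      "val (Q f) = (\<lambda>m. if m \<in> U then 0 else 0)"
      by (rule val_extend[OF at F smooth_on_const K]) blast+
    then show ?thesis unfolding C_def by (intro image_eqI[of _ _ f]) (auto simp: grade_even_iff)
  qed
qed

end

sublocale super_null_riemannian \<subseteq> smooth_function_algebra "points M" C atlas
  by (rule smooth_functions)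

context super_null_riemannian
begin

lemma val_C: "f \<in> carrier A \<Longrightarrow> val f \<in> C"
proof -
  assume f: "f \<in> carrier A"
  obtain f0 f1 where d: "f0 \<in> grade A 0" "f1 \<in> grade A 1" "f = f0 \<oplus>\<^bsub>A\<^esub> f1"
    using decompose[OF f] .
  have "val f = val f0"
    using d A.grade_carrier val_odd[OF d(2)] by (auto simp: val_add)
  then show ?thesis using d(1) by (simp add: C_def)
qed

text \<open>P is a coordinate field in a Shander chart, so the cut-off coordinate serves. Needed to
  conclude \<xi> = 0 from \<xi>^2 P = 0.\<close>

lemma P_nonvanishing:
  assumes "m \<in> pts"
  obtains f where "f \<in> grade A 0" "val (P f) m = 1"
proof -
  obtain U and W :: "(real^'n) set" and \<phi> \<Phi> k where m: "m \<in> U" "shander_coordinates M g Q P U W \<phi> \<Phi> k"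
    using shander_at[OF assms] .
  interpret ch: shander_coordinates n M g Q P U W \<phi> \<Phi> k by (rule m(2))
  obtain s where s: "s > 0" "ball (\<phi> m) s \<subseteq> W"
    using ch.W_open ch.\<phi>_W[OF m(1)] openE by blast
  obtain \<eta> \<rho> where \<eta>: "0 < \<rho>" "\<rho> < s" "\<eta> \<in> C"
    "\<And>m'. m' \<in> U \<Longrightarrow> \<phi> m' \<in> ball (\<phi> m) \<rho> \<Longrightarrow> \<eta> m' = 1"
    "\<And>m'. m' \<in> U \<Longrightarrow> \<phi> m' \<notin> ball (\<phi> m) s \<Longrightarrow> \<eta> m' = 0" "\<And>m'. m' \<notin> U \<Longrightarrow> \<eta> m' = 0"
    "\<And>h. smooth_on (ball (\<phi> m) s) h \<Longrightarrow> (\<lambda>m'. \<eta> m' * h (\<phi> m')) \<in> C"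
    by (rule cutoff[OF ch.in_atlas s]) (rule that)
  have "(\<lambda>m'. \<eta> m' * \<phi> m' $ k) \<in> val ` grade A 0"
    using \<eta>(7)[OF smooth_on_nth, of k] by (simp add: C_def)
  then obtain f where f: "val f = (\<lambda>m'. \<eta> m' * \<phi> m' $ k)" "f \<in> grade A 0"
    by (rule imageE) (rule that, rule sym)
  have W: "x \<in> W" if "x \<in> ball (\<phi> m) \<rho>" for x using that \<eta>(2) s(2) by auto
  have "val (P f) m = partial k (\<lambda>x. val f (inv_into U \<phi> x)) (\<phi> m)"
    using ch.val_P[OF A.grade_carrier[OF f(2)] ch.\<phi>_W[OF m(1)]] ch.\<psi>(3)[OF m(1)] by simp
  also have "\<dots> = partial k (\<lambda>x. x $ k) (\<phi> m)"
    using \<eta>(1,4) ch.\<psi>(1,2) W f(1) by (intro partial_cong[of "ball (\<phi> m) \<rho>"]) auto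
  finally show ?thesis using that f(2) by (simp add: partial_nth)
qed

text \<open>The odd coordinates of the Shander charts agree on overlaps, since value 0 and Q-value 1
  determine both coefficients; they glue to a global function.\<close>

lemma odd_unit_exists: "\<exists>\<tau> \<in> grade A 1. \<forall>m \<in> pts. val (Q \<tau>) m = 1"
proof -
  define \<U> where "\<U> = {U. \<exists>(W :: (real^'n) set) \<phi> \<Phi> k. shander_coordinates M g Q P U W \<phi> \<Phi> k}"
  \<comment> \<open>\<open>val\<close> and \<open>Q\<close> apply to global functions only, so a
    section over U is characterised by comparing its restrictions with those of global
    functions.\<close>
  define good where "good U s \<longleftrightarrow> s \<in> carrier (sect M U) \<and>
    (\<forall>V f. openin (points M) V \<longrightarrow> V \<subseteq> U \<longrightarrow> f \<in> carrier A \<longrightarrow>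
      (restr M pts V f = restr M U V s \<longleftrightarrow> (\<forall>m \<in> V. val f m = 0 \<and> val (Q f) m = 1)))" for U s
  have ex: "\<exists>s. good U s" if "U \<in> \<U>" for U
  proof -
    obtain W :: "(real^'n) set" and \<phi> \<Phi> k where "shander_coordinates M g Q P U W \<phi> \<Phi> k"
      using \<open>U \<in> \<U>\<close> by (auto simp: \<U>_def)
    then interpret ch: shander_coordinates n M g Q P U W \<phi> \<Phi> k .
    have "superfun_of W (\<lambda>x. 0) (\<lambda>x. 1) \<in> superfuns 1 (\<phi> ` U)"
      unfolding ch.\<phi>_bij(1) by (intro superfun_of_superfuns ch.W_open smooth_on_const)
    then obtain s where s: "s \<in> carrier (sect M U)" "\<Phi> U s = superfun_of W (\<lambda>x. 0) (\<lambda>x. 1)"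
      using bij_betw_imp_surj_on[OF ch.\<Phi>_bij[OF ch.U_open order_refl]] by force
    have "good U s"
      unfolding good_def using s ch.\<phi>_W by (auto simp: ch.restr_eq_val superfun_of_simps subset_iff)
    then show ?thesis ..
  qed
  define s where "s U = (SOME s. good U s)" for U
  have s: "good U (s U)" if "U \<in> \<U>" for U
    unfolding s_def using ex[OF that] by (rule someI_ex)
  have \<U>_open: "openin (points M) U" if "U \<in> \<U>" for U
  proof -
    obtain W :: "(real^'n) set" and \<phi> \<Phi> k where "shander_coordinates M g Q P U W \<phi> \<Phi> k"
      using \<open>U \<in> \<U>\<close> by (auto simp: \<U>_def)
    then interpret ch: shander_coordinates n M g Q P U W \<phi> \<Phi> k .
    show ?thesis by (rule ch.U_open)
  qed
  have sc: "s U \<in> carrier (sect M U)" if "U \<in> \<U>" for U using s[OF that] by (simp add: good_def)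
  have Un: "\<Union>\<U> = pts"
  proof
    show "\<Union>\<U> \<subseteq> pts" using \<U>_open openin_subset by blast
    show "pts \<subseteq> \<Union>\<U>"
    proof
      fix m assume "m \<in> pts"
      then obtain U and W :: "(real^'n) set" and \<phi> \<Phi> k
        where "m \<in> U" "shander_coordinates M g Q P U W \<phi> \<Phi> k" by (rule shander_at)
      then show "m \<in> \<Union>\<U>" unfolding \<U>_def by blast
    qed
  qed
  have "\<exists>!f. f \<in> carrier (sect M (\<Union>\<U>)) \<and> (\<forall>U\<in>\<U>. restr M (\<Union>\<U>) U f = s U)"
  proof (rule gluing)
    fix U U' assume U: "U \<in> \<U>" "U' \<in> \<U>"
    note oU = \<U>_open[OF U(1)] \<U>_open[OF U(2)]
    have o: "openin (points M) (U \<inter> U')" using oU by blast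
    show "restr M U (U \<inter> U') (s U) = restr M U' (U \<inter> U') (s U')"
    proof (rule sections_eq_locally[OF o])
      show "restr M U (U \<inter> U') (s U) \<in> carrier (sect M (U \<inter> U'))"
        "restr M U' (U \<inter> U') (s U') \<in> carrier (sect M (U \<inter> U'))"
        using restr_homD(1)[OF oU(1) o _ sc[OF U(1)]] restr_homD(1)[OF oU(2) o _ sc[OF U(2)]] by auto
      fix m assume m: "m \<in> U \<inter> U'"
      obtain W :: "(real^'n) set" and \<phi> \<Phi> k where "shander_coordinates M g Q P U W \<phi> \<Phi> k"
        using U(1) by (auto simp: \<U>_def)
      then interpret ch: shander_coordinates n M g Q P U W \<phi> \<Phi> k .
      obtain e where e: "e > 0" "cball (\<phi> m) e \<subseteq> W"
        using ch.W_open ch.\<phi>_W m open_contains_cball by blast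
      obtain b where b: "smooth_on UNIV b" "\<And>y. y \<in> cball (\<phi> m) (e / 2) \<Longrightarrow> b y = 1"
        "\<And>y. y \<notin> ball (\<phi> m) (2 * (e / 2)) \<Longrightarrow> b y = 0"
        using exists_bump[of "e / 2" "\<phi> m"] e(1) by auto
      \<comment> \<open>A global function with value 0 and Q-value 1 near m; both local sections
        restrict to it there, hence they agree there.\<close>
      obtain f where f: "f \<in> carrier A" "val f = (\<lambda>m. if m \<in> U then 0 else 0)"
        "val (Q f) = (\<lambda>m. if m \<in> U then b (\<phi> m) else 0)"
        by (rule val_extend[OF ch.in_atlas smooth_on_const smooth_on_subset[OF b(1)] compact_cball e(2)])
          (use b(3) in auto)
      define N where "N = {m' \<in> U. \<phi> m' \<in> ball (\<phi> m) (e / 2)} \<inter> U'"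
      have N: "openin (points M) N" "m \<in> N" "N \<subseteq> U" "N \<subseteq> U'" "N \<subseteq> U \<inter> U'"
        using openin_Int[OF ch.preimage_open[OF open_ball] oU(2)] m e(1)
        by (auto simp: N_def simp del: mem_ball)
      have "\<forall>m \<in> N. val f m = 0 \<and> val (Q f) m = 1" using f b(2) by (auto simp: N_def)
      then have "restr M U N (s U) = restr M U' N (s U')"
        using s[OF U(1)] s[OF U(2)] N f(1) unfolding good_def by metis
      then have "restr M (U \<inter> U') N (restr M U (U \<inter> U') (s U)) = restr M (U \<inter> U') N (restr M U' (U \<inter> U') (s U'))"
        using restr_comp[OF oU(1) o N(1,5) _ sc[OF U(1)]] restr_comp[OF oU(2) o N(1,5) _ sc[OF U(2)]] by auto
      then show "\<exists>N. openin (points M) N \<and> m \<in> N \<and> N \<subseteq> U \<inter> U' \<and>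
          restr M (U \<inter> U') N (restr M U (U \<inter> U') (s U)) = restr M (U \<inter> U') N (restr M U' (U \<inter> U') (s U'))"
        using N by blast
    qed
  qed (use \<U>_open sc in auto)
  then obtain \<tau> where \<tau>: "\<tau> \<in> carrier (sect M pts)" "\<And>U. U \<in> \<U> \<Longrightarrow> restr M pts U \<tau> = s U"
    unfolding Un by blast
  have c: "\<tau> \<in> carrier A" using \<tau>(1) by (simp add: Cinf_def)
  have v: "val \<tau> m = 0 \<and> val (Q \<tau>) m = 1" if m: "m \<in> pts" for m
  proof -
    obtain U where U: "U \<in> \<U>" "m \<in> U" using Un m by blast
    have "restr M pts U \<tau> = restr M U U (s U)"
      using \<tau>(2)[OF U(1)] restr_id[OF \<U>_open[OF U(1)] sc[OF U(1)]] by simp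
    then show ?thesis
      using iffD1[OF s[OF U(1), unfolded good_def, THEN conjunct2, rule_format, OF \<U>_open[OF U(1)] order_refl c]]
        U(2) by blast
  qed
  have "val \<tau> m = 0" for m
    using v[of m] val_outside[of m \<tau>] by (cases "m \<in> pts") simp_all
  then have "\<tau> \<in> grade A 1" using c by (simp add: grade_odd_iff)
  with v show ?thesis by blast
qed

end

section \<open>Vector fields and the super-null Lie algebra\<close>

lemma bit_eq: "(p::bit) = 0 \<or> p = 1"
  by (cases p) auto

lemma bit_add_self [simp]: "(p::bit) + p = 0" "(p::bit) + (p + q) = q"
  using bit_eq[of p] by auto

lemma koszul_laws:
  "koszul (p + q) r = koszul p r * koszul q r" "koszul p (q + r) = koszul p q * koszul p r"
  "koszul p q = koszul q p" "koszul p q * koszul p q = 1"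
  using bit_eq[of p] bit_eq[of q] bit_eq[of r] by auto

lemma (in abelian_monoid) finsum_bit:
  assumes "f 0 \<in> carrier G" "f 1 \<in> carrier G"
  shows "(\<Oplus>p \<in> (UNIV :: bit set). f p) = f 0 \<oplus> f 1"
proof -
  have U: "(UNIV :: bit set) = {0, 1}" using bit_eq by auto
  show ?thesis unfolding U using assms by (subst finsum_insert) auto
qed

section \<open>Parity components, commutators and the graded Jacobi identity\<close>

context super_null_riemannian
begin

abbreviation D where "D \<equiv> derivations A"
abbreviation V where "V \<equiv> Vect M"

lemma val_minus: "f \<in> carrier A \<Longrightarrow> h \<in> carrier A \<Longrightarrow> val (f \<ominus>\<^bsub>A\<^esub> h) m = val f m - val h m"
  and val_Q_minus: "f \<in> carrier A \<Longrightarrow> h \<in> carrier A \<Longrightarrow> val (Q (f \<ominus>\<^bsub>A\<^esub> h)) m = val (Q f) m - val (Q h) m"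
  by (simp_all add: A.minus_smult val_add val_smult val_Q_add val_Q_smult A.smult_simps(1))

lemma val_Q_zero: "val (Q \<zero>\<^bsub>A\<^esub>) m = 0"
  using val_Q_even[OF A.grade_zero] .

lemmas val_simps = val_add val_smult val_mult val_zero val_one val_minus val_Q_zero val_Q_one
  val_Q_add val_Q_smult val_Q_mult val_Q_minus A.smult_simps(1)

lemma Vect_simps: "grade V p = D p" "\<zero>\<^bsub>V\<^esub> = (\<lambda>f \<in> carrier A. \<zero>\<^bsub>A\<^esub>)"
  "X \<oplus>\<^bsub>V\<^esub> Y = (\<lambda>f \<in> carrier A. X f \<oplus>\<^bsub>A\<^esub> Y f)" "c \<odot>\<^bsub>V\<^esub> X = (\<lambda>f \<in> carrier A. c \<odot>\<^bsub>A\<^esub> X f)"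
  by (simp_all add: Vect_def Der_def)

lemma Vect_carrier: "carrier V = {X \<oplus>\<^bsub>V\<^esub> Y | X Y. X \<in> D 0 \<and> Y \<in> D 1}"
  by (simp add: Vect_def Der_def)

lemma D_minus: "X \<in> D p \<Longrightarrow> f \<in> carrier A \<Longrightarrow> h \<in> carrier A \<Longrightarrow> X (f \<ominus>\<^bsub>A\<^esub> h) = X f \<ominus>\<^bsub>A\<^esub> X h"
  by (simp add: A.minus_smult derivationsD(1,2,3) A.smult_simps(1))

lemma D_eqI: "X \<in> D p \<Longrightarrow> Y \<in> D q \<Longrightarrow> (\<And>f. f \<in> carrier A \<Longrightarrow> X f = Y f) \<Longrightarrow> X = Y"
  using derivationsD(7) extensionalityI by metis

lemma derivationsI:
  assumes "\<And>f. f \<in> carrier A \<Longrightarrow> X f \<in> carrier A"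
    "\<And>f h. f \<in> carrier A \<Longrightarrow> h \<in> carrier A \<Longrightarrow> X (f \<oplus>\<^bsub>A\<^esub> h) = X f \<oplus>\<^bsub>A\<^esub> X h"
    "\<And>c f. f \<in> carrier A \<Longrightarrow> X (c \<odot>\<^bsub>A\<^esub> f) = c \<odot>\<^bsub>A\<^esub> X f"
    "\<And>r f. f \<in> grade A r \<Longrightarrow> X f \<in> grade A (p + r)"
    "\<And>r f h. f \<in> grade A r \<Longrightarrow> h \<in> carrier A \<Longrightarrow>
      X (f \<otimes>\<^bsub>A\<^esub> h) = X f \<otimes>\<^bsub>A\<^esub> h \<oplus>\<^bsub>A\<^esub> koszul p r \<odot>\<^bsub>A\<^esub> (f \<otimes>\<^bsub>A\<^esub> X h)"
  shows "restrict X (carrier A) \<in> D p"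
  using assms A.grade_carrier
  by (auto simp: derivations_def A.smult_simps(1))

lemma D_zero: "\<zero>\<^bsub>V\<^esub> \<in> D p"
  unfolding Vect_simps
  by (rule derivationsI) (auto simp: A.smult_simps A.grade_zero A.grade_carrier)

lemma D_add:
  assumes X: "X \<in> D p" and Y: "Y \<in> D p"
  shows "X \<oplus>\<^bsub>V\<^esub> Y \<in> D p"
  unfolding Vect_simps
proof (rule derivationsI)
  note s = derivationsD[OF X] derivationsD[OF Y]
  fix r f h assume f: "f \<in> grade A r" and h: "h \<in> carrier A"
  have f': "f \<in> carrier A" using f by (rule A.grade_carrier)
  show "X (f \<otimes>\<^bsub>A\<^esub> h) \<oplus>\<^bsub>A\<^esub> Y (f \<otimes>\<^bsub>A\<^esub> h) =
      (X f \<oplus>\<^bsub>A\<^esub> Y f) \<otimes>\<^bsub>A\<^esub> h \<oplus>\<^bsub>A\<^esub> koszul p r \<odot>\<^bsub>A\<^esub> (f \<otimes>\<^bsub>A\<^esub> (X h \<oplus>\<^bsub>A\<^esub> Y h))"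
    unfolding s(5)[OF f h] s(12)[OF f h]
    by (rule val_eqI) (simp_all add: s f' h val_simps algebra_simps)
next
  fix f assume f: "f \<in> carrier A"
  then show "X f \<oplus>\<^bsub>A\<^esub> Y f \<in> carrier A"
    by (intro A.a_closed derivationsD(1)[OF X] derivationsD(1)[OF Y])
  show "X (c \<odot>\<^bsub>A\<^esub> f) \<oplus>\<^bsub>A\<^esub> Y (c \<odot>\<^bsub>A\<^esub> f) = c \<odot>\<^bsub>A\<^esub> (X f \<oplus>\<^bsub>A\<^esub> Y f)" for c
    using f by (simp add: derivationsD[OF X] derivationsD[OF Y] A.smult_simps)
  fix h assume h: "h \<in> carrier A"
  show "X (f \<oplus>\<^bsub>A\<^esub> h) \<oplus>\<^bsub>A\<^esub> Y (f \<oplus>\<^bsub>A\<^esub> h) = X f \<oplus>\<^bsub>A\<^esub> Y f \<oplus>\<^bsub>A\<^esub> (X h \<oplus>\<^bsub>A\<^esub> Y h)"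
    using f h by (simp add: derivationsD(1,2)[OF X] derivationsD(1,2)[OF Y] A.a_ac)
next
  fix r f assume f: "f \<in> grade A r"
  show "X f \<oplus>\<^bsub>A\<^esub> Y f \<in> grade A (p + r)"
    by (intro A.grade_add derivationsD(4)[OF X f] derivationsD(4)[OF Y f])
qed

lemma D_smult:
  assumes X: "X \<in> D p"
  shows "c \<odot>\<^bsub>V\<^esub> X \<in> D p"
  unfolding Vect_simps
proof (rule derivationsI)
  note s = derivationsD[OF X]
  fix r f h assume f: "f \<in> grade A r" and h: "h \<in> carrier A"
  have f': "f \<in> carrier A" using f by (rule A.grade_carrier)
  show "c \<odot>\<^bsub>A\<^esub> X (f \<otimes>\<^bsub>A\<^esub> h) =
      (c \<odot>\<^bsub>A\<^esub> X f) \<otimes>\<^bsub>A\<^esub> h \<oplus>\<^bsub>A\<^esub> koszul p r \<odot>\<^bsub>A\<^esub> (f \<otimes>\<^bsub>A\<^esub> (c \<odot>\<^bsub>A\<^esub> X h))"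
    unfolding s(5)[OF f h]
    by (rule val_eqI) (simp_all add: s f' h val_simps algebra_simps)
next
  fix f assume f: "f \<in> carrier A"
  then show "c \<odot>\<^bsub>A\<^esub> X f \<in> carrier A" using derivationsD(1)[OF X] A.smult_simps(1) by blast
  show "c \<odot>\<^bsub>A\<^esub> X (d \<odot>\<^bsub>A\<^esub> f) = d \<odot>\<^bsub>A\<^esub> (c \<odot>\<^bsub>A\<^esub> X f)" for d
    using f by (simp add: derivationsD[OF X] A.smult_simps mult.commute)
  fix h assume h: "h \<in> carrier A"
  show "c \<odot>\<^bsub>A\<^esub> X (f \<oplus>\<^bsub>A\<^esub> h) = c \<odot>\<^bsub>A\<^esub> X f \<oplus>\<^bsub>A\<^esub> c \<odot>\<^bsub>A\<^esub> X h"
    using f h by (simp add: derivationsD(1,2)[OF X] A.smult_simps)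
next
  fix r f assume f: "f \<in> grade A r"
  show "c \<odot>\<^bsub>A\<^esub> X f \<in> grade A (p + r)"
    by (intro A.grade_smult derivationsD(4)[OF X f])
qed

lemma VectE:
  assumes "X \<in> carrier V"
  obtains X0 X1 where "X0 \<in> D 0" "X1 \<in> D 1" "X = X0 \<oplus>\<^bsub>V\<^esub> X1"
  using assms unfolding Vect_carrier by blast

lemma VectI: "X \<in> D 0 \<Longrightarrow> Y \<in> D 1 \<Longrightarrow> X \<oplus>\<^bsub>V\<^esub> Y \<in> carrier V"
  unfolding Vect_carrier by blast

lemma VectD:
  assumes "X \<in> carrier V"
  shows "f \<in> carrier A \<Longrightarrow> X f \<in> carrier A"
    "f \<in> carrier A \<Longrightarrow> h \<in> carrier A \<Longrightarrow> X (f \<oplus>\<^bsub>A\<^esub> h) = X f \<oplus>\<^bsub>A\<^esub> X h"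
    "f \<in> carrier A \<Longrightarrow> X (c \<odot>\<^bsub>A\<^esub> f) = c \<odot>\<^bsub>A\<^esub> X f"
    "X \<in> extensional (carrier A)"
proof -
  obtain X0 X1 where X: "X0 \<in> D 0" "X1 \<in> D 1" "X = X0 \<oplus>\<^bsub>V\<^esub> X1" using VectE[OF assms] .
  note s = derivationsD(1-3)[OF X(1)] derivationsD(1-3)[OF X(2)]
  show "f \<in> carrier A \<Longrightarrow> X f \<in> carrier A"
    "f \<in> carrier A \<Longrightarrow> h \<in> carrier A \<Longrightarrow> X (f \<oplus>\<^bsub>A\<^esub> h) = X f \<oplus>\<^bsub>A\<^esub> X h"
    "f \<in> carrier A \<Longrightarrow> X (c \<odot>\<^bsub>A\<^esub> f) = c \<odot>\<^bsub>A\<^esub> X f"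
    "X \<in> extensional (carrier A)"
    unfolding X(3) Vect_simps by (simp_all add: s A.smult_simps A.a_ac)
qed

lemma Vect_eqI: "X \<in> carrier V \<Longrightarrow> Y \<in> carrier V \<Longrightarrow> (\<And>f. f \<in> carrier A \<Longrightarrow> X f = Y f) \<Longrightarrow> X = Y"
  using VectD(4) extensionalityI by metis

lemma D_Vect: "X \<in> D p \<Longrightarrow> X \<in> carrier V"
proof -
  assume X: "X \<in> D p"
  have "X = X \<oplus>\<^bsub>V\<^esub> \<zero>\<^bsub>V\<^esub>" "X = \<zero>\<^bsub>V\<^esub> \<oplus>\<^bsub>V\<^esub> X"
    using derivationsD(1,7)[OF X] unfolding Vect_simps by (auto simp: extensional_def)
  then show ?thesis using VectI D_zero X bit_eq[of p] by metis
qed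

lemma V_add: "f \<in> carrier A \<Longrightarrow> (X \<oplus>\<^bsub>V\<^esub> Y) f = X f \<oplus>\<^bsub>A\<^esub> Y f"
  and V_smult: "f \<in> carrier A \<Longrightarrow> (c \<odot>\<^bsub>V\<^esub> X) f = c \<odot>\<^bsub>A\<^esub> X f"
  and V_zero: "f \<in> carrier A \<Longrightarrow> \<zero>\<^bsub>V\<^esub> f = \<zero>\<^bsub>A\<^esub>"
  by (simp_all add: Vect_simps)

lemma Vect_add_closed: "X \<in> carrier V \<Longrightarrow> Y \<in> carrier V \<Longrightarrow> X \<oplus>\<^bsub>V\<^esub> Y \<in> carrier V"
proof -
  assume a: "X \<in> carrier V" "Y \<in> carrier V"
  obtain X0 X1 where X: "X0 \<in> D 0" "X1 \<in> D 1" "X = X0 \<oplus>\<^bsub>V\<^esub> X1" using VectE[OF a(1)] .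
  obtain Y0 Y1 where Y: "Y0 \<in> D 0" "Y1 \<in> D 1" "Y = Y0 \<oplus>\<^bsub>V\<^esub> Y1" using VectE[OF a(2)] .
  have "X \<oplus>\<^bsub>V\<^esub> Y = (X0 \<oplus>\<^bsub>V\<^esub> Y0) \<oplus>\<^bsub>V\<^esub> (X1 \<oplus>\<^bsub>V\<^esub> Y1)"
    using X(1,2) Y(1,2) unfolding X(3) Y(3) Vect_simps
    by (auto simp: derivationsD(1) A.a_ac intro!: restrict_ext)
  then show ?thesis using VectI D_add X Y by simp
qed

lemma Vect_smult_closed: "X \<in> carrier V \<Longrightarrow> c \<odot>\<^bsub>V\<^esub> X \<in> carrier V"
proof -
  assume a: "X \<in> carrier V"
  obtain X0 X1 where X: "X0 \<in> D 0" "X1 \<in> D 1" "X = X0 \<oplus>\<^bsub>V\<^esub> X1" using VectE[OF a] .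
  have "c \<odot>\<^bsub>V\<^esub> X = c \<odot>\<^bsub>V\<^esub> X0 \<oplus>\<^bsub>V\<^esub> c \<odot>\<^bsub>V\<^esub> X1"
    using X(1,2) unfolding X(3) Vect_simps
    by (auto simp: derivationsD(1) A.smult_simps intro!: restrict_ext)
  then show ?thesis using VectI D_smult X by simp
qed

lemma Vect_zero_closed: "\<zero>\<^bsub>V\<^esub> \<in> carrier V"
  by (rule D_Vect[OF D_zero])

lemmas Vect_closed = Vect_add_closed Vect_smult_closed Vect_zero_closed

text \<open>Stated for any structure that inherits the operations of \<open>V\<close>, so that it
  serves both all vector fields and the super-null ones.\<close>

lemma vectorspace_subset:
  assumes S: "carrier W = S" "S \<subseteq> carrier V" "\<zero>\<^bsub>V\<^esub> \<in> S"
    "\<And>X Y. X \<in> S \<Longrightarrow> Y \<in> S \<Longrightarrow> X \<oplus>\<^bsub>V\<^esub> Y \<in> S" "\<And>c X. X \<in> S \<Longrightarrow> c \<odot>\<^bsub>V\<^esub> X \<in> S"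
    and W: "zero W = \<zero>\<^bsub>V\<^esub>" "add W = add V" "smult W = smult V"
  shows "vectorspace real_ring W"
proof -
  have SV: "X \<in> carrier V" if "X \<in> S" for X using that S(2) by blast
  have "\<exists>Y\<in>S. X \<oplus>\<^bsub>V\<^esub> Y = \<zero>\<^bsub>V\<^esub>" if X: "X \<in> S" for X
    proof
      show "(-1) \<odot>\<^bsub>V\<^esub> X \<in> S" using S(5) X .
      show "X \<oplus>\<^bsub>V\<^esub> (-1) \<odot>\<^bsub>V\<^esub> X = \<zero>\<^bsub>V\<^esub>"
      proof (rule Vect_eqI)
        fix f assume f: "f \<in> carrier A"
        then show "(X \<oplus>\<^bsub>V\<^esub> (-1) \<odot>\<^bsub>V\<^esub> X) f = \<zero>\<^bsub>V\<^esub> f"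
          using VectD(1)[OF SV[OF X] f] A.a_inv_smult[of "X f"] A.r_neg[of "X f"]
          by (simp add: V_add V_smult V_zero)
      qed (use SV[OF X] Vect_closed in auto)
    qed
  moreover have "X \<oplus>\<^bsub>V\<^esub> Y = Y \<oplus>\<^bsub>V\<^esub> X" if "X \<in> S" "Y \<in> S" for X Y
    using that SV by (intro Vect_eqI) (auto simp: Vect_closed V_add VectD(1) A.a_comm)
  moreover have "X \<oplus>\<^bsub>V\<^esub> Y \<oplus>\<^bsub>V\<^esub> Z = X \<oplus>\<^bsub>V\<^esub> (Y \<oplus>\<^bsub>V\<^esub> Z)" if "X \<in> S" "Y \<in> S" "Z \<in> S" for X Y Z
    using that SV by (intro Vect_eqI) (auto simp: Vect_closed V_add VectD(1) A.a_assoc)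
  moreover have "X \<oplus>\<^bsub>V\<^esub> \<zero>\<^bsub>V\<^esub> = X" if "X \<in> S" for X
    using that SV by (intro Vect_eqI) (auto simp: Vect_closed V_add V_zero VectD(1))
  moreover have "(a * b) \<odot>\<^bsub>V\<^esub> X = a \<odot>\<^bsub>V\<^esub> (b \<odot>\<^bsub>V\<^esub> X)" if "X \<in> S" for a b X
    using that SV by (intro Vect_eqI) (auto simp: Vect_closed V_smult VectD(1) A.smult_simps)
  moreover have "1 \<odot>\<^bsub>V\<^esub> X = X" if "X \<in> S" for X
    using that SV by (intro Vect_eqI) (auto simp: Vect_closed V_smult VectD(1) A.smult_simps)
  moreover have "(a + b) \<odot>\<^bsub>V\<^esub> X = a \<odot>\<^bsub>V\<^esub> X \<oplus>\<^bsub>V\<^esub> b \<odot>\<^bsub>V\<^esub> X" if "X \<in> S" for a b X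
    using that SV by (intro Vect_eqI) (auto simp: Vect_closed V_smult V_add VectD(1) A.smult_simps)
  moreover have "a \<odot>\<^bsub>V\<^esub> (X \<oplus>\<^bsub>V\<^esub> Y) = a \<odot>\<^bsub>V\<^esub> X \<oplus>\<^bsub>V\<^esub> a \<odot>\<^bsub>V\<^esub> Y" if "X \<in> S" "Y \<in> S" for a X Y
    using that SV by (intro Vect_eqI) (auto simp: Vect_closed V_smult V_add VectD(1) A.smult_simps)
  ultimately show ?thesis
    using A.field_axioms S by (intro vs_criteria) (simp_all add: W)
qed

lemma Vect_vectorspace: "vectorspace real_ring V"
  by (rule vectorspace_subset[of V "carrier V"]) (auto intro: Vect_closed)

lemma homogeneous_parts_unique:
  assumes "f0 \<in> grade A p" "f1 \<in> grade A (p + 1)" "h0 \<in> grade A p" "h1 \<in> grade A (p + 1)"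
    and eq: "f0 \<oplus>\<^bsub>A\<^esub> f1 = h0 \<oplus>\<^bsub>A\<^esub> h1"
  shows "f0 = h0" "f1 = h1"
proof -
  have c: "f0 \<in> carrier A" "f1 \<in> carrier A" "h0 \<in> carrier A" "h1 \<in> carrier A"
    using assms A.grade_carrier by auto
  have v: "val f0 m + val f1 m = val h0 m + val h1 m"
    "val (Q f0) m + val (Q f1) m = val (Q h0) m + val (Q h1) m" for m
    using arg_cong[OF eq, of "\<lambda>f. val f m"] arg_cong[OF eq, of "\<lambda>f. val (Q f) m"] c
    by (simp_all add: val_simps)
  have "(val f1 m = 0 \<and> val h1 m = 0 \<and> val (Q f0) m = 0 \<and> val (Q h0) m = 0) \<or>
    (val f0 m = 0 \<and> val h0 m = 0 \<and> val (Q f1) m = 0 \<and> val (Q h1) m = 0)" for m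
    using bit_eq[of p] assms(1-4) val_odd val_Q_even by auto
  then have "val f0 m = val h0 m \<and> val (Q f0) m = val (Q h0) m \<and> val f1 m = val h1 m \<and> val (Q f1) m = val (Q h1) m" for m
    using v[of m] by (smt (verit))
  then show "f0 = h0" "f1 = h1" using c by (auto intro: val_eqI)
qed

lemma D_parts_unique:
  assumes "X0 \<in> D p" "X1 \<in> D (p + 1)" "Y0 \<in> D p" "Y1 \<in> D (p + 1)"
    and eq: "X0 \<oplus>\<^bsub>V\<^esub> X1 = Y0 \<oplus>\<^bsub>V\<^esub> Y1"
  shows "X0 = Y0" "X1 = Y1"
proof -
  have hom: "X0 f = Y0 f \<and> X1 f = Y1 f" if f: "f \<in> grade A r" for f r
  proof -
    have "X0 f \<oplus>\<^bsub>A\<^esub> X1 f = Y0 f \<oplus>\<^bsub>A\<^esub> Y1 f"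
      using fun_cong[OF eq, of f] A.grade_carrier[OF f] by (simp add: V_add)
    moreover have "X1 f \<in> grade A ((p + r) + 1)" "Y1 f \<in> grade A ((p + r) + 1)"
      using derivationsD(4)[OF assms(2) f] derivationsD(4)[OF assms(4) f] by (simp_all only: add_ac)
    ultimately show ?thesis
      using homogeneous_parts_unique derivationsD(4)[OF assms(1) f] derivationsD(4)[OF assms(3) f] by blast
  qed
  have "X0 f = Y0 f \<and> X1 f = Y1 f" if f: "f \<in> carrier A" for f
  proof -
    obtain f0 f1 where d: "f0 \<in> grade A 0" "f1 \<in> grade A 1" "f = f0 \<oplus>\<^bsub>A\<^esub> f1"
      using decompose[OF f] .
    then show ?thesis
      using hom[OF d(1)] hom[OF d(2)] A.grade_carrier[OF d(1)] A.grade_carrier[OF d(2)]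
      by (simp add: derivationsD(2)[OF assms(1)] derivationsD(2)[OF assms(2)]
          derivationsD(2)[OF assms(3)] derivationsD(2)[OF assms(4)])
  qed
  then show "X0 = Y0" "X1 = Y1" using D_eqI assms(1-4) by blast+
qed

lemma Vect_add_comm: "X \<in> carrier V \<Longrightarrow> Y \<in> carrier V \<Longrightarrow> X \<oplus>\<^bsub>V\<^esub> Y = Y \<oplus>\<^bsub>V\<^esub> X"
  by (intro Vect_eqI Vect_closed) (auto simp: V_add VectD(1) A.a_comm)

lemma component_eqI:
  assumes "X \<in> D p" "Y \<in> D (p + 1)"
  shows "component V p (X \<oplus>\<^bsub>V\<^esub> Y) = X"
  unfolding component_def Vect_simps(1)
  using assms D_parts_unique(1) by (intro the_equality) blast+

definition part :: "bit \<Rightarrow> ('f \<Rightarrow> 'f) \<Rightarrow> 'f \<Rightarrow> 'f" where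
  "part p X = component V p X"

lemma part_eqI:
  assumes "X0 \<in> D 0" "X1 \<in> D 1" "X = X0 \<oplus>\<^bsub>V\<^esub> X1"
  shows "part 0 X = X0" "part 1 X = X1"
  using component_eqI[of X0 0 X1] component_eqI[of X1 1 X0] assms
    Vect_add_comm[OF D_Vect D_Vect] by (auto simp: part_def)

lemma part_D: "X \<in> carrier V \<Longrightarrow> part p X \<in> D p"
  and part_sum: "X \<in> carrier V \<Longrightarrow> X = part 0 X \<oplus>\<^bsub>V\<^esub> part 1 X"
proof -
  assume "X \<in> carrier V"
  then obtain X0 X1 where X: "X0 \<in> D 0" "X1 \<in> D 1" "X = X0 \<oplus>\<^bsub>V\<^esub> X1" by (rule VectE)
  show "part p X \<in> D p" "X = part 0 X \<oplus>\<^bsub>V\<^esub> part 1 X"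
    using part_eqI[OF X] X bit_eq[of p] by auto
qed

lemma part_add:
  assumes "X \<in> carrier V" "Y \<in> carrier V"
  shows "part p (X \<oplus>\<^bsub>V\<^esub> Y) = part p X \<oplus>\<^bsub>V\<^esub> part p Y"
proof -
  have "X \<oplus>\<^bsub>V\<^esub> Y = (part 0 X \<oplus>\<^bsub>V\<^esub> part 0 Y) \<oplus>\<^bsub>V\<^esub> (part 1 X \<oplus>\<^bsub>V\<^esub> part 1 Y)"
    by (subst part_sum[OF assms(1)], subst part_sum[OF assms(2)])
      (auto simp: Vect_simps derivationsD(1)[OF part_D[OF assms(1)]] derivationsD(1)[OF part_D[OF assms(2)]]
        A.a_ac intro!: restrict_ext)
  from part_eqI[OF D_add[OF part_D part_D] D_add[OF part_D part_D] this] assms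
  show ?thesis using bit_eq[of p] by auto
qed

lemma part_smult:
  assumes "X \<in> carrier V"
  shows "part p (c \<odot>\<^bsub>V\<^esub> X) = c \<odot>\<^bsub>V\<^esub> part p X"
proof -
  have "c \<odot>\<^bsub>V\<^esub> X = c \<odot>\<^bsub>V\<^esub> part 0 X \<oplus>\<^bsub>V\<^esub> c \<odot>\<^bsub>V\<^esub> part 1 X"
    by (subst part_sum[OF assms])
      (auto simp: Vect_simps derivationsD(1)[OF part_D[OF assms]] A.smult_simps intro!: restrict_ext)
  from part_eqI[OF D_smult[OF part_D] D_smult[OF part_D] this] assms
  show ?thesis using bit_eq[of p] by auto
qed

lemma part_homogeneous:
  assumes "X \<in> D p"
  shows "part q X = (if q = p then X else \<zero>\<^bsub>V\<^esub>)"
proof -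
  have e: "X = X \<oplus>\<^bsub>V\<^esub> \<zero>\<^bsub>V\<^esub>" "X = \<zero>\<^bsub>V\<^esub> \<oplus>\<^bsub>V\<^esub> X"
    using derivationsD(1,7)[OF assms] unfolding Vect_simps by (auto simp: extensional_def)
  show ?thesis
    using part_eqI[OF _ D_zero e(1)] part_eqI[OF D_zero _ e(2)] assms bit_eq[of p] bit_eq[of q] by auto
qed

text \<open>The parities are explicit arguments because they cannot be read off a field: zero is
  homogeneous of both parities.\<close>

definition hcomm :: "bit \<Rightarrow> bit \<Rightarrow> ('f \<Rightarrow> 'f) \<Rightarrow> ('f \<Rightarrow> 'f) \<Rightarrow> 'f \<Rightarrow> 'f" where
  "hcomm p q X Y = (\<lambda>f \<in> carrier A. X (Y f) \<ominus>\<^bsub>A\<^esub> koszul p q \<odot>\<^bsub>A\<^esub> Y (X f))"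

lemma hcomm_apply: "f \<in> carrier A \<Longrightarrow> hcomm p q X Y f = X (Y f) \<ominus>\<^bsub>A\<^esub> koszul p q \<odot>\<^bsub>A\<^esub> Y (X f)"
  by (simp add: hcomm_def)

lemma hcomm_D:
  assumes X: "X \<in> D p" and Y: "Y \<in> D q"
  shows "hcomm p q X Y \<in> D (p + q)"
  unfolding hcomm_def
proof (rule derivationsI)
  note s = derivationsD(1-3)[OF X] derivationsD(1-3)[OF Y]
  fix r f h assume f: "f \<in> grade A r" and h: "h \<in> carrier A"
  have f': "f \<in> carrier A" using f by (rule A.grade_carrier)
  note c = f' h s(1)[OF f'] s(1)[OF h] s(4)[OF f'] s(4)[OF h]
  have "X (Y (f \<otimes>\<^bsub>A\<^esub> h)) = X (Y f) \<otimes>\<^bsub>A\<^esub> h \<oplus>\<^bsub>A\<^esub> koszul p (q + r) \<odot>\<^bsub>A\<^esub> (Y f \<otimes>\<^bsub>A\<^esub> X h) \<oplus>\<^bsub>A\<^esub>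
      koszul q r \<odot>\<^bsub>A\<^esub> (X f \<otimes>\<^bsub>A\<^esub> Y h \<oplus>\<^bsub>A\<^esub> koszul p r \<odot>\<^bsub>A\<^esub> (f \<otimes>\<^bsub>A\<^esub> X (Y h)))"
    using c derivationsD(5)[OF Y f h] derivationsD(5)[OF X derivationsD(4)[OF Y f] h]
      derivationsD(5)[OF X f c(6)] by (simp add: s A.smult_simps(1))
  moreover have "Y (X (f \<otimes>\<^bsub>A\<^esub> h)) = Y (X f) \<otimes>\<^bsub>A\<^esub> h \<oplus>\<^bsub>A\<^esub> koszul q (p + r) \<odot>\<^bsub>A\<^esub> (X f \<otimes>\<^bsub>A\<^esub> Y h) \<oplus>\<^bsub>A\<^esub>
      koszul p r \<odot>\<^bsub>A\<^esub> (Y f \<otimes>\<^bsub>A\<^esub> X h \<oplus>\<^bsub>A\<^esub> koszul q r \<odot>\<^bsub>A\<^esub> (f \<otimes>\<^bsub>A\<^esub> Y (X h)))"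
    using c derivationsD(5)[OF X f h] derivationsD(5)[OF Y derivationsD(4)[OF X f] h]
      derivationsD(5)[OF Y f c(4)] by (simp add: s A.smult_simps(1))
  ultimately show "X (Y (f \<otimes>\<^bsub>A\<^esub> h)) \<ominus>\<^bsub>A\<^esub> koszul p q \<odot>\<^bsub>A\<^esub> Y (X (f \<otimes>\<^bsub>A\<^esub> h)) =
      (X (Y f) \<ominus>\<^bsub>A\<^esub> koszul p q \<odot>\<^bsub>A\<^esub> Y (X f)) \<otimes>\<^bsub>A\<^esub> h \<oplus>\<^bsub>A\<^esub>
      koszul (p + q) r \<odot>\<^bsub>A\<^esub> (f \<otimes>\<^bsub>A\<^esub> (X (Y h) \<ominus>\<^bsub>A\<^esub> koszul p q \<odot>\<^bsub>A\<^esub> Y (X h)))"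
    using bit_eq[of p] bit_eq[of q] bit_eq[of r]
    by (intro val_eqI) (auto simp: s c val_simps algebra_simps)
next
  note s = derivationsD(1-3)[OF X] derivationsD(1-3)[OF Y]
  fix f assume f: "f \<in> carrier A"
  show "X (Y f) \<ominus>\<^bsub>A\<^esub> koszul p q \<odot>\<^bsub>A\<^esub> Y (X f) \<in> carrier A" using f by (simp add: s A.smult_simps(1))
  show "X (Y (c \<odot>\<^bsub>A\<^esub> f)) \<ominus>\<^bsub>A\<^esub> koszul p q \<odot>\<^bsub>A\<^esub> Y (X (c \<odot>\<^bsub>A\<^esub> f)) =
      c \<odot>\<^bsub>A\<^esub> (X (Y f) \<ominus>\<^bsub>A\<^esub> koszul p q \<odot>\<^bsub>A\<^esub> Y (X f))" for c
    using f by (intro val_eqI) (auto simp: s val_simps algebra_simps)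
  fix h assume h: "h \<in> carrier A"
  show "X (Y (f \<oplus>\<^bsub>A\<^esub> h)) \<ominus>\<^bsub>A\<^esub> koszul p q \<odot>\<^bsub>A\<^esub> Y (X (f \<oplus>\<^bsub>A\<^esub> h)) =
      X (Y f) \<ominus>\<^bsub>A\<^esub> koszul p q \<odot>\<^bsub>A\<^esub> Y (X f) \<oplus>\<^bsub>A\<^esub> (X (Y h) \<ominus>\<^bsub>A\<^esub> koszul p q \<odot>\<^bsub>A\<^esub> Y (X h))"
    using f h by (intro val_eqI) (auto simp: s val_simps algebra_simps)
next
  fix r f assume f: "f \<in> grade A r"
  have "X (Y f) \<in> grade A (p + q + r)" "Y (X f) \<in> grade A (p + q + r)"
    using derivationsD(4)[OF X derivationsD(4)[OF Y f]] derivationsD(4)[OF Y derivationsD(4)[OF X f]]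
    by (simp_all only: add_ac)
  then show "X (Y f) \<ominus>\<^bsub>A\<^esub> koszul p q \<odot>\<^bsub>A\<^esub> Y (X f) \<in> grade A (p + q + r)"
    using A.grade_carrier by (simp add: A.minus_smult A.smult_simps(1) A.grade_add A.grade_smult)
qed

lemma commutator_Vect: "X \<in> carrier V \<Longrightarrow> Y \<in> carrier V \<Longrightarrow> commutator M X Y \<in> carrier V"
  and commutator_apply: "X \<in> carrier V \<Longrightarrow> Y \<in> carrier V \<Longrightarrow> f \<in> carrier A \<Longrightarrow> commutator M X Y f =
    (hcomm 0 0 (part 0 X) (part 0 Y) f \<oplus>\<^bsub>A\<^esub> hcomm 0 1 (part 0 X) (part 1 Y) f) \<oplus>\<^bsub>A\<^esub>
    (hcomm 1 0 (part 1 X) (part 0 Y) f \<oplus>\<^bsub>A\<^esub> hcomm 1 1 (part 1 X) (part 1 Y) f)"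
proof -
  assume X: "X \<in> carrier V" and Y: "Y \<in> carrier V"
  interpret VV: vectorspace real_ring V by (rule Vect_vectorspace)
  have c: "hcomm p q (part p X) (part q Y) \<in> carrier V" for p q
    using hcomm_D[OF part_D[OF X] part_D[OF Y]] D_Vect by blast
  have "commutator M X Y = (\<Oplus>\<^bsub>V\<^esub>p\<in>UNIV. \<Oplus>\<^bsub>V\<^esub>q\<in>UNIV. hcomm p q (part p X) (part q Y))"
    by (simp add: commutator_def hcomm_def part_def Let_def)
  also have "\<dots> = (hcomm 0 0 (part 0 X) (part 0 Y) \<oplus>\<^bsub>V\<^esub> hcomm 0 1 (part 0 X) (part 1 Y)) \<oplus>\<^bsub>V\<^esub>
      (hcomm 1 0 (part 1 X) (part 0 Y) \<oplus>\<^bsub>V\<^esub> hcomm 1 1 (part 1 X) (part 1 Y))"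
    using c by (simp add: VV.finsum_bit Vect_closed del: VV.finsum_addf)
  finally have e: "commutator M X Y = \<dots>" .
  show "commutator M X Y \<in> carrier V" unfolding e using c by (intro Vect_closed)
  show "f \<in> carrier A \<Longrightarrow> commutator M X Y f =
    (hcomm 0 0 (part 0 X) (part 0 Y) f \<oplus>\<^bsub>A\<^esub> hcomm 0 1 (part 0 X) (part 1 Y) f) \<oplus>\<^bsub>A\<^esub>
    (hcomm 1 0 (part 1 X) (part 0 Y) f \<oplus>\<^bsub>A\<^esub> hcomm 1 1 (part 1 X) (part 1 Y) f)"
    unfolding e by (simp add: V_add)
qed

lemma commutator_homogeneous:
  assumes X: "X \<in> D p" and Y: "Y \<in> D q"
  shows "commutator M X Y = hcomm p q X Y"
proof (rule Vect_eqI)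
  show "commutator M X Y \<in> carrier V" "hcomm p q X Y \<in> carrier V"
    using commutator_Vect hcomm_D[OF X Y] D_Vect X Y by blast+
  fix f assume f: "f \<in> carrier A"
  have z: "X \<zero>\<^bsub>A\<^esub> = \<zero>\<^bsub>A\<^esub>" if "X \<in> D p" for X p
    using derivationsD(3)[OF that A.zero_closed, of 0] derivationsD(1)[OF that A.zero_closed]
    by (simp add: A.smult_simps)
  note s = derivationsD(1)[OF X] derivationsD(1)[OF Y]
  show "commutator M X Y f = hcomm p q X Y f"
    using bit_eq[of p] bit_eq[of q] f z[OF X] z[OF Y] unfolding commutator_apply[OF D_Vect[OF X] D_Vect[OF Y] f]
    by (auto simp: part_homogeneous[OF X] part_homogeneous[OF Y] hcomm_apply V_zero s
        A.smult_simps A.minus_smult)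
qed

lemma commutator_add:
  assumes "X \<in> carrier V" "Y \<in> carrier V" "Z \<in> carrier V"
  shows "commutator M (X \<oplus>\<^bsub>V\<^esub> Y) Z = commutator M X Z \<oplus>\<^bsub>V\<^esub> commutator M Y Z"
    "commutator M Z (X \<oplus>\<^bsub>V\<^esub> Y) = commutator M Z X \<oplus>\<^bsub>V\<^esub> commutator M Z Y"
proof -
  note d = part_D[OF assms(1)] part_D[OF assms(2)] part_D[OF assms(3)]
  show "commutator M (X \<oplus>\<^bsub>V\<^esub> Y) Z = commutator M X Z \<oplus>\<^bsub>V\<^esub> commutator M Y Z"
    "commutator M Z (X \<oplus>\<^bsub>V\<^esub> Y) = commutator M Z X \<oplus>\<^bsub>V\<^esub> commutator M Z Y"
    using assms derivationsD(1-3)[OF d(1)] derivationsD(1-3)[OF d(2)] derivationsD(1-3)[OF d(3)]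
    by (auto intro!: Vect_eqI val_eqI commutator_Vect Vect_closed
        simp: commutator_apply Vect_closed part_add hcomm_apply V_add val_simps algebra_simps)
qed

lemma commutator_smult:
  assumes "X \<in> carrier V" "Y \<in> carrier V"
  shows "commutator M (c \<odot>\<^bsub>V\<^esub> X) Y = c \<odot>\<^bsub>V\<^esub> commutator M X Y"
    "commutator M X (c \<odot>\<^bsub>V\<^esub> Y) = c \<odot>\<^bsub>V\<^esub> commutator M X Y"
proof -
  note d = part_D[OF assms(1)] part_D[OF assms(2)]
  show "commutator M (c \<odot>\<^bsub>V\<^esub> X) Y = c \<odot>\<^bsub>V\<^esub> commutator M X Y"
    "commutator M X (c \<odot>\<^bsub>V\<^esub> Y) = c \<odot>\<^bsub>V\<^esub> commutator M X Y"
    using assms derivationsD(1-3)[OF d(1)] derivationsD(1-3)[OF d(2)]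
    by (auto intro!: Vect_eqI val_eqI commutator_Vect Vect_closed
        simp: commutator_apply Vect_closed part_smult hcomm_apply V_smult val_simps algebra_simps)
qed

lemma hcomm_antisym:
  assumes X: "X \<in> D p" and Y: "Y \<in> D q"
  shows "hcomm p q X Y = (- koszul p q) \<odot>\<^bsub>V\<^esub> hcomm q p Y X"
proof (rule Vect_eqI)
  note s = derivationsD(1)[OF X] derivationsD(1)[OF Y]
  show "hcomm p q X Y f = ((- koszul p q) \<odot>\<^bsub>V\<^esub> hcomm q p Y X) f" if "f \<in> carrier A" for f
    using that bit_eq[of p] bit_eq[of q]
    by (intro val_eqI) (auto simp: V_smult hcomm_apply s val_simps)
qed (intro Vect_closed D_Vect[OF hcomm_D] X Y)+

lemma hcomm_jacobi:
  assumes X: "X \<in> D p" and Y: "Y \<in> D q" and Z: "Z \<in> D r"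
  shows "hcomm p (q + r) X (hcomm q r Y Z) =
    hcomm (p + q) r (hcomm p q X Y) Z \<oplus>\<^bsub>V\<^esub> koszul p q \<odot>\<^bsub>V\<^esub> hcomm q (p + r) Y (hcomm p r X Z)"
proof (rule Vect_eqI)
  note s = derivationsD(1-3)[OF X] derivationsD(1-3)[OF Y] derivationsD(1-3)[OF Z]
    D_minus[OF X] D_minus[OF Y] D_minus[OF Z]
  show "hcomm p (q + r) X (hcomm q r Y Z) f =
    (hcomm (p + q) r (hcomm p q X Y) Z \<oplus>\<^bsub>V\<^esub> koszul p q \<odot>\<^bsub>V\<^esub> hcomm q (p + r) Y (hcomm p r X Z)) f"
    if "f \<in> carrier A" for f
    using that bit_eq[of p] bit_eq[of q] bit_eq[of r]
    by (intro val_eqI) (auto simp: V_smult V_add hcomm_apply s val_simps algebra_simps)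
qed (intro Vect_closed D_Vect[OF hcomm_D] hcomm_D X Y Z)+

end

section \<open>Finite dimension from finitely many separating functionals\<close>

context super_vector_space
begin

text \<open>Induction on the functionals, over all subspaces U: either the next one vanishes on U,
  or U is its kernel plus the line of a vector w on which it is 1. Spanning is phrased through the
  subspaces containing B, so that no span inside the varying subspace U is needed.\<close>

lemma spanning_set_of_separating_functionals:
  fixes l :: "'i \<Rightarrow> 'a \<Rightarrow> real"
  assumes "finite I"
    and lin: "\<And>i x y. i \<in> I \<Longrightarrow> x \<in> carrier V \<Longrightarrow> y \<in> carrier V \<Longrightarrow> l i (x \<oplus> y) = l i x + l i y"
      "\<And>i c x. i \<in> I \<Longrightarrow> x \<in> carrier V \<Longrightarrow> l i (c \<odot> x) = c * l i x"
    and U: "submodule real_ring U V" and sep: "\<And>x. x \<in> U \<Longrightarrow> (\<And>i. i \<in> I \<Longrightarrow> l i x = 0) \<Longrightarrow> x = \<zero>"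
  shows "\<exists>B. finite B \<and> B \<subseteq> U \<and> (\<forall>T. submodule real_ring T V \<longrightarrow> B \<subseteq> T \<longrightarrow> U \<subseteq> T)"
  using assms
proof (induction I arbitrary: U rule: finite_induct)
  case empty
  then have "U \<subseteq> {\<zero>}" by auto
  then show ?case using submodule.zero_closed by (intro exI[of _ "{}"]) blast
next
  case (insert i I)
  interpret U: submodule real_ring U V by fact
  show ?case
  proof (cases "\<forall>x \<in> U. l i x = 0")
    case True
    show ?thesis
    proof (rule insert.IH)
      show "x = \<zero>" if "x \<in> U" "\<And>j. j \<in> I \<Longrightarrow> l j x = 0" for x
        using that True by (intro insert.prems(4)) auto
    qed (use insert.prems in auto)
  next
    case False
    then obtain v where v: "v \<in> U" "l i v \<noteq> 0" by blast
    define w where "w = (1 / l i v) \<odot> v"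
    have w: "w \<in> U" "l i w = 1"
      using v U.smult_closed[of "1 / l i v" v] insert.prems(2) U.subset by (auto simp: w_def)
    have wV: "w \<in> carrier V" using w U.subset by blast
    let ?U = "{x \<in> U. l i x = 0}"
    have l0: "l i \<zero> = 0"
      using insert.prems(2)[of i \<zero> 0] smult_simps(3)[of \<zero>] by simp
    have sub: "submodule real_ring ?U V"
    proof (rule LinearCombinations.submodule.intro)
      show "module real_ring V" by (rule U.module)
      show "?U \<subseteq> carrier V" using U.subset by blast
      show "\<zero> \<in> ?U" using l0 by simp
      show "x \<oplus> y \<in> ?U" if "x \<in> ?U" "y \<in> ?U" for x y
        using that insert.prems(1)[of i x y] U.subset by auto
      show "c \<odot> x \<in> ?U" if "x \<in> ?U" for c x
        using that insert.prems(2)[of i x c] U.subset by auto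
    qed
    have "\<exists>B. finite B \<and> B \<subseteq> ?U \<and> (\<forall>T. submodule real_ring T V \<longrightarrow> B \<subseteq> T \<longrightarrow> ?U \<subseteq> T)"
    proof (rule insert.IH[OF _ _ sub])
      show "x = \<zero>" if "x \<in> ?U" "\<And>j. j \<in> I \<Longrightarrow> l j x = 0" for x
        using that by (intro insert.prems(4)) auto
    qed (use insert.prems in auto)
    then obtain B where B: "finite B" "B \<subseteq> ?U" "\<And>T. submodule real_ring T V \<Longrightarrow> B \<subseteq> T \<Longrightarrow> ?U \<subseteq> T"
      by blast
    have "U \<subseteq> T" if T: "submodule real_ring T V" "insert w B \<subseteq> T" for T
    proof
      interpret T: submodule real_ring T V by fact
      fix x assume x: "x \<in> U"
      then have xV: "x \<in> carrier V" using U.subset by blast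
      let ?y = "x \<oplus> (- l i x) \<odot> w"
      have "l i ?y = 0"
        using insert.prems(1)[of i x "(- l i x) \<odot> w"] insert.prems(2)[of i w "- l i x"] xV wV w(2)
        by (simp add: smult_simps)
      moreover have "?y \<in> U" using x w(1) by simp
      ultimately have y: "?y \<in> T" using B(3)[OF T(1)] T(2) by blast
      have yw: "?y \<oplus> l i x \<odot> w \<in> T" by (rule T.m_closed[OF y T.smult_closed]) (use T(2) in auto)
      have "?y \<oplus> l i x \<odot> w = x \<oplus> ((- l i x) \<odot> w \<oplus> l i x \<odot> w)"
        using xV wV by (simp add: a_assoc smult_simps(1))
      also have "\<dots> = x \<oplus> ((- l i x) + l i x) \<odot> w" using wV by (simp only: smult_simps(6))
      also have "\<dots> = x" using xV wV by (simp add: smult_simps(3))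
      finally show "x \<in> T" using yw by (simp only:)
    qed
    then show ?thesis using B w by (intro exI[of _ "insert w B"]) auto
  qed
qed

lemma fin_dim_of_separating_functionals:
  fixes l :: "'i \<Rightarrow> 'a \<Rightarrow> real"
  assumes "finite I"
    and "\<And>i x y. i \<in> I \<Longrightarrow> x \<in> carrier V \<Longrightarrow> y \<in> carrier V \<Longrightarrow> l i (x \<oplus> y) = l i x + l i y"
      "\<And>i c x. i \<in> I \<Longrightarrow> x \<in> carrier V \<Longrightarrow> l i (c \<odot> x) = c * l i x"
    and "\<And>x. x \<in> carrier V \<Longrightarrow> (\<And>i. i \<in> I \<Longrightarrow> l i x = 0) \<Longrightarrow> x = \<zero>"
  shows "fin_dim"
proof -
  have sub: "submodule real_ring (carrier V) V"
    by unfold_locales (auto simp: smult_simps)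
  have "\<exists>B. finite B \<and> B \<subseteq> carrier V \<and> (\<forall>T. submodule real_ring T V \<longrightarrow> B \<subseteq> T \<longrightarrow> carrier V \<subseteq> T)"
    by (rule spanning_set_of_separating_functionals[where l = l, OF assms(1-3) sub assms(4)])
  then obtain B where B: "finite B" "B \<subseteq> carrier V"
    "\<And>T. submodule real_ring T V \<Longrightarrow> B \<subseteq> T \<Longrightarrow> carrier V \<subseteq> T"
    by blast
  have "carrier V \<subseteq> span B"
    by (rule B(3)[OF span_is_submodule[OF B(2)] in_own_span[OF B(2)]])
  moreover have "span B \<subseteq> carrier V"
    using submodule.subset[OF span_is_submodule[OF B(2)]] .
  ultimately show ?thesis using B unfolding fin_dim_def by blast
qed

end

section \<open>The Lie derivative of the metric and the superalgebra structure\<close>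

context super_null_riemannian
begin

lemma g_grade: "X \<in> D p \<Longrightarrow> Y \<in> D q \<Longrightarrow> g X Y \<in> grade A (p + q)"
  and g_sym: "X \<in> D p \<Longrightarrow> Y \<in> D q \<Longrightarrow> g X Y = koszul p q \<odot>\<^bsub>A\<^esub> g Y X"
  and g_linear: "f \<in> carrier A \<Longrightarrow> X \<in> carrier V \<Longrightarrow> Y \<in> carrier V \<Longrightarrow> Z \<in> carrier V \<Longrightarrow>
    g (fun_scale M f X \<oplus>\<^bsub>V\<^esub> Y) Z = f \<otimes>\<^bsub>A\<^esub> g X Z \<oplus>\<^bsub>A\<^esub> g Y Z"
  and g_add_right: "X \<in> carrier V \<Longrightarrow> Y \<in> carrier V \<Longrightarrow> Z \<in> carrier V \<Longrightarrow>
    g X (Y \<oplus>\<^bsub>V\<^esub> Z) = g X Y \<oplus>\<^bsub>A\<^esub> g X Z"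
  using metric unfolding metric_def Vect_simps(1) by blast+

lemma fun_scale_one: "X \<in> carrier V \<Longrightarrow> fun_scale M \<one>\<^bsub>A\<^esub> X = X"
  using VectD(1,4) by (fastforce simp: fun_scale_def extensional_def)

lemma g_closed: "X \<in> carrier V \<Longrightarrow> Y \<in> carrier V \<Longrightarrow> g X Y \<in> carrier A"
proof -
  assume X: "X \<in> carrier V" and Y: "Y \<in> carrier V"
  have c: "g (part p X) Y \<in> carrier A" for p
  proof -
    have "g (part p X) Y = g (part p X) (part 0 Y) \<oplus>\<^bsub>A\<^esub> g (part p X) (part 1 Y)"
      using g_add_right[OF D_Vect D_Vect D_Vect] part_D[OF X] part_D[OF Y] part_sum[OF Y] by metis
    then show ?thesis
      using g_grade[OF part_D[OF X] part_D[OF Y]] A.grade_carrier by (metis A.a_closed)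
  qed
  have "X = fun_scale M \<one>\<^bsub>A\<^esub> (part 0 X) \<oplus>\<^bsub>V\<^esub> part 1 X"
    using fun_scale_one[OF D_Vect[OF part_D[OF X]]] part_sum[OF X] by simp
  then have "g X Y = \<one>\<^bsub>A\<^esub> \<otimes>\<^bsub>A\<^esub> g (part 0 X) Y \<oplus>\<^bsub>A\<^esub> g (part 1 X) Y"
    using g_linear[OF A.one_closed D_Vect D_Vect Y] part_D[OF X] by metis
  then show ?thesis using c by simp
qed

lemma g_add_left: "X \<in> carrier V \<Longrightarrow> Y \<in> carrier V \<Longrightarrow> Z \<in> carrier V \<Longrightarrow>
    g (X \<oplus>\<^bsub>V\<^esub> Y) Z = g X Z \<oplus>\<^bsub>A\<^esub> g Y Z"
  using g_linear[OF A.one_closed, of X Y Z] fun_scale_one[of X] g_closed[of X Z] by simp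

lemma V_zero_simps: "\<zero>\<^bsub>V\<^esub> \<oplus>\<^bsub>V\<^esub> \<zero>\<^bsub>V\<^esub> = \<zero>\<^bsub>V\<^esub>" "X \<in> carrier V \<Longrightarrow> X \<oplus>\<^bsub>V\<^esub> \<zero>\<^bsub>V\<^esub> = X"
  "X \<in> carrier V \<Longrightarrow> 0 \<odot>\<^bsub>V\<^esub> X = \<zero>\<^bsub>V\<^esub>" "c \<odot>\<^bsub>V\<^esub> \<zero>\<^bsub>V\<^esub> = \<zero>\<^bsub>V\<^esub>"
  by (intro Vect_eqI; auto simp: Vect_closed V_add V_zero V_smult VectD(1) A.smult_simps
      intro!: val_eqI simp: val_simps)+

lemma g_zero_left: "Z \<in> carrier V \<Longrightarrow> g \<zero>\<^bsub>V\<^esub> Z = \<zero>\<^bsub>A\<^esub>"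
proof -
  assume Z: "Z \<in> carrier V"
  have c: "g \<zero>\<^bsub>V\<^esub> Z \<in> carrier A" by (intro g_closed Vect_zero_closed Z)
  have "g \<zero>\<^bsub>V\<^esub> Z = g \<zero>\<^bsub>V\<^esub> Z \<oplus>\<^bsub>A\<^esub> g \<zero>\<^bsub>V\<^esub> Z"
    using g_add_left[OF Vect_zero_closed Vect_zero_closed Z] V_zero_simps(1) by simp
  then have e: "val (g \<zero>\<^bsub>V\<^esub> Z) m = val (g \<zero>\<^bsub>V\<^esub> Z \<oplus>\<^bsub>A\<^esub> g \<zero>\<^bsub>V\<^esub> Z) m"
    "val (Q (g \<zero>\<^bsub>V\<^esub> Z)) m = val (Q (g \<zero>\<^bsub>V\<^esub> Z \<oplus>\<^bsub>A\<^esub> g \<zero>\<^bsub>V\<^esub> Z)) m" for m by simp_all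
  show ?thesis
    using e c by (intro val_eqI) (simp_all add: val_simps)
qed

lemma g_fun_scale: "f \<in> carrier A \<Longrightarrow> X \<in> carrier V \<Longrightarrow> Z \<in> carrier V \<Longrightarrow>
    g (fun_scale M f X) Z = f \<otimes>\<^bsub>A\<^esub> g X Z"
proof -
  assume a: "f \<in> carrier A" "X \<in> carrier V" "Z \<in> carrier V"
  have "fun_scale M f X \<oplus>\<^bsub>V\<^esub> \<zero>\<^bsub>V\<^esub> = fun_scale M f X"
    unfolding Vect_simps fun_scale_def by (rule restrict_ext) (simp add: a VectD(1)[OF a(2)])
  then show ?thesis
    using g_linear[OF a(1,2) Vect_zero_closed a(3)] g_zero_left[OF a(3)] g_closed[OF a(2,3)] a by simp
qed

lemma g_smult_left: "X \<in> carrier V \<Longrightarrow> Z \<in> carrier V \<Longrightarrow> g (c \<odot>\<^bsub>V\<^esub> X) Z = c \<odot>\<^bsub>A\<^esub> g X Z"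
proof -
  assume a: "X \<in> carrier V" "Z \<in> carrier V"
  have "c \<odot>\<^bsub>V\<^esub> X = fun_scale M (c \<odot>\<^bsub>A\<^esub> \<one>\<^bsub>A\<^esub>) X"
    unfolding Vect_simps fun_scale_def
    by (rule restrict_ext) (simp add: A.smult_mult_left VectD(1)[OF a(1)])
  then show ?thesis
    using g_fun_scale[of "c \<odot>\<^bsub>A\<^esub> \<one>\<^bsub>A\<^esub>" X Z] a g_closed[OF a]
    by (simp add: A.smult_simps(1) A.smult_mult_left)
qed

text \<open>The definition of a metric gives only additivity in the second argument; homogeneity
  comes from the first argument by graded symmetry, on homogeneous parts.\<close>

lemma g_smult_right: "X \<in> carrier V \<Longrightarrow> Y \<in> carrier V \<Longrightarrow> g X (c \<odot>\<^bsub>V\<^esub> Y) = c \<odot>\<^bsub>A\<^esub> g X Y"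
proof -
  have hom: "g X (c \<odot>\<^bsub>V\<^esub> Y) = c \<odot>\<^bsub>A\<^esub> g X Y" if X: "X \<in> D p" and Y: "Y \<in> D q" for X Y p q
    using g_sym[OF X D_smult[OF Y, of c]] g_smult_left[OF D_Vect[OF Y] D_Vect[OF X], of c]
      g_sym[OF X Y] g_closed[OF D_Vect[OF Y] D_Vect[OF X]]
    by (simp add: A.smult_simps mult.commute)
  assume X: "X \<in> carrier V" and Y: "Y \<in> carrier V"
  note d = D_Vect[OF part_D[OF X]] D_Vect[OF part_D[OF Y]]
  have "g X (c \<odot>\<^bsub>V\<^esub> Y) = g (part 0 X \<oplus>\<^bsub>V\<^esub> part 1 X) (part 0 (c \<odot>\<^bsub>V\<^esub> Y) \<oplus>\<^bsub>V\<^esub> part 1 (c \<odot>\<^bsub>V\<^esub> Y))"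
    using part_sum[OF X] part_sum[OF Vect_smult_closed[OF Y]] by simp
  also have "\<dots> = c \<odot>\<^bsub>A\<^esub> g (part 0 X \<oplus>\<^bsub>V\<^esub> part 1 X) (part 0 Y \<oplus>\<^bsub>V\<^esub> part 1 Y)"
    using X Y d hom[OF part_D[OF X] part_D[OF Y]]
    by (simp add: part_smult g_add_left g_add_right Vect_closed g_closed A.smult_simps)
  finally show ?thesis using part_sum[OF X] part_sum[OF Y] by simp
qed

lemma g_zero_right: "X \<in> carrier V \<Longrightarrow> g X \<zero>\<^bsub>V\<^esub> = \<zero>\<^bsub>A\<^esub>"
  using g_smult_right[of X "\<zero>\<^bsub>V\<^esub>" 0] V_zero_simps(4)[of 0] g_closed[of X "\<zero>\<^bsub>V\<^esub>"] Vect_zero_closed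
  by (simp add: A.smult_simps)

lemma commutator_zero:
  "X \<in> carrier V \<Longrightarrow> commutator M X \<zero>\<^bsub>V\<^esub> = \<zero>\<^bsub>V\<^esub>" "X \<in> carrier V \<Longrightarrow> commutator M \<zero>\<^bsub>V\<^esub> X = \<zero>\<^bsub>V\<^esub>"
  using commutator_smult[OF _ Vect_zero_closed, of X 0] commutator_smult[OF Vect_zero_closed, of X 0]
    commutator_Vect[OF _ Vect_zero_closed, of X] commutator_Vect[OF Vect_zero_closed, of X]
  by (simp_all add: V_zero_simps)

lemma commutator_D: "X \<in> D p \<Longrightarrow> Y \<in> D q \<Longrightarrow> commutator M X Y \<in> D (p + q)"
  using commutator_homogeneous hcomm_D by simp

lemma D_apply_zero: "X \<in> D p \<Longrightarrow> X \<zero>\<^bsub>A\<^esub> = \<zero>\<^bsub>A\<^esub>"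
  using derivationsD(3)[of X A p "\<zero>\<^bsub>A\<^esub>" 0] derivationsD(1)[of X A p "\<zero>\<^bsub>A\<^esub>"]
  by (simp add: A.smult_simps)

definition hlie :: "bit \<Rightarrow> bit \<Rightarrow> ('f \<Rightarrow> 'f) \<Rightarrow> ('f \<Rightarrow> 'f) \<Rightarrow> ('f \<Rightarrow> 'f) \<Rightarrow> 'f" where
  "hlie p q X Y Z = X (g Y Z) \<ominus>\<^bsub>A\<^esub> g (commutator M X Y) Z \<ominus>\<^bsub>A\<^esub> koszul p q \<odot>\<^bsub>A\<^esub> g Y (commutator M X Z)"

lemma A_smult_zero: "c \<odot>\<^bsub>A\<^esub> \<zero>\<^bsub>A\<^esub> = \<zero>\<^bsub>A\<^esub>"
  by (rule val_eqI) (simp_all add: val_simps)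

lemma hlie_closed: "X \<in> D p \<Longrightarrow> Y \<in> carrier V \<Longrightarrow> Z \<in> carrier V \<Longrightarrow> hlie p q X Y Z \<in> carrier A"
  unfolding hlie_def
  by (simp add: derivationsD(1) g_closed commutator_Vect D_Vect A.smult_simps(1))

lemma lie_metric_eq:
  assumes "X \<in> carrier V" "Y \<in> carrier V" "Z \<in> carrier V"
  shows "lie_metric M g X Y Z =
    (hlie 0 0 (part 0 X) (part 0 Y) Z \<oplus>\<^bsub>A\<^esub> hlie 0 1 (part 0 X) (part 1 Y) Z) \<oplus>\<^bsub>A\<^esub>
    (hlie 1 0 (part 1 X) (part 0 Y) Z \<oplus>\<^bsub>A\<^esub> hlie 1 1 (part 1 X) (part 1 Y) Z)"
proof -
  have c: "hlie p q (part p X) (part q Y) Z \<in> carrier A" for p q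
    by (intro hlie_closed part_D D_Vect[OF part_D] assms)
  have "lie_metric M g X Y Z = (\<Oplus>\<^bsub>A\<^esub>p\<in>UNIV. \<Oplus>\<^bsub>A\<^esub>q\<in>UNIV. hlie p q (part p X) (part q Y) Z)"
    by (simp add: lie_metric_def hlie_def part_def Let_def)
  also have "\<dots> = (hlie 0 0 (part 0 X) (part 0 Y) Z \<oplus>\<^bsub>A\<^esub> hlie 0 1 (part 0 X) (part 1 Y) Z) \<oplus>\<^bsub>A\<^esub>
    (hlie 1 0 (part 1 X) (part 0 Y) Z \<oplus>\<^bsub>A\<^esub> hlie 1 1 (part 1 X) (part 1 Y) Z)"
    using c by (simp add: A.finsum_bit del: A.finsum_addf)
  finally show ?thesis .
qed

lemma hlie_zero: "X \<in> D p \<Longrightarrow> Z \<in> carrier V \<Longrightarrow> hlie p q X \<zero>\<^bsub>V\<^esub> Z = \<zero>\<^bsub>A\<^esub>"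
  unfolding hlie_def
  by (simp add: g_zero_left g_zero_right commutator_zero D_Vect D_apply_zero commutator_Vect
      A.minus_smult A.smult_simps)

lemma hlie_add_right:
  assumes X: "X \<in> D p" and Y: "Y \<in> carrier V" and Z: "Z \<in> carrier V" "Z' \<in> carrier V"
  shows "hlie p q X Y (Z \<oplus>\<^bsub>V\<^esub> Z') = hlie p q X Y Z \<oplus>\<^bsub>A\<^esub> hlie p q X Y Z'"
  unfolding hlie_def using D_Vect[OF X] Y Z
  by (intro val_eqI)
    (simp_all add: g_add_right commutator_add commutator_Vect g_closed derivationsD(1,2)[OF X]
      Vect_closed val_simps algebra_simps)

lemma hlie_grade:
  assumes X: "X \<in> D p" and Y: "Y \<in> D q" and Z: "Z \<in> D r"
  shows "hlie p q X Y Z \<in> grade A (p + (q + r))"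
proof -
  have "X (g Y Z) \<in> grade A (p + (q + r))" "g (commutator M X Y) Z \<in> grade A (p + (q + r))"
    "g Y (commutator M X Z) \<in> grade A (p + (q + r))"
    using derivationsD(4)[OF X g_grade[OF Y Z]] g_grade[OF commutator_D[OF X Y] Z]
      g_grade[OF Y commutator_D[OF X Z]] by (simp_all only: add_ac)
  then show ?thesis
    unfolding hlie_def using A.grade_carrier
    by (simp add: A.minus_smult A.smult_simps(1) A.grade_add A.grade_smult)
qed

text \<open>The homogeneous elements of the super-null algebra, see
  \<open>snull_homogeneous\<close>, in a form that avoids parity projections and sums over
  parities.\<close>

definition null_field :: "bit \<Rightarrow> ('f \<Rightarrow> 'f) \<Rightarrow> bool" where
  "null_field p X \<longleftrightarrow> X \<in> D p \<and> commutator M X Q = \<zero>\<^bsub>V\<^esub> \<and>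
    (\<forall>q. \<forall>Y \<in> D q. \<forall>Z \<in> carrier V. hlie p q X Y Z = \<zero>\<^bsub>A\<^esub>)"

abbreviation N where "N \<equiv> snull M g Q P"

lemma snull_simps: "grade N p = D p \<inter> carrier N" "zero N = \<zero>\<^bsub>V\<^esub>" "add N = add V"
  "smult N = smult V" "bracket N = commutator M"
  by (simp_all add: snull_def Let_def Vect_simps(1))

lemma snull_carrier: "carrier N = {X \<in> carrier V.
    (\<forall>Y \<in> carrier V. \<forall>Z \<in> carrier V. lie_metric M g X Y Z = \<zero>\<^bsub>A\<^esub>) \<and> commutator M X Q = \<zero>\<^bsub>V\<^esub>}"
  by (simp add: snull_def Let_def)

lemma Q_D: "Q \<in> D 1" and Q_Vect: "Q \<in> carrier V"
  using Q_der D_Vect by auto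

text \<open>For homogeneous arguments the even and the odd part of X contribute functions of
  opposite parity to the Lie derivative, and fields of opposite parity to [X, Q]; a vanishing sum
  therefore vanishes termwise.\<close>

lemma snull_iff: "X \<in> carrier N \<longleftrightarrow> X \<in> carrier V \<and> (\<forall>p. null_field p (part p X))"
proof
  assume "X \<in> carrier N"
  then have X: "X \<in> carrier V" and lie: "\<And>Y Z. Y \<in> carrier V \<Longrightarrow> Z \<in> carrier V \<Longrightarrow> lie_metric M g X Y Z = \<zero>\<^bsub>A\<^esub>"
    and com: "commutator M X Q = \<zero>\<^bsub>V\<^esub>"
    by (auto simp: snull_carrier)
  note d = part_D[OF X]
  have h0: "hlie p q (part p X) Y Z = \<zero>\<^bsub>A\<^esub>" if Y: "Y \<in> D q" and Z: "Z \<in> D r" for p q r Y Z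
  proof -
    note c = hlie_closed[OF d D_Vect[OF Y] D_Vect[OF Z]]
    have "hlie 0 q (part 0 X) Y Z \<oplus>\<^bsub>A\<^esub> hlie 1 q (part 1 X) Y Z = lie_metric M g X Y Z"
      unfolding lie_metric_eq[OF X D_Vect[OF Y] D_Vect[OF Z]] using bit_eq[of q] c
      by (auto simp: part_homogeneous[OF Y] hlie_zero[OF d D_Vect[OF Z]])
    also have "\<dots> = \<zero>\<^bsub>A\<^esub> \<oplus>\<^bsub>A\<^esub> \<zero>\<^bsub>A\<^esub>" using lie[OF D_Vect[OF Y] D_Vect[OF Z]] by simp
    finally have e: "hlie 0 q (part 0 X) Y Z \<oplus>\<^bsub>A\<^esub> hlie 1 q (part 1 X) Y Z = \<zero>\<^bsub>A\<^esub> \<oplus>\<^bsub>A\<^esub> \<zero>\<^bsub>A\<^esub>" .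
    have gr: "hlie 0 q (part 0 X) Y Z \<in> grade A (q + r)" "hlie 1 q (part 1 X) Y Z \<in> grade A (q + r + 1)"
      using hlie_grade[OF d Y Z, of 0] hlie_grade[OF d Y Z, of 1] by (simp_all only: add_ac add_0)
    show ?thesis
      using homogeneous_parts_unique[OF gr A.grade_zero A.grade_zero e] bit_eq[of p] by auto
  qed
  have "hlie p q (part p X) Y Z = \<zero>\<^bsub>A\<^esub>" if Y: "Y \<in> D q" and Z: "Z \<in> carrier V" for p q Y Z
    using hlie_add_right[OF d D_Vect[OF Y] D_Vect[OF part_D[OF Z]] D_Vect[OF part_D[OF Z]], of p q 0 1]
      part_sum[OF Z] h0[OF Y part_D[OF Z]] by simp
  moreover have "commutator M (part p X) Q = \<zero>\<^bsub>V\<^esub>" for p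
  proof -
    have "commutator M (part 1 X) Q \<oplus>\<^bsub>V\<^esub> commutator M (part 0 X) Q = commutator M X Q"
      using commutator_add(1)[OF D_Vect[OF d] D_Vect[OF d] Q_Vect, of 0 1] part_sum[OF X]
        Vect_add_comm[OF commutator_Vect commutator_Vect] D_Vect[OF d] Q_Vect by metis
    then have e: "commutator M (part 1 X) Q \<oplus>\<^bsub>V\<^esub> commutator M (part 0 X) Q = \<zero>\<^bsub>V\<^esub> \<oplus>\<^bsub>V\<^esub> \<zero>\<^bsub>V\<^esub>"
      using com V_zero_simps(1) by simp
    have gr: "commutator M (part 1 X) Q \<in> D 0" "commutator M (part 0 X) Q \<in> D (0 + 1)"
      using commutator_D[OF d Q_D, of 1] commutator_D[OF d Q_D, of 0] by simp_all
    show ?thesis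
      using D_parts_unique[OF gr D_zero D_zero e] bit_eq[of p] by auto
  qed
  ultimately show "X \<in> carrier V \<and> (\<forall>p. null_field p (part p X))"
    using X d by (simp add: null_field_def)
next
  assume "X \<in> carrier V \<and> (\<forall>p. null_field p (part p X))"
  then have X: "X \<in> carrier V" and nf: "\<And>p. null_field p (part p X)" by auto
  have "lie_metric M g X Y Z = \<zero>\<^bsub>A\<^esub>" if "Y \<in> carrier V" "Z \<in> carrier V" for Y Z
    using nf that part_D[OF that(1)] by (simp add: lie_metric_eq[OF X] null_field_def)
  moreover have "commutator M X Q = \<zero>\<^bsub>V\<^esub>"
    using commutator_add(1)[OF D_Vect[OF part_D[OF X]] D_Vect[OF part_D[OF X]] Q_Vect, of 0 1]
      nf part_sum[OF X] by (simp add: null_field_def V_zero_simps)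
  ultimately show "X \<in> carrier N" using X by (simp add: snull_carrier)
qed

lemma null_field_zero: "null_field p \<zero>\<^bsub>V\<^esub>"
  unfolding null_field_def hlie_def
  by (auto simp: D_zero commutator_zero Q_Vect g_zero_left g_zero_right D_Vect g_closed V_zero
      A.smult_simps A.minus_smult)

lemma null_field_add:
  assumes X: "null_field p X" and Y: "null_field p Y"
  shows "null_field p (X \<oplus>\<^bsub>V\<^esub> Y)"
proof -
  have d: "X \<in> D p" "Y \<in> D p" using X Y by (auto simp: null_field_def)
  note v = D_Vect[OF d(1)] D_Vect[OF d(2)]
  have "hlie p q (X \<oplus>\<^bsub>V\<^esub> Y) Z W = hlie p q X Z W \<oplus>\<^bsub>A\<^esub> hlie p q Y Z W"
    if "Z \<in> D q" "W \<in> carrier V" for q Z W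
    unfolding hlie_def using v that(2) D_Vect[OF that(1)]
    by (intro val_eqI)
      (simp_all add: g_add_left g_add_right V_add commutator_add commutator_Vect g_closed
        VectD(1) Vect_closed val_simps algebra_simps)
  then show ?thesis
    using X Y D_add[OF d] commutator_add(1)[OF v Q_Vect]
    by (auto simp: null_field_def V_zero_simps)
qed

lemma null_field_smult:
  assumes X: "null_field p X"
  shows "null_field p (c \<odot>\<^bsub>V\<^esub> X)"
proof -
  have d: "X \<in> D p" using X by (auto simp: null_field_def)
  note v = D_Vect[OF d]
  have "hlie p q (c \<odot>\<^bsub>V\<^esub> X) Z W = c \<odot>\<^bsub>A\<^esub> hlie p q X Z W" if "Z \<in> D q" "W \<in> carrier V" for q Z W
    unfolding hlie_def using v that(2) D_Vect[OF that(1)]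
    by (intro val_eqI)
      (simp_all add: g_smult_left g_smult_right V_smult commutator_smult commutator_Vect g_closed
        VectD(1) Vect_closed val_simps algebra_simps)
  then show ?thesis
    using X D_smult[OF d] commutator_smult(1)[OF v Q_Vect]
    by (simp add: null_field_def V_zero_simps A_smult_zero)
qed

lemma commutator_jacobi:
  assumes X: "X \<in> D p" and Y: "Y \<in> D q" and Z: "Z \<in> carrier V"
  shows "commutator M X (commutator M Y Z) =
    commutator M (commutator M X Y) Z \<oplus>\<^bsub>V\<^esub> koszul p q \<odot>\<^bsub>V\<^esub> commutator M Y (commutator M X Z)"
proof -
  note v = D_Vect[OF X] D_Vect[OF Y]
  have hom: "commutator M X (commutator M Y Z) =
    commutator M (commutator M X Y) Z \<oplus>\<^bsub>V\<^esub> koszul p q \<odot>\<^bsub>V\<^esub> commutator M Y (commutator M X Z)"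
    if Z: "Z \<in> D r" for Z r
    using hcomm_jacobi[OF X Y Z] commutator_homogeneous[OF Y Z] commutator_homogeneous[OF X hcomm_D[OF Y Z]]
      commutator_homogeneous[OF X Y] commutator_homogeneous[OF hcomm_D[OF X Y] Z]
      commutator_homogeneous[OF X Z] commutator_homogeneous[OF Y hcomm_D[OF X Z]] by simp
  note z = D_Vect[OF part_D[OF Z]]
  have "commutator M X (commutator M Y (part 0 Z \<oplus>\<^bsub>V\<^esub> part 1 Z)) =
    commutator M (commutator M X Y) (part 0 Z \<oplus>\<^bsub>V\<^esub> part 1 Z) \<oplus>\<^bsub>V\<^esub>
      koszul p q \<odot>\<^bsub>V\<^esub> commutator M Y (commutator M X (part 0 Z \<oplus>\<^bsub>V\<^esub> part 1 Z))"
    using v z hom[OF part_D[OF Z]]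
    by (intro Vect_eqI val_eqI)
      (simp_all add: commutator_add commutator_Vect Vect_closed V_add V_smult VectD(1) val_simps algebra_simps)
  then show ?thesis using part_sum[OF Z] by simp
qed

lemma null_field_eq: "null_field p X \<Longrightarrow> Y \<in> D q \<Longrightarrow> Z \<in> carrier V \<Longrightarrow>
    X (g Y Z) = g (commutator M X Y) Z \<oplus>\<^bsub>A\<^esub> koszul p q \<odot>\<^bsub>A\<^esub> g Y (commutator M X Z)"
proof -
  assume X: "null_field p X" and Y: "Y \<in> D q" and Z: "Z \<in> carrier V"
  have d: "X \<in> D p" and h: "hlie p q X Y Z = \<zero>\<^bsub>A\<^esub>" using X Y Z by (auto simp: null_field_def)
  note c = g_closed commutator_Vect D_Vect[OF d] D_Vect[OF Y] Z derivationsD(1)[OF d]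
  have "val (hlie p q X Y Z) m = 0" "val (Q (hlie p q X Y Z)) m = 0" for m
    using h by (simp_all add: val_simps)
  then show ?thesis
    by (intro val_eqI) (simp_all add: hlie_def c val_simps algebra_simps)
qed

text \<open>The Lie derivative along [X, Y] is the graded commutator of the two Lie derivatives.
  When X(Y g) and Y(X g) are expanded the mixed terms cancel, and the others combine by the Jacobi
  identity.\<close>

lemma null_field_commutator:
  assumes X: "null_field p X" and Y: "null_field q Y"
  shows "null_field (p + q) (commutator M X Y)"
proof -
  have d: "X \<in> D p" "Y \<in> D q" using X Y by (auto simp: null_field_def)
  note v = D_Vect[OF d(1)] D_Vect[OF d(2)]
  have W: "commutator M X Y \<in> D (p + q)" by (rule commutator_D[OF d])
  have jac: "commutator M (commutator M X Y) Z = commutator M X (commutator M Y Z) \<oplus>\<^bsub>V\<^esub>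
      (- koszul p q) \<odot>\<^bsub>V\<^esub> commutator M Y (commutator M X Z)" if "Z \<in> carrier V" for Z
    using commutator_jacobi[OF d that] v that
    by (intro Vect_eqI val_eqI)
      (simp_all add: commutator_Vect Vect_closed V_add V_smult VectD(1) val_simps)
  have "commutator M (commutator M X Y) Q = \<zero>\<^bsub>V\<^esub>"
    using jac[OF Q_Vect] X Y v by (simp add: null_field_def commutator_zero V_zero_simps)
  moreover have "hlie (p + q) r (commutator M X Y) U Z = \<zero>\<^bsub>A\<^esub>" if U: "U \<in> D r" and Z: "Z \<in> carrier V" for r U Z
  proof -
    note u = D_Vect[OF U]
    note s = derivationsD(1-3)[OF d(1)] derivationsD(1-3)[OF d(2)]
    note XU = commutator_D[OF d(1) U] and YU = commutator_D[OF d(2) U]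
    note XZ = commutator_Vect[OF v(1) Z] and YZ = commutator_Vect[OF v(2) Z]
    note c = g_closed commutator_Vect v u Z Vect_closed
    have XY: "X (Y (g U Z)) =
        (g (commutator M X (commutator M Y U)) Z \<oplus>\<^bsub>A\<^esub> koszul p (q + r) \<odot>\<^bsub>A\<^esub> g (commutator M Y U) (commutator M X Z)) \<oplus>\<^bsub>A\<^esub>
        koszul q r \<odot>\<^bsub>A\<^esub> (g (commutator M X U) (commutator M Y Z) \<oplus>\<^bsub>A\<^esub> koszul p r \<odot>\<^bsub>A\<^esub> g U (commutator M X (commutator M Y Z)))"
      using c by (simp add: null_field_eq[OF Y U Z] s A.smult_simps(1) null_field_eq[OF X YU Z] null_field_eq[OF X U YZ])
    have YX: "Y (X (g U Z)) =
        (g (commutator M Y (commutator M X U)) Z \<oplus>\<^bsub>A\<^esub> koszul q (p + r) \<odot>\<^bsub>A\<^esub> g (commutator M X U) (commutator M Y Z)) \<oplus>\<^bsub>A\<^esub>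
        koszul p r \<odot>\<^bsub>A\<^esub> (g (commutator M Y U) (commutator M X Z) \<oplus>\<^bsub>A\<^esub> koszul q r \<odot>\<^bsub>A\<^esub> g U (commutator M Y (commutator M X Z)))"
      using c by (simp add: null_field_eq[OF X U Z] s A.smult_simps(1) null_field_eq[OF Y XU Z] null_field_eq[OF Y U XZ])
    have app: "commutator M X Y (g U Z) = X (Y (g U Z)) \<ominus>\<^bsub>A\<^esub> koszul p q \<odot>\<^bsub>A\<^esub> Y (X (g U Z))"
      using c by (simp add: commutator_homogeneous[OF d] hcomm_apply)
    have k: "koszul p (q + r) = koszul p q * koszul p r" "koszul q (p + r) = koszul p q * koszul q r"
      "koszul (p + q) r = koszul p r * koszul q r"
      using koszul_laws(1)[of p q r] koszul_laws(2)[of p q r] koszul_laws(2)[of q p r] koszul_laws(3)[of q p]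
      by simp_all
    \<comment> \<open>After \<open>k\<close> the sign of p and q occurs repeatedly in products;
      substituting its two possible values makes the mixed terms cancel literally.\<close>
    have "koszul p q = 1 \<or> koszul p q = - 1" by (simp add: koszul_def)
    then show ?thesis
    proof
      assume pq: "koszul p q = 1"
      show ?thesis
        unfolding hlie_def app XY YX jac[OF u] jac[OF Z] k pq using c
        by (intro val_eqI)
          (simp_all add: g_add_left g_add_right g_smult_left g_smult_right val_simps algebra_simps)
    next
      assume pq: "koszul p q = - 1"
      show ?thesis
        unfolding hlie_def app XY YX jac[OF u] jac[OF Z] k pq using c
        by (intro val_eqI)
          (simp_all add: g_add_left g_add_right g_smult_left g_smult_right val_simps algebra_simps)
    qed
  qed
  ultimately show ?thesis using W by (simp add: null_field_def)
qed

lemma snull_homogeneous: "X \<in> grade N p \<longleftrightarrow> null_field p X"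
proof
  assume "X \<in> grade N p"
  then have d: "X \<in> D p" and "X \<in> carrier N" by (auto simp: snull_simps)
  then have "null_field p (part p X)" using snull_iff by blast
  then show "null_field p X" using part_homogeneous[OF d] by simp
next
  assume X: "null_field p X"
  then have d: "X \<in> D p" by (simp add: null_field_def)
  then have "X \<in> carrier N"
    using X null_field_zero by (auto simp: snull_iff D_Vect part_homogeneous[OF d])
  with d show "X \<in> grade N p" by (simp add: snull_simps)
qed

lemma snull_grade_carrier: "X \<in> grade N p \<Longrightarrow> X \<in> carrier N"
  by (simp add: snull_simps(1))

lemma snull_Vect: "X \<in> carrier N \<Longrightarrow> X \<in> carrier V"
  by (simp add: snull_carrier)

lemma snull_closed:
  "X \<in> carrier N \<Longrightarrow> Y \<in> carrier N \<Longrightarrow> X \<oplus>\<^bsub>V\<^esub> Y \<in> carrier N"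
  "X \<in> carrier N \<Longrightarrow> c \<odot>\<^bsub>V\<^esub> X \<in> carrier N" "\<zero>\<^bsub>V\<^esub> \<in> carrier N"
  by (auto simp: snull_iff Vect_closed part_add part_smult null_field_add null_field_smult
      null_field_zero part_homogeneous[OF D_zero[of 0]])

lemma snull_vectorspace: "vectorspace real_ring N"
  by (rule vectorspace_subset[OF refl _ snull_closed(3,1,2)]) (auto simp: snull_Vect snull_simps)

lemma snull_super_vector_space: "super_vector_space N"
proof -
  interpret vectorspace real_ring N by (rule snull_vectorspace)
  show ?thesis
  proof (intro super_vector_space.intro super_vector_space_axioms.intro snull_vectorspace)
    fix p
    show "VectorSpace.subspace real_ring (grade N p) N"
    proof (intro VectorSpace.subspace.intro LinearCombinations.submodule.intro)
      show "vectorspace real_ring N" "module real_ring N" by unfold_locales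
      show "grade N p \<subseteq> carrier N" by (auto simp: snull_simps)
      show "\<zero>\<^bsub>N\<^esub> \<in> grade N p" using null_field_zero by (simp add: snull_homogeneous snull_simps(2))
      show "X \<oplus>\<^bsub>N\<^esub> Y \<in> grade N p" if "X \<in> grade N p" "Y \<in> grade N p" for X Y
        using that null_field_add by (simp add: snull_homogeneous snull_simps(3))
      show "c \<odot>\<^bsub>N\<^esub> X \<in> grade N p" if "X \<in> grade N p" for c X
        using that null_field_smult by (simp add: snull_homogeneous snull_simps(4))
    qed
    fix X assume "X \<in> carrier N"
    then have X: "X \<in> carrier V" "\<And>p. null_field p (part p X)" by (auto simp: snull_iff)
    show "\<exists>!(u, w). u \<in> grade N 0 \<and> w \<in> grade N 1 \<and> X = u \<oplus>\<^bsub>N\<^esub> w"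
    proof (rule ex1I[of _ "(part 0 X, part 1 X)"])
      show "case (part 0 X, part 1 X) of (u, w) \<Rightarrow> u \<in> grade N 0 \<and> w \<in> grade N 1 \<and> X = u \<oplus>\<^bsub>N\<^esub> w"
        using X part_sum[OF X(1)] by (simp add: snull_homogeneous snull_simps(3))
      fix z assume z: "case z of (u, w) \<Rightarrow> u \<in> grade N 0 \<and> w \<in> grade N 1 \<and> X = u \<oplus>\<^bsub>N\<^esub> w"
      obtain u w where uw: "z = (u, w)" by force
      then have "u \<in> D 0" "w \<in> D 1" "X = u \<oplus>\<^bsub>V\<^esub> w"
        using z by (auto simp: snull_homogeneous snull_simps(3) null_field_def)
      then show "z = (part 0 X, part 1 X)" using part_eqI[of u w X] uw by simp
    qed
  qed
qed

theorem snull_lie_superalgebra: "lie_superalgebra N"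
proof -
  interpret super_vector_space N by (rule snull_super_vector_space)
  note v = snull_Vect
  have d: "X \<in> D p" "X \<in> carrier V" if "X \<in> grade N p" for X p
    using that D_Vect by (auto simp: snull_simps(1))
  show ?thesis
  proof
    show "bracket N X Y \<in> grade N (p + q)" if "X \<in> grade N p" "Y \<in> grade N q" for X Y p q
      using that null_field_commutator by (simp add: snull_homogeneous snull_simps(5))
    show "bracket N X Y \<in> carrier N" if X: "X \<in> carrier N" and Y: "Y \<in> carrier N" for X Y
    proof -
      have c: "commutator M (part p X) (part q Y) \<in> carrier N" for p q
        using null_field_commutator[of p "part p X" q "part q Y"] X Y
          snull_grade_carrier[of "commutator M (part p X) (part q Y)" "p + q"]
        unfolding snull_homogeneous snull_iff by blast
      have "commutator M X Y = commutator M (part 0 X \<oplus>\<^bsub>V\<^esub> part 1 X) (part 0 Y \<oplus>\<^bsub>V\<^esub> part 1 Y)"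
        using part_sum X Y v by metis
      also have "\<dots> = (commutator M (part 0 X) (part 0 Y) \<oplus>\<^bsub>V\<^esub> commutator M (part 1 X) (part 0 Y)) \<oplus>\<^bsub>V\<^esub>
          (commutator M (part 0 X) (part 1 Y) \<oplus>\<^bsub>V\<^esub> commutator M (part 1 X) (part 1 Y))"
        using D_Vect[OF part_D[OF v[OF X]]] D_Vect[OF part_D[OF v[OF Y]]]
        by (simp add: commutator_add Vect_closed)
      finally show ?thesis using c by (simp add: snull_simps snull_closed)
    qed
    show "bracket N X Y = \<ominus>\<^bsub>N\<^esub> (koszul p q \<odot>\<^bsub>N\<^esub> bracket N Y X)" if "X \<in> grade N p" "Y \<in> grade N q" for X Y p q
    proof -
      have "bracket N Y X \<in> carrier N"
        using null_field_commutator[of q Y p X] that snull_grade_carrier[of "commutator M Y X" "q + p"]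
        unfolding snull_homogeneous snull_simps(5) by blast
      then have "\<ominus>\<^bsub>N\<^esub> (koszul p q \<odot>\<^bsub>N\<^esub> bracket N Y X) = (- koszul p q) \<odot>\<^bsub>N\<^esub> bracket N Y X"
        by (simp add: a_inv_smult smult_simps)
      then show ?thesis
        using hcomm_antisym[OF d(1)[OF that(1)] d(1)[OF that(2)]]
          commutator_homogeneous[OF d(1)[OF that(1)] d(1)[OF that(2)]]
          commutator_homogeneous[OF d(1)[OF that(2)] d(1)[OF that(1)]]
        by (simp add: snull_simps)
    qed
    show "bracket N X (bracket N Y Z) =
        bracket N (bracket N X Y) Z \<oplus>\<^bsub>N\<^esub> koszul p q \<odot>\<^bsub>N\<^esub> bracket N Y (bracket N X Z)"
      if "X \<in> grade N p" "Y \<in> grade N q" "Z \<in> grade N r" for X Y Z p q r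
      using commutator_jacobi[OF d(1)[OF that(1)] d(1)[OF that(2)] d(2)[OF that(3)]]
      by (simp add: snull_simps)
  qed (use v commutator_add commutator_smult in \<open>simp_all add: snull_simps\<close>)
qed

end

section \<open>Reduction to the underlying manifold\<close>

context super_null_riemannian
begin

definition \<tau> :: 'f where
  "\<tau> = (SOME t. t \<in> grade A 1 \<and> (\<forall>m \<in> pts. val (Q t) m = 1))"

lemma \<tau>_odd: "\<tau> \<in> grade A 1" and val_Q_\<tau>_pts: "m \<in> pts \<Longrightarrow> val (Q \<tau>) m = 1"
proof -
  have "\<exists>t. t \<in> grade A 1 \<and> (\<forall>m \<in> pts. val (Q t) m = 1)"
    using odd_unit_exists by blast
  then have "\<tau> \<in> grade A 1 \<and> (\<forall>m \<in> pts. val (Q \<tau>) m = 1)"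
    unfolding \<tau>_def by (rule someI_ex)
  then show "\<tau> \<in> grade A 1" "m \<in> pts \<Longrightarrow> val (Q \<tau>) m = 1" by auto
qed

lemma \<tau>_carrier: "\<tau> \<in> carrier A"
  using \<tau>_odd A.grade_carrier by blast

lemma val_\<tau>: "val \<tau> m = 0"
  by (rule val_odd[OF \<tau>_odd])

lemma val_Q_\<tau>: "val (Q \<tau>) m = (if m \<in> pts then 1 else 0)"
  using val_Q_\<tau>_pts val_outside by auto

definition even_fun :: "('p \<Rightarrow> real) \<Rightarrow> 'f" where
  "even_fun a = inv_into (grade A 0) val a"

lemma even_fun: "a \<in> C \<Longrightarrow> even_fun a \<in> grade A 0" "a \<in> C \<Longrightarrow> val (even_fun a) = a"
  by (simp_all add: C_def even_fun_def inv_into_into f_inv_into_f)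

lemma even_fun_carrier: "a \<in> C \<Longrightarrow> even_fun a \<in> carrier A"
  using even_fun A.grade_carrier by blast

lemma even_fun_Q: "a \<in> C \<Longrightarrow> val (Q (even_fun a)) m = 0"
  using val_Q_even even_fun by blast

lemma even_eqI: "f \<in> grade A 0 \<Longrightarrow> h \<in> grade A 0 \<Longrightarrow> val f = val h \<Longrightarrow> f = h"
  using val_eqI A.grade_carrier val_Q_even by metis

lemma even_fun_val: "f \<in> grade A 0 \<Longrightarrow> even_fun (val f) = f"
  using even_eqI even_fun val_C A.grade_carrier by metis

text \<open>The global function a + b \<tau>; by \<open>superf_val\<close> every function is of this
  form.\<close>

definition superf :: "('p \<Rightarrow> real) \<Rightarrow> ('p \<Rightarrow> real) \<Rightarrow> 'f" where
  "superf a b = even_fun a \<oplus>\<^bsub>A\<^esub> even_fun b \<otimes>\<^bsub>A\<^esub> \<tau>"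

lemma superf_carrier: "a \<in> C \<Longrightarrow> b \<in> C \<Longrightarrow> superf a b \<in> carrier A"
  by (simp add: superf_def even_fun_carrier \<tau>_carrier)

lemma val_superf: "a \<in> C \<Longrightarrow> b \<in> C \<Longrightarrow> val (superf a b) = a"
  and val_Q_superf: "a \<in> C \<Longrightarrow> b \<in> C \<Longrightarrow> val (Q (superf a b)) = b"
  using C_outside
  by (auto simp: superf_def even_fun_carrier \<tau>_carrier val_simps even_fun val_\<tau> even_fun_Q val_Q_\<tau> fun_eq_iff)

lemma val_Q_C: "f \<in> carrier A \<Longrightarrow> val (Q f) \<in> C"
  using val_C Q_closed by blast

lemma superf_val: "f \<in> carrier A \<Longrightarrow> superf (val f) (val (Q f)) = f"
  by (rule val_eqI) (simp_all add: superf_carrier val_superf val_Q_superf val_C val_Q_C)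

lemma val_fun_simps:
  "f \<in> carrier A \<Longrightarrow> h \<in> carrier A \<Longrightarrow> val (f \<oplus>\<^bsub>A\<^esub> h) = (\<lambda>m. val f m + val h m)"
  "f \<in> carrier A \<Longrightarrow> val (c \<odot>\<^bsub>A\<^esub> f) = (\<lambda>m. c * val f m)"
  "f \<in> carrier A \<Longrightarrow> h \<in> carrier A \<Longrightarrow> val (f \<otimes>\<^bsub>A\<^esub> h) = (\<lambda>m. val f m * val h m)"
  "f \<in> carrier A \<Longrightarrow> h \<in> carrier A \<Longrightarrow> val (Q (f \<oplus>\<^bsub>A\<^esub> h)) = (\<lambda>m. val (Q f) m + val (Q h) m)"
  "f \<in> carrier A \<Longrightarrow> val (Q (c \<odot>\<^bsub>A\<^esub> f)) = (\<lambda>m. c * val (Q f) m)"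
  "f \<in> carrier A \<Longrightarrow> h \<in> carrier A \<Longrightarrow>
    val (Q (f \<otimes>\<^bsub>A\<^esub> h)) = (\<lambda>m. val (Q f) m * val h m + val f m * val (Q h) m)"
  by (auto simp: val_simps)

lemma even_fun_add: "a \<in> C \<Longrightarrow> b \<in> C \<Longrightarrow> even_fun (\<lambda>m. a m + b m) = even_fun a \<oplus>\<^bsub>A\<^esub> even_fun b"
  and even_fun_cmult: "a \<in> C \<Longrightarrow> even_fun (\<lambda>m. c * a m) = c \<odot>\<^bsub>A\<^esub> even_fun a"
  and even_fun_mult: "a \<in> C \<Longrightarrow> b \<in> C \<Longrightarrow> even_fun (\<lambda>m. a m * b m) = even_fun a \<otimes>\<^bsub>A\<^esub> even_fun b"
proof -
  show "a \<in> C \<Longrightarrow> b \<in> C \<Longrightarrow> even_fun (\<lambda>m. a m + b m) = even_fun a \<oplus>\<^bsub>A\<^esub> even_fun b"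
    by (rule even_eqI) (simp_all add: even_fun C_add A.grade_add val_fun_simps even_fun_carrier)
  show "a \<in> C \<Longrightarrow> even_fun (\<lambda>m. c * a m) = c \<odot>\<^bsub>A\<^esub> even_fun a"
    by (rule even_eqI) (simp_all add: even_fun C_cmult A.grade_smult val_fun_simps even_fun_carrier)
  show "a \<in> C \<Longrightarrow> b \<in> C \<Longrightarrow> even_fun (\<lambda>m. a m * b m) = even_fun a \<otimes>\<^bsub>A\<^esub> even_fun b"
    using A.mult_grade[of "even_fun a" 0 "even_fun b" 0]
    by (intro even_eqI) (simp_all add: even_fun C_mult val_fun_simps even_fun_carrier)
qed

text \<open>\<open>lift\<close> and \<open>down\<close> identify the vector fields on the underlying manifold with the even fields
  that annihilate \<open>\<tau>\<close>.\<close>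

definition lift :: "(('p \<Rightarrow> real) \<Rightarrow> 'p \<Rightarrow> real) \<Rightarrow> 'f \<Rightarrow> 'f" where
  "lift Y = (\<lambda>f \<in> carrier A. superf (Y (val f)) (Y (val (Q f))))"

definition down :: "('f \<Rightarrow> 'f) \<Rightarrow> ('p \<Rightarrow> real) \<Rightarrow> 'p \<Rightarrow> real" where
  "down X a = val (X (even_fun a))"

lemma val_lift: "der Y \<Longrightarrow> f \<in> carrier A \<Longrightarrow> val (lift Y f) = Y (val f)"
  and val_Q_lift: "der Y \<Longrightarrow> f \<in> carrier A \<Longrightarrow> val (Q (lift Y f)) = Y (val (Q f))"
  and lift_carrier: "der Y \<Longrightarrow> f \<in> carrier A \<Longrightarrow> lift Y f \<in> carrier A"
  by (simp_all add: lift_def val_superf val_Q_superf superf_carrier der_closed val_C val_Q_C)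

lemma der_fun_zero: "der Y \<Longrightarrow> Y (\<lambda>m. 0) = (\<lambda>m. 0)"
  using der_cmult[OF _ C_zero, of Y 0] by simp

lemma lift_D:
  assumes Y: "der Y"
  shows "lift Y \<in> D 0"
proof -
  note s = val_lift[OF Y] val_Q_lift[OF Y] lift_carrier[OF Y] val_C val_Q_C val_fun_simps
    der_plus[OF Y] der_cmult[OF Y] der_leibniz[OF Y] C_mult C_add
  have "restrict (lift Y) (carrier A) \<in> D 0"
  proof (rule derivationsI)
    show "lift Y f \<in> grade A (0 + r)" if f: "f \<in> grade A r" for f r
    proof -
      have c: "f \<in> carrier A" using f by (rule A.grade_carrier)
      have "val (lift Y f) = (\<lambda>m. 0)" if "r = 1"
      proof -
        have "val f = (\<lambda>m. 0)" using f \<open>r = 1\<close> by (simp add: grade_odd_iff fun_eq_iff)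
        then show ?thesis using c by (simp add: s der_fun_zero[OF Y])
      qed
      moreover have "val (Q (lift Y f)) = (\<lambda>m. 0)" if "r = 0"
      proof -
        have "val (Q f) = (\<lambda>m. 0)" using f \<open>r = 0\<close> by (simp add: grade_even_iff fun_eq_iff)
        then show ?thesis using c by (simp add: s der_fun_zero[OF Y])
      qed
      ultimately show ?thesis
        using bit_eq[of r] c by (auto simp: grade_odd_iff grade_even_iff lift_carrier[OF Y])
    qed
    show "lift Y (f \<otimes>\<^bsub>A\<^esub> h) = lift Y f \<otimes>\<^bsub>A\<^esub> h \<oplus>\<^bsub>A\<^esub> koszul 0 r \<odot>\<^bsub>A\<^esub> (f \<otimes>\<^bsub>A\<^esub> lift Y h)"
      if "f \<in> grade A r" "h \<in> carrier A" for f h r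
      using A.grade_carrier[OF that(1)] that(2)
      by (intro val_eqI) (simp_all add: s A.smult_simps(1) algebra_simps)
    show "lift Y (f \<oplus>\<^bsub>A\<^esub> h) = lift Y f \<oplus>\<^bsub>A\<^esub> lift Y h" if "f \<in> carrier A" "h \<in> carrier A" for f h
      using that by (intro val_eqI) (simp_all add: s)
    show "lift Y (c \<odot>\<^bsub>A\<^esub> f) = c \<odot>\<^bsub>A\<^esub> lift Y f" if "f \<in> carrier A" for c f
      using that by (intro val_eqI) (simp_all add: s A.smult_simps(1))
  qed (rule lift_carrier[OF Y])
  moreover have "restrict (lift Y) (carrier A) = lift Y" by (simp add: lift_def)
  ultimately show ?thesis by simp
qed

lemma lift_Vect: "der Y \<Longrightarrow> lift Y \<in> carrier V"
  using lift_D D_Vect by blast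

text \<open>The odd part of X maps even functions to odd ones, whose values are 0.\<close>

lemma down_even_part: "X \<in> carrier V \<Longrightarrow> a \<in> C \<Longrightarrow> down X a = val (part 0 X (even_fun a))"
proof -
  assume X: "X \<in> carrier V" and a: "a \<in> C"
  have "X (even_fun a) = part 0 X (even_fun a) \<oplus>\<^bsub>A\<^esub> part 1 X (even_fun a)"
    using part_sum[OF X] V_add even_fun_carrier[OF a] by metis
  moreover have "part 1 X (even_fun a) \<in> grade A 1"
    using derivationsD(4)[OF part_D[OF X] even_fun(1)[OF a], of 1] by simp
  ultimately show ?thesis
    using val_odd derivationsD(1)[OF part_D[OF X] even_fun_carrier[OF a]]
    by (auto simp: down_def val_simps fun_eq_iff)
qed

lemma down_der:
  assumes X: "X \<in> carrier V"
  shows "der (down X)"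
proof -
  let ?X = "part 0 X"
  have d: "?X \<in> D 0" by (rule part_D[OF X])
  note s = derivationsD(1-3)[OF d] even_fun_carrier even_fun(2)
  have L: "?X (even_fun a \<otimes>\<^bsub>A\<^esub> even_fun b) = ?X (even_fun a) \<otimes>\<^bsub>A\<^esub> even_fun b \<oplus>\<^bsub>A\<^esub> even_fun a \<otimes>\<^bsub>A\<^esub> ?X (even_fun b)"
    if "a \<in> C" "b \<in> C" for a b
    using derivationsD(5)[OF d even_fun(1)[OF that(1)] even_fun_carrier[OF that(2)]] that
    by (simp add: s A.smult_simps)
  show ?thesis
    unfolding der_def
    by (auto simp: down_even_part[OF X] C_add C_mult C_cmult even_fun_add even_fun_mult even_fun_cmult
        s L val_fun_simps val_C)
qed

lemma down_val:
  assumes X: "X \<in> D 0" and f: "f \<in> carrier A"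
  shows "down X (val f) = val (X f)"
proof -
  obtain f0 f1 where d: "f0 \<in> grade A 0" "f1 \<in> grade A 1" "f = f0 \<oplus>\<^bsub>A\<^esub> f1"
    using decompose[OF f] .
  have c: "f0 \<in> carrier A" "f1 \<in> carrier A" using d A.grade_carrier by auto
  have "val f = val f0" using c val_odd[OF d(2)] by (simp add: d(3) val_fun_simps)
  moreover have "val (X f) = val (X f0)"
    using c val_odd[of "X f1"] derivationsD(4)[OF X d(2)]
    by (simp add: d(3) derivationsD(1,2)[OF X] val_fun_simps)
  ultimately show ?thesis by (simp add: down_def even_fun_val[OF d(1)])
qed

text \<open>The metric induced on the underlying manifold |M|.\<close>

definition G0 :: "(('p \<Rightarrow> real) \<Rightarrow> 'p \<Rightarrow> real) \<Rightarrow> (('p \<Rightarrow> real) \<Rightarrow> 'p \<Rightarrow> real) \<Rightarrow> 'p \<Rightarrow> real" where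
  "G0 Y Z = val (g (lift Y) (lift Z))"

lemma lift_cong: "(\<And>a. a \<in> C \<Longrightarrow> X a = Y a) \<Longrightarrow> lift X = lift Y"
  unfolding lift_def by (intro restrict_ext) (simp add: val_C val_Q_C)

lemma smooth_pairing_G0: "smooth_pairing (points M) C atlas G0"
proof
  fix X Y assume X: "der X" and Y: "der Y"
  show "G0 X Y \<in> C"
    unfolding G0_def by (intro val_C g_closed lift_Vect X Y)
  show "G0 X Y = G0 Y X"
    using g_sym[OF lift_D[OF X] lift_D[OF Y]] g_closed[OF lift_Vect[OF Y] lift_Vect[OF X]]
    by (simp add: G0_def A.smult_simps)
  show "G0 X Y = G0 X' Y" if "\<And>f. f \<in> C \<Longrightarrow> X f = X' f" for X'
    using lift_cong[OF that] by (simp add: G0_def)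
  show "G0 (\<lambda>f m. X f m + X' f m) Y = (\<lambda>m. G0 X Y m + G0 X' Y m)" if X': "der X'" for X'
  proof -
    have "lift (\<lambda>f m. X f m + X' f m) = lift X \<oplus>\<^bsub>V\<^esub> lift X'"
      using der_add[OF X X']
      by (intro Vect_eqI val_eqI)
        (simp_all add: lift_Vect Vect_closed X X' V_add lift_carrier val_lift val_Q_lift val_fun_simps)
    then show ?thesis
      using g_add_left[OF lift_Vect[OF X] lift_Vect[OF X'] lift_Vect[OF Y]]
        g_closed[OF lift_Vect lift_Vect] X X' Y by (simp add: G0_def val_fun_simps)
  qed
  show "G0 (\<lambda>h m. f m * X h m) Y = (\<lambda>m. f m * G0 X Y m)" if f: "f \<in> C" for f
  proof -
    have "lift (\<lambda>h m. f m * X h m) h = even_fun f \<otimes>\<^bsub>A\<^esub> lift X h" if h: "h \<in> carrier A" for h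
      using der_scale[OF f X] f h
      by (intro val_eqI)
        (simp_all add: lift_carrier X val_lift val_Q_lift val_fun_simps even_fun_carrier even_fun even_fun_Q)
    then have "lift (\<lambda>h m. f m * X h m) = fun_scale M (even_fun f) (lift X)"
      unfolding fun_scale_def by (intro extensionalityI[of _ "carrier A"]) (auto simp: lift_def)
    then show ?thesis
      using g_fun_scale[OF even_fun_carrier[OF f] lift_Vect[OF X] lift_Vect[OF Y]]
        g_closed[OF lift_Vect[OF X] lift_Vect[OF Y]] f
      by (simp add: G0_def val_fun_simps even_fun even_fun_carrier)
  qed
qed

lemma D_one: "X \<in> D p \<Longrightarrow> X \<one>\<^bsub>A\<^esub> = \<zero>\<^bsub>A\<^esub>"
proof -
  assume X: "X \<in> D p"
  have c: "X \<one>\<^bsub>A\<^esub> \<in> carrier A" using derivationsD(1)[OF X A.one_closed] .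
  have "X \<one>\<^bsub>A\<^esub> = X \<one>\<^bsub>A\<^esub> \<oplus>\<^bsub>A\<^esub> X \<one>\<^bsub>A\<^esub>"
    using derivationsD(5)[OF X A.one_even A.one_closed] c by (simp add: A.smult_simps)
  from arg_cong[OF this, of val] arg_cong[OF this, of "\<lambda>f. val (Q f)"] show ?thesis
    using c by (intro val_eqI) (simp_all add: val_fun_simps val_simps fun_eq_iff)
qed

lemma Q_\<tau>: "Q \<tau> = \<one>\<^bsub>A\<^esub>"
proof (rule even_eqI)
  show "Q \<tau> \<in> grade A 0" using derivationsD(4)[OF Q_der \<tau>_odd] by simp
qed (auto simp: A.one_even val_Q_\<tau> val_one fun_eq_iff)

lemma even_times_\<tau>: "b \<in> C \<Longrightarrow> X \<in> D p \<Longrightarrow>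
    X (even_fun b \<otimes>\<^bsub>A\<^esub> \<tau>) = X (even_fun b) \<otimes>\<^bsub>A\<^esub> \<tau> \<oplus>\<^bsub>A\<^esub> even_fun b \<otimes>\<^bsub>A\<^esub> X \<tau>"
  using derivationsD(5)[of X A p "even_fun b" 0 \<tau>] even_fun(1)[of b] even_fun_carrier[of b] \<tau>_carrier
  by (simp add: A.smult_simps derivationsD(1))

lemma D_superf: "a \<in> C \<Longrightarrow> b \<in> C \<Longrightarrow> X \<in> D p \<Longrightarrow>
    X (superf a b) = X (even_fun a) \<oplus>\<^bsub>A\<^esub> (X (even_fun b) \<otimes>\<^bsub>A\<^esub> \<tau> \<oplus>\<^bsub>A\<^esub> even_fun b \<otimes>\<^bsub>A\<^esub> X \<tau>)"
  by (simp add: superf_def derivationsD(2) even_fun_carrier \<tau>_carrier even_times_\<tau>)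

text \<open>Since Q \<tau> = 1, subtracting X(\<tau>) Q leaves an even field that annihilates
  \<tau>, and such a field is a lift. As Q lies in the kernel, the metric sees only the lifted
  part.\<close>

lemma even_field_decomp:
  assumes X: "X \<in> D 0"
  shows "X = fun_scale M (X \<tau>) Q \<oplus>\<^bsub>V\<^esub> lift (down X)"
proof -
  have dd: "der (down X)" by (rule down_der[OF D_Vect[OF X]])
  have X\<tau>: "X \<tau> \<in> grade A 1" using derivationsD(4)[OF X \<tau>_odd] by simp
  note c = A.grade_carrier[OF X\<tau>] derivationsD(1)[OF X] \<tau>_carrier
  have "X f = X \<tau> \<otimes>\<^bsub>A\<^esub> Q f \<oplus>\<^bsub>A\<^esub> lift (down X) f" if f: "f \<in> carrier A" for f
  proof (rule val_eqI)
    let ?b = "val (Q f)"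
    have b: "?b \<in> C" by (rule val_Q_C[OF f])
    show "val (X f) m = val (X \<tau> \<otimes>\<^bsub>A\<^esub> Q f \<oplus>\<^bsub>A\<^esub> lift (down X) f) m" for m
      using f c down_val[OF X f] val_odd[OF X\<tau>]
      by (simp add: val_simps Q_closed lift_carrier[OF dd] val_lift[OF dd])
    have Xf: "X f = X (even_fun (val f)) \<oplus>\<^bsub>A\<^esub> (X (even_fun ?b) \<otimes>\<^bsub>A\<^esub> \<tau> \<oplus>\<^bsub>A\<^esub> even_fun ?b \<otimes>\<^bsub>A\<^esub> X \<tau>)"
      using D_superf[OF val_C[OF f] b X] superf_val[OF f] by simp
    have e: "val (Q (X (even_fun a))) m = 0" if "a \<in> C" for a m
      using derivationsD(4)[OF X even_fun(1)[OF that]] val_Q_even by simp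
    show "val (Q (X f)) m = val (Q (X \<tau> \<otimes>\<^bsub>A\<^esub> Q f \<oplus>\<^bsub>A\<^esub> lift (down X) f)) m" for m
      unfolding Xf using f b c val_odd[OF X\<tau>] val_Q_\<tau>[of m] val_outside[of m]
      by (simp add: val_simps Q_closed lift_carrier[OF dd] val_Q_lift[OF dd] e val_C even_fun_carrier
          even_fun val_\<tau> down_def even_fun_Q val_Q_C)
  qed (use f c lift_carrier[OF dd] Q_closed in simp_all)
  then show ?thesis
    using derivationsD(7)[OF X] unfolding Vect_simps fun_scale_def
    by (intro extensionalityI[of _ "carrier A"]) auto
qed

lemma fun_scale_even_D:
  assumes h: "h \<in> grade A 0" and X: "X \<in> D p"
  shows "fun_scale M h X \<in> D p"
  unfolding fun_scale_def
proof (rule derivationsI)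
  note c = A.grade_carrier[OF h] derivationsD(1-3)[OF X]
  show "h \<otimes>\<^bsub>A\<^esub> X f \<in> grade A (p + r)" if "f \<in> grade A r" for f r
    using A.mult_grade[OF h derivationsD(4)[OF X that]] by simp
  show "h \<otimes>\<^bsub>A\<^esub> X (f \<otimes>\<^bsub>A\<^esub> k) = h \<otimes>\<^bsub>A\<^esub> X f \<otimes>\<^bsub>A\<^esub> k \<oplus>\<^bsub>A\<^esub> koszul p r \<odot>\<^bsub>A\<^esub> (f \<otimes>\<^bsub>A\<^esub> (h \<otimes>\<^bsub>A\<^esub> X k))"
    if "f \<in> grade A r" "k \<in> carrier A" for f k r
    unfolding derivationsD(5)[OF X that] using A.grade_carrier[OF that(1)] that(2) c
    by (intro val_eqI) (simp_all add: val_simps algebra_simps)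
  show "h \<otimes>\<^bsub>A\<^esub> X f \<in> carrier A" if "f \<in> carrier A" for f using that c by simp
  show "h \<otimes>\<^bsub>A\<^esub> X (f \<oplus>\<^bsub>A\<^esub> k) = h \<otimes>\<^bsub>A\<^esub> X f \<oplus>\<^bsub>A\<^esub> h \<otimes>\<^bsub>A\<^esub> X k" if "f \<in> carrier A" "k \<in> carrier A" for f k
    using that c by (simp add: A.r_distr)
  show "h \<otimes>\<^bsub>A\<^esub> X (a \<odot>\<^bsub>A\<^esub> f) = a \<odot>\<^bsub>A\<^esub> (h \<otimes>\<^bsub>A\<^esub> X f)" if "f \<in> carrier A" for a f
    using that c by (simp add: A.smult_mult_right)
qed

lemma Q_kernel: "Z \<in> carrier V \<Longrightarrow> g Q Z = \<zero>\<^bsub>A\<^esub>"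
proof -
  assume Z: "Z \<in> carrier V"
  have "fun_scale M \<one>\<^bsub>A\<^esub> Q \<in> metric_kernel M g" unfolding kernel_span by blast
  then show ?thesis using Z fun_scale_one[OF Q_Vect] by (simp add: metric_kernel_def)
qed

text \<open>An odd field that annihilates \<open>\<tau>\<close> is \<open>\<tau>\<close> times the even field \<open>[Q, R]\<close>.\<close>

lemma odd_field_pairing:
  assumes X: "X \<in> D 1" and Z: "Z \<in> carrier V"
  shows "val (g X Z) m = 0"
proof -
  let ?h = "X \<tau>"
  have h: "?h \<in> grade A 0" using derivationsD(4)[OF X \<tau>_odd] by simp
  note hc = A.grade_carrier[OF h]
  have hQ: "fun_scale M ?h Q \<in> D 1" by (rule fun_scale_even_D[OF h Q_D])
  \<comment> \<open>Removing the component along Q does not change pairings with Z and makes the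
    remainder annihilate \<tau>.\<close>
  define R where "R = X \<oplus>\<^bsub>V\<^esub> (-1) \<odot>\<^bsub>V\<^esub> fun_scale M ?h Q"
  have R: "R \<in> D 1" unfolding R_def by (intro D_add X D_smult hQ)
  note c = derivationsD(1)[OF X] derivationsD(1)[OF R] Q_closed hc \<tau>_carrier
  have R\<tau>: "R \<tau> = \<zero>\<^bsub>A\<^esub>"
  proof -
    have "R \<tau> = ?h \<oplus>\<^bsub>A\<^esub> (-1) \<odot>\<^bsub>A\<^esub> (?h \<otimes>\<^bsub>A\<^esub> \<one>\<^bsub>A\<^esub>)"
      using \<tau>_carrier by (simp add: R_def V_add V_smult fun_scale_def Q_\<tau>)
    then show ?thesis using hc by (intro val_eqI) (simp_all add: val_simps)
  qed
  \<comment> \<open>Write f = a + b \<tau>: R a is odd, and R(b \<tau>) = R(b) \<tau> because R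
    \<tau> = 0.\<close>
  have R0: "val (R f) m = 0" if f: "f \<in> carrier A" for f m
  proof -
    have "R f = R (even_fun (val f)) \<oplus>\<^bsub>A\<^esub> (R (even_fun (val (Q f))) \<otimes>\<^bsub>A\<^esub> \<tau> \<oplus>\<^bsub>A\<^esub> even_fun (val (Q f)) \<otimes>\<^bsub>A\<^esub> R \<tau>)"
      using D_superf[OF val_C[OF f] val_Q_C[OF f] R] superf_val[OF f] by simp
    moreover have "R (even_fun (val f)) \<in> grade A 1"
      using derivationsD(4)[OF R even_fun(1)[OF val_C[OF f]]] by simp
    ultimately show ?thesis
      using f c val_odd[of "R (even_fun (val f))"]
      by (simp add: R\<tau> val_simps even_fun_carrier val_C val_Q_C val_\<tau>)
  qed
  let ?B = "hcomm 1 1 Q R"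
  have B: "?B \<in> D 0" using hcomm_D[OF Q_D R] by simp
  \<comment> \<open>Both sides have value 0. Their Q-values agree because the value of [Q, R] f =
    Q(R f) + R(Q f) reduces to that of Q(R f).\<close>
  have "R f = \<tau> \<otimes>\<^bsub>A\<^esub> ?B f" if f: "f \<in> carrier A" for f
    using f c derivationsD(1)[OF B f] R0[OF f] R0[OF Q_closed[OF f]] val_Q_\<tau> val_outside
    by (intro val_eqI) (simp_all add: val_simps val_\<tau> hcomm_apply)
  then have "R = fun_scale M \<tau> ?B"
    unfolding fun_scale_def using derivationsD(7)[OF R]
    by (intro extensionalityI[of _ "carrier A"]) auto
  then have gR: "g R Z = \<tau> \<otimes>\<^bsub>A\<^esub> g ?B Z"
    using g_fun_scale[OF \<tau>_carrier D_Vect[OF B] Z] by simp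
  have "X = fun_scale M ?h Q \<oplus>\<^bsub>V\<^esub> R"
    using derivationsD(1)[OF hQ] D_Vect[OF X] D_Vect[OF R] D_Vect[OF hQ] c
    by (intro Vect_eqI val_eqI) (simp_all add: Vect_closed V_add V_smult R_def val_simps)
  then have "g X Z = ?h \<otimes>\<^bsub>A\<^esub> g Q Z \<oplus>\<^bsub>A\<^esub> g R Z"
    using g_linear[OF hc Q_Vect D_Vect[OF R] Z] by metis
  then show ?thesis
    using hc g_closed[OF D_Vect[OF B] Z] \<tau>_carrier by (simp add: gR Q_kernel[OF Z] val_simps val_\<tau>)
qed

lemma even_field_pairing:
  assumes X: "X \<in> D 0" and Z: "Z \<in> carrier V"
  shows "val (g X Z) m = val (g (lift (down X)) Z) m"
proof -
  have dd: "der (down X)" by (rule down_der[OF D_Vect[OF X]])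
  note c = derivationsD(1)[OF X \<tau>_carrier]
  have "g X Z = X \<tau> \<otimes>\<^bsub>A\<^esub> g Q Z \<oplus>\<^bsub>A\<^esub> g (lift (down X)) Z"
    using g_linear[OF c Q_Vect lift_Vect[OF dd] Z] even_field_decomp[OF X] by metis
  then show ?thesis
    using c g_closed[OF lift_Vect[OF dd] Z] by (simp add: Q_kernel[OF Z] val_simps)
qed

lemma val_g_sym:
  assumes "X \<in> D 0" "Z \<in> carrier V"
  shows "val (g X Z) m = val (g (part 0 Z) X) m"
proof -
  note p = part_D[OF assms(2)]
  have "g X Z = g X (part 0 Z) \<oplus>\<^bsub>A\<^esub> g X (part 1 Z)"
    using g_add_right[OF D_Vect[OF assms(1)] D_Vect[OF p] D_Vect[OF p]] part_sum[OF assms(2)] by metis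
  moreover have "val (g X (part 1 Z)) m = 0"
    using g_grade[OF assms(1) p, of 1] val_odd by simp
  moreover have "g X (part 0 Z) = g (part 0 Z) X"
    using g_sym[OF assms(1) p, of 0] g_closed[OF D_Vect[OF p] D_Vect[OF assms(1)], of 0]
    by (simp add: A.smult_simps)
  ultimately show ?thesis
    using g_closed[OF D_Vect[OF assms(1)] D_Vect[OF p]] g_closed[OF D_Vect[OF p] D_Vect[OF assms(1)]]
    by (simp add: val_simps)
qed

lemma down_part: "X \<in> carrier V \<Longrightarrow> a \<in> C \<Longrightarrow> down (part 0 X) a = down X a"
  using down_even_part by (simp add: down_def)

text \<open>Odd fields pair to functions with value 0, and an even field differs from the lift of
  its reduction by a multiple of the kernel field Q. Graded symmetry carries the argument over to
  the second slot.\<close>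

lemma val_g:
  assumes X: "X \<in> carrier V" and Z: "Z \<in> carrier V"
  shows "val (g X Z) m = G0 (down X) (down Z) m"
proof -
  note p = part_D[OF X] part_D[OF Z]
  have "g X Z = g (part 0 X) Z \<oplus>\<^bsub>A\<^esub> g (part 1 X) Z"
    using g_add_left[OF D_Vect[OF p(1)] D_Vect[OF p(1)] Z] part_sum[OF X] by metis
  then have "val (g X Z) m = val (g (part 0 X) Z) m"
    using g_closed[OF D_Vect[OF p(1)] Z] odd_field_pairing[OF p(1) Z] by (simp add: val_simps)
  also have "\<dots> = val (g (lift (down (part 0 X))) Z) m" by (rule even_field_pairing[OF p(1) Z])
  also have "lift (down (part 0 X)) = lift (down X)" by (rule lift_cong) (rule down_part[OF X])
  also have "val (g (lift (down X)) Z) m = val (g (part 0 Z) (lift (down X))) m"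
    by (rule val_g_sym[OF lift_D[OF down_der[OF X]] Z])
  also have "\<dots> = val (g (lift (down (part 0 Z))) (lift (down X))) m"
    by (rule even_field_pairing[OF p(2) lift_Vect[OF down_der[OF X]]])
  also have "lift (down (part 0 Z)) = lift (down Z)" by (rule lift_cong) (rule down_part[OF Z])
  finally show ?thesis
    using smooth_pairing.G_sym[OF smooth_pairing_G0 down_der[OF X] down_der[OF Z]] by (simp add: G0_def)
qed

end

section \<open>The forms on the tangent spaces and nondegeneracy of the reduced metric\<close>

context super_null_riemannian
begin

interpretation G0: smooth_pairing "points M" C atlas G0
  by (rule smooth_pairing_G0)

lemma vector_at_val: "m \<in> pts \<Longrightarrow> f \<in> carrier A \<Longrightarrow> vector_at M m X f = val (X f) m"
  by (simp add: vector_at_def val_def)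

lemma vector_at_eqD:
  "m \<in> pts \<Longrightarrow> vector_at M m X = vector_at M m Y \<Longrightarrow> f \<in> carrier A \<Longrightarrow> val (X f) m = val (Y f) m"
  using vector_at_val by metis

lemma tangent_carrier:
  assumes "m \<in> pts"
  shows "carrier (tangent_space M m) = {v \<in> extensional (carrier A).
       (\<forall>f \<in> carrier A. \<forall>h \<in> carrier A. v (f \<oplus>\<^bsub>A\<^esub> h) = v f + v h) \<and>
       (\<forall>c. \<forall>f \<in> carrier A. v (c \<odot>\<^bsub>A\<^esub> f) = c * v f) \<and>
       (\<forall>f \<in> carrier A. \<forall>h \<in> carrier A. v (f \<otimes>\<^bsub>A\<^esub> h) = v f * val h m + val f m * v h)}"
  using assms by (simp add: tangent_space_def Let_def val_def)

lemma tangent_simps: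
  "grade (tangent_space M m) p = {v \<in> carrier (tangent_space M m). \<forall>f \<in> grade A (p + 1). v f = 0}"
  "\<zero>\<^bsub>tangent_space M m\<^esub> = (\<lambda>f \<in> carrier A. 0)"
  "v \<oplus>\<^bsub>tangent_space M m\<^esub> w = (\<lambda>f \<in> carrier A. v f + w f)"
  "c \<odot>\<^bsub>tangent_space M m\<^esub> v = (\<lambda>f \<in> carrier A. c * v f)"
  by (simp_all add: tangent_space_def Let_def)

text \<open>Every tangent vector is \<open>\<Sum> w(\<xi>\<^sub>i) \<partial>\<^sub>i + w(\<tau>) Q\<close> at the point.\<close>

lemma tangent_vector_extends:
  assumes m: "m \<in> pts" and w: "w \<in> carrier (tangent_space M m)"
  obtains X where "X \<in> carrier V" "vector_at M m X = w"
proof -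
  note w = w[unfolded tangent_carrier[OF m]]
  obtain U W \<phi> r \<xi> \<delta> where mU: "m \<in> U" and fr: "coordinate_frame (points M) C atlas U W \<phi> (\<phi> m) r \<xi> \<delta>"
    using frame_exists[OF m] .
  interpret coordinate_frame "points M" C atlas U W \<phi> "\<phi> m" r \<xi> \<delta> by (rule fr)
  define w0 where "w0 a = w (even_fun a)" for a
  have c: "\<phi> m \<in> ball (\<phi> m) r" using r by simp
  have \<psi>m: "inv_into U \<phi> (\<phi> m) = m" using atlas_inv[OF chart] mU by blast
  have "pder m w0"
    using w by (auto simp: pder_def w0_def even_fun_add even_fun_cmult even_fun_mult even_fun_carrier even_fun)
  then have w0: "w0 a = (\<Sum>i\<in>UNIV. w0 (\<xi> i) * \<delta> i a m)" if "a \<in> C" for a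
    using pder_formula[OF c _ that] \<delta>[OF that c] by (simp add: \<psi>m)
  define Y where "Y a m' = (\<Sum>i\<in>UNIV. (if m' \<in> pts then w0 (\<xi> i) else 0) * \<delta> i a m')" for a m'
  have dY: "der Y"
    unfolding Y_def[abs_def] by (intro der_sum der_scale C_const \<delta>_der)
  define X where "X = lift Y \<oplus>\<^bsub>V\<^esub> w \<tau> \<odot>\<^bsub>V\<^esub> Q"
  have X: "X \<in> carrier V" unfolding X_def by (intro Vect_closed lift_Vect dY Q_Vect)
  have "vector_at M m X = w"
  proof (rule extensionalityI[of _ "carrier A"])
    show "vector_at M m X \<in> extensional (carrier A)" by (simp add: vector_at_def)
    show "w \<in> extensional (carrier A)" using w by blast
    fix f assume f: "f \<in> carrier A"
    note fC = val_C[OF f] val_Q_C[OF f]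
    have "val (X f) m = w0 (val f) + w \<tau> * val (Q f) m"
      using f w0[OF fC(1)] m
      by (simp add: X_def V_add V_smult val_simps lift_carrier dY Q_closed val_lift Y_def)
    also have "\<dots> = w (superf (val f) (val (Q f)))"
      using w fC by (simp add: superf_def even_fun_carrier even_fun \<tau>_carrier val_\<tau> w0_def)
    also have "\<dots> = w f" using superf_val[OF f] by simp
    finally show "vector_at M m X f = w f" using vector_at_val[OF m f] by simp
  qed
  with X that show ?thesis by blast
qed

lemma G0_pointwise:
  assumes m: "m \<in> pts" and X: "der X" "der X'" and Y: "der Y"
    and eq: "\<And>a. a \<in> C \<Longrightarrow> X a m = X' a m"
  shows "G0 X Y m = G0 X' Y m"
proof -
  obtain U W \<phi> r \<xi> \<delta> where mU: "m \<in> U" and fr: "coordinate_frame (points M) C atlas U W \<phi> (\<phi> m) r \<xi> \<delta>"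
    using frame_exists[OF m] .
  interpret coordinate_frame "points M" C atlas U W \<phi> "\<phi> m" r \<xi> \<delta> by (rule fr)
  have c: "\<phi> m \<in> ball (\<phi> m) r" using r by simp
  have \<psi>m: "inv_into U \<phi> (\<phi> m) = m" using atlas_inv[OF chart] mU by blast
  show ?thesis
    using G0.G_frame[OF fr c X(1) Y] G0.G_frame[OF fr c X(2) Y] eq[OF \<xi>_C] by (simp add: \<psi>m)
qed

text \<open>The definite description in \<open>metric_at\<close> is well defined: by
  \<open>val_g\<close> the value of the pairing is that of \<open>G0\<close> on the reductions,
  which depends on the two vectors at m only.\<close>

lemma metric_at_val:
  assumes m: "m \<in> pts" and X: "X \<in> carrier V" and Y: "Y \<in> carrier V"
  shows "metric_at M g m (vector_at M m X) (vector_at M m Y) = val (g X Y) m"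
  unfolding metric_at_def
proof (rule the_equality)
  show "\<exists>X'\<in>carrier V. \<exists>Y'\<in>carrier V. vector_at M m X' = vector_at M m X \<and>
      vector_at M m Y' = vector_at M m Y \<and> val (g X Y) m = fun_value M m (g X' Y')"
    using X Y m by (auto simp: val_def)
  fix r assume "\<exists>X'\<in>carrier V. \<exists>Y'\<in>carrier V. vector_at M m X' = vector_at M m X \<and>
      vector_at M m Y' = vector_at M m Y \<and> r = fun_value M m (g X' Y')"
  then obtain X' Y' where X': "X' \<in> carrier V" and Y': "Y' \<in> carrier V"
    and eq: "vector_at M m X' = vector_at M m X" "vector_at M m Y' = vector_at M m Y"
    and r: "r = val (g X' Y') m"
    using m by (auto simp: val_def)
  have e: "down X' a m = down X a m" "down Y' a m = down Y a m" if "a \<in> C" for a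
    using vector_at_eqD[OF m eq(1)] vector_at_eqD[OF m eq(2)] even_fun_carrier[OF that]
    by (simp_all add: down_def)
  note d = down_der[OF X] down_der[OF X'] down_der[OF Y] down_der[OF Y']
  have "r = G0 (down X') (down Y') m" by (simp add: r val_g[OF X' Y'])
  also have "\<dots> = G0 (down X) (down Y') m" by (rule G0_pointwise[OF m d(2,1,4) e(1)])
  also have "\<dots> = G0 (down Y') (down X) m" by (simp add: G0.G_sym[OF d(1,4)])
  also have "\<dots> = G0 (down Y) (down X) m" by (rule G0_pointwise[OF m d(4,3,1) e(2)])
  also have "\<dots> = val (g X Y) m" by (simp add: val_g[OF X Y] G0.G_sym[OF d(1,3)])
  finally show "r = val (g X Y) m" .
qed

text \<open>The rank condition says that the even piece of the pointwise kernel has dimension 0.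
  Before a dimension can be used, this piece has to be shown to be a vector space, which takes up
  most of the proof.\<close>

lemma even_kernel_trivial:
  assumes m: "m \<in> pts" and v: "v \<in> carrier (metric_kernel_at M g m)"
    and odd: "\<And>f. f \<in> grade A 1 \<Longrightarrow> v f = 0"
  shows "f \<in> carrier A \<Longrightarrow> v f = 0"
proof -
  let ?T = "tangent_space M m" and ?K = "metric_kernel_at M g m"
  let ?E = "graded_piece ?K 0"
  have K: "carrier ?K = {v \<in> carrier ?T. \<forall>w \<in> carrier ?T. metric_at M g m v w = 0}"
    by (simp add: metric_kernel_at_def Let_def)
  have E: "carrier ?E = {v \<in> carrier ?K. \<forall>f \<in> grade A 1. v f = 0}"
    using K by (auto simp: graded_piece_def metric_kernel_at_def Let_def tangent_simps)
  have E_simps: "\<zero>\<^bsub>?E\<^esub> = (\<lambda>f \<in> carrier A. 0)" "v \<oplus>\<^bsub>?E\<^esub> w = (\<lambda>f \<in> carrier A. v f + w f)"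
    "c \<odot>\<^bsub>?E\<^esub> v = (\<lambda>f \<in> carrier A. c * v f)" for v w c
    by (simp_all add: graded_piece_def metric_kernel_at_def Let_def tangent_space_def)
  have kernel_iff: "vector_at M m X \<in> carrier ?K \<longleftrightarrow>
      vector_at M m X \<in> carrier ?T \<and> (\<forall>Y \<in> carrier V. vector_at M m Y \<in> carrier ?T \<longrightarrow> val (g X Y) m = 0)"
    if X: "X \<in> carrier V" for X
    unfolding K using metric_at_val[OF m X] tangent_vector_extends[OF m] by (auto; metis)
  \<comment> \<open>\<open>metric_at\<close> is not linear by definition, so the tangent vectors are
    represented by global fields and the linearity of g is used.\<close>
  have lin: "(\<lambda>f \<in> carrier A. a * v f + b * w f) \<in> carrier ?E" if v: "v \<in> carrier ?E" and w: "w \<in> carrier ?E" for a b v w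
  proof -
    have vT: "v \<in> carrier ?T" "w \<in> carrier ?T" using v w E K by auto
    obtain X where X: "X \<in> carrier V" "vector_at M m X = v" using tangent_vector_extends[OF m vT(1)] .
    obtain Y where Y: "Y \<in> carrier V" "vector_at M m Y = w" using tangent_vector_extends[OF m vT(2)] .
    let ?Z = "a \<odot>\<^bsub>V\<^esub> X \<oplus>\<^bsub>V\<^esub> b \<odot>\<^bsub>V\<^esub> Y" and ?z = "\<lambda>f \<in> carrier A. a * v f + b * w f"
    have Z: "?Z \<in> carrier V" by (intro Vect_closed X Y)
    have vZ: "vector_at M m ?Z = ?z"
    proof (rule extensionalityI[of _ "carrier A"])
      fix f assume f: "f \<in> carrier A"
      show "vector_at M m ?Z f = ?z f"
        using f vector_at_val[OF m f, of X] vector_at_val[OF m f, of Y] X Y VectD(1)[OF X(1) f] VectD(1)[OF Y(1) f]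
        by (simp add: vector_at_val[OF m f] V_add V_smult val_simps)
    qed (simp_all add: vector_at_def)
    have zT: "?z \<in> carrier ?T"
      using vT unfolding tangent_carrier[OF m] by (auto simp: A.smult_simps algebra_simps)
    have "val (g ?Z Y') m = 0" if Y': "Y' \<in> carrier V" "vector_at M m Y' \<in> carrier ?T" for Y'
    proof -
      have "val (g X Y') m = 0" "val (g Y Y') m = 0"
        using kernel_iff[OF X(1)] kernel_iff[OF Y(1)] v w Y' X(2) Y(2) E by auto
      then show ?thesis
        using X(1) Y(1) Y'(1) by (simp add: g_add_left g_smult_left Vect_closed g_closed val_simps)
    qed
    then have "?z \<in> carrier ?K" using kernel_iff[OF Z] zT vZ by simp
    then show ?thesis
      using v w A.grade_carrier unfolding E by simp
  qed
  have ext: "u \<in> extensional (carrier A)" if "u \<in> carrier ?E" for u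
    using that unfolding E K tangent_carrier[OF m] by blast
  have vE: "v \<in> carrier ?E" using v odd by (simp add: E)
  have zeroE: "(\<lambda>f \<in> carrier A. 0) \<in> carrier ?E" using lin[OF vE vE, of 0 0] by simp
  have addE: "(\<lambda>f \<in> carrier A. u f + w f) \<in> carrier ?E" if "u \<in> carrier ?E" "w \<in> carrier ?E" for u w
    using lin[OF that, of 1 1] by simp
  have smultE: "(\<lambda>f \<in> carrier A. c * u f) \<in> carrier ?E" if "u \<in> carrier ?E" for u c
    using lin[OF that that, of c 0] by simp
  have res: "restrict u (carrier A) = u" if "u \<in> carrier ?E" for u
    using ext[OF that] extensional_restrict by blast
  have "vectorspace real_ring ?E"
  proof (rule vs_criteria)
    show "field real_ring" by (rule A.field_axioms)
    show "\<forall>u\<in>carrier ?E. \<exists>w\<in>carrier ?E. u \<oplus>\<^bsub>?E\<^esub> w = \<zero>\<^bsub>?E\<^esub>"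
    proof
      fix u assume "u \<in> carrier ?E"
      from smultE[OF this, of "-1"] show "\<exists>w\<in>carrier ?E. u \<oplus>\<^bsub>?E\<^esub> w = \<zero>\<^bsub>?E\<^esub>"
        by (rule bexI[rotated]) (simp add: E_simps cong: restrict_cong)
    qed
  qed (auto simp: E_simps zeroE addE smultE res algebra_simps intro!: restrict_ext cong: restrict_cong)
  then interpret E: vectorspace real_ring ?E .
  have "has_superdim ?K 0 1" by (rule kernel_rank[OF m])
  then have "E.fin_dim" "E.dim = 0" by (auto simp: has_superdim_def)
  \<comment> \<open>\<open>dim\<close> is the least size of a finite spanning set;
    \<open>fin_dim\<close> ensures that one exists, so the least size 0 is attained by the empty
    set.\<close>
  then have "\<exists>B. finite B \<and> card B = 0 \<and> B \<subseteq> carrier ?E \<and> E.span B = carrier ?E"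
    using LeastI_ex[of "\<lambda>n. \<exists>B. finite B \<and> card B = n \<and> B \<subseteq> carrier ?E \<and> E.span B = carrier ?E"]
    unfolding E.fin_dim_def E.dim_def by auto
  then have "carrier ?E = {\<zero>\<^bsub>?E\<^esub>}" using E.span_empty by auto
  then have "v = (\<lambda>f \<in> carrier A. 0)" using vE E_simps(1) by simp
  then show "f \<in> carrier A \<Longrightarrow> v f = 0" by simp
qed

text \<open>A vector orthogonal to everything for \<open>G0\<close> lifts to an even tangent vector
  in the kernel of the form at m, and a kernel of dimension 0|1 has no nonzero even vector.\<close>

lemma smooth_metric_G0: "smooth_metric (points M) C atlas G0"
proof (intro smooth_metric.intro smooth_pairing_G0 smooth_metric_axioms.intro)
  fix m X a assume m: "m \<in> pts" and X: "der X" and G: "\<And>Y. der Y \<Longrightarrow> G0 X Y m = 0" and a: "a \<in> C"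
  let ?v = "vector_at M m (lift X)"
  note L = lift_Vect[OF X]
  have down_lift: "down (lift X) b = X b" if "b \<in> C" for b
    using that X by (simp add: down_def val_lift even_fun_carrier even_fun)
  have vT: "?v \<in> carrier (tangent_space M m)"
    unfolding tangent_carrier[OF m]
    using X by (auto simp: vector_at_val[OF m] lift_carrier val_lift A.smult_simps val_fun_simps val_C
        der_plus der_cmult der_leibniz) (simp add: vector_at_def)
  have "metric_at M g m ?v w = 0" if w: "w \<in> carrier (tangent_space M m)" for w
  proof -
    obtain Y where Y: "Y \<in> carrier V" "vector_at M m Y = w" using tangent_vector_extends[OF m w] .
    have "metric_at M g m ?v w = G0 (down (lift X)) (down Y) m"
      using metric_at_val[OF m L Y(1)] Y(2) val_g[OF L Y(1)] by simp
    also have "\<dots> = G0 X (down Y) m"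
      using down_lift by (intro G0_pointwise[OF m down_der[OF L] X down_der[OF Y(1)]]) simp
    finally show ?thesis using G[OF down_der[OF Y(1)]] by simp
  qed
  then have v: "?v \<in> carrier (metric_kernel_at M g m)"
    using vT by (simp add: metric_kernel_at_def Let_def)
  have "?v f = 0" if "f \<in> grade A 1" for f
    using derivationsD(4)[OF lift_D[OF X] that] val_odd vector_at_val[OF m A.grade_carrier[OF that]] by simp
  from even_kernel_trivial[OF m v this even_fun_carrier[OF a]]
  show "X a m = 0"
    using vector_at_val[OF m even_fun_carrier[OF a]] down_lift[OF a] by (simp add: down_def)
qed

section \<open>Super-null fields seen on the underlying manifold, and finite dimension\<close>

interpretation G0: smooth_metric "points M" C atlas G0
  by (rule smooth_metric_G0)

lemma Q_Q: "f \<in> carrier A \<Longrightarrow> Q (Q f) = P f"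
proof -
  assume f: "f \<in> carrier A"
  have "hcomm 1 1 Q Q f = (2 \<odot>\<^bsub>V\<^esub> P) f"
    using Q_squared commutator_homogeneous[OF Q_D Q_D] by simp
  then have e: "Q (Q f) \<ominus>\<^bsub>A\<^esub> koszul 1 1 \<odot>\<^bsub>A\<^esub> Q (Q f) = 2 \<odot>\<^bsub>A\<^esub> P f"
    using f by (simp add: hcomm_apply V_smult)
  have "val (Q (Q f)) m = val (P f) m" "val (Q (Q (Q f))) m = val (Q (P f)) m" for m
    using arg_cong[OF e, of "\<lambda>f. val f m"] arg_cong[OF e, of "\<lambda>f. val (Q f) m"] f
    by (simp_all add: val_simps Q_closed P_closed)
  then show ?thesis using f by (intro val_eqI) (auto simp: Q_closed P_closed)
qed

lemma null_field_Q:
  assumes X: "null_field p X" and f: "f \<in> carrier A"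
  shows "X (Q f) = koszul p 1 \<odot>\<^bsub>A\<^esub> Q (X f)"
proof -
  have d: "X \<in> D p" and "commutator M X Q = \<zero>\<^bsub>V\<^esub>" using X by (auto simp: null_field_def)
  then have e: "X (Q f) \<ominus>\<^bsub>A\<^esub> koszul p 1 \<odot>\<^bsub>A\<^esub> Q (X f) = \<zero>\<^bsub>A\<^esub>"
    using commutator_homogeneous[OF d Q_D] hcomm_apply[OF f] V_zero[OF f] by metis
  note c = derivationsD(1)[OF d] Q_closed f
  have "val (X (Q f)) m = koszul p 1 * val (Q (X f)) m"
    "val (Q (X (Q f))) m = koszul p 1 * val (Q (Q (X f))) m" for m
    using arg_cong[OF e, of "\<lambda>f. val f m"] arg_cong[OF e, of "\<lambda>f. val (Q f) m"] c
    by (simp_all add: val_simps)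
  then show ?thesis using c by (intro val_eqI) (simp_all add: val_simps)
qed

text \<open>Applying \<open>Q X = X Q\<close> to \<open>\<tau>\<close> gives \<open>X(\<tau>) = 0\<close>, so that \<open>X\<close> comes from a field on the
  underlying manifold.\<close>

lemma even_null_field:
  assumes X: "null_field 0 X"
  shows "X = lift (down X)" "G0.killing (down X)"
proof -
  have d: "X \<in> D 0" using X by (simp add: null_field_def)
  note v = D_Vect[OF d]
  have X\<tau>o: "X \<tau> \<in> grade A 1" using derivationsD(4)[OF d \<tau>_odd] by simp
  have "Q (X \<tau>) = \<zero>\<^bsub>A\<^esub>"
    using null_field_Q[OF X \<tau>_carrier] Q_\<tau> D_one[OF d] derivationsD(1)[OF d \<tau>_carrier] Q_closed
    by (simp add: A.smult_simps)
  then have "X \<tau> = \<zero>\<^bsub>A\<^esub>"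
    using A.grade_carrier[OF X\<tau>o] val_odd[OF X\<tau>o] by (intro val_eqI) (simp_all add: val_simps)
  then have "fun_scale M (X \<tau>) Q = \<zero>\<^bsub>V\<^esub>"
    unfolding fun_scale_def Vect_simps by (intro restrict_ext) (simp add: Q_closed)
  then show XL: "X = lift (down X)"
    using even_field_decomp[OF d] Vect_add_comm[OF Vect_zero_closed lift_Vect[OF down_der[OF v]]]
      V_zero_simps(2)[OF lift_Vect[OF down_der[OF v]]] by simp
  have dd: "der (down X)" by (rule down_der[OF v])
  \<comment> \<open>\<open>lift\<close> respects brackets, so the invariance of g, evaluated on
    lifted fields, reduces to Killing's equation for \<open>G0\<close>.\<close>
  have br: "commutator M X (lift Y) = lift (lie (down X) Y)" if Y: "der Y" for Y
  proof -
    have "hcomm 0 0 (lift (down X)) (lift Y) = lift (lie (down X) Y)"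
      using dd Y der_lie[OF dd Y] D_Vect[OF hcomm_D[OF lift_D[OF dd] lift_D[OF Y]]]
      by (intro Vect_eqI val_eqI)
        (simp_all add: lift_Vect hcomm_apply lift_carrier val_lift val_Q_lift val_simps val_fun_simps lie_def)
    then show ?thesis using XL commutator_homogeneous[OF d lift_D[OF Y]] by simp
  qed
  show "G0.killing (down X)"
    unfolding G0.killing_def
  proof (intro conjI dd allI impI)
    fix Y Z assume Y: "der Y" and Z: "der Z"
    have "down X (G0 Y Z) = val (X (g (lift Y) (lift Z)))"
      unfolding G0_def by (rule down_val[OF d g_closed[OF lift_Vect[OF Y] lift_Vect[OF Z]]])
    also have "X (g (lift Y) (lift Z)) =
        g (lift (lie (down X) Y)) (lift Z) \<oplus>\<^bsub>A\<^esub> g (lift Y) (lift (lie (down X) Z))"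
      using null_field_eq[OF X lift_D[OF Y] lift_Vect[OF Z]]
        g_closed[OF lift_Vect[OF Y] lift_Vect[OF der_lie[OF dd Z]]] br[OF Y] br[OF Z]
      by (simp add: A.smult_simps)
    finally show "down X (G0 Y Z) = (\<lambda>m. G0 (lie (down X) Y) Z m + G0 Y (lie (down X) Z) m)"
      using Y Z by (simp add: val_fun_simps g_closed lift_Vect der_lie dd G0_def)
  qed
qed

text \<open>For odd \<open>X\<close> with \<open>\<xi> = X(\<tau>)\<close>, the equation \<open>Q X = - X Q\<close> gives \<open>X = - \<xi> \<tau> P\<close> on even
  functions, so the even null field \<open>[X, X]\<close> is \<open>- 2 \<xi>\<^sup>2 P\<close> there.\<close>

lemma odd_null_field:
  assumes X: "null_field 1 X"
  shows "a \<in> C \<Longrightarrow> X (even_fun a) = superf (\<lambda>m. 0) (\<lambda>m. - val (X \<tau>) m * val (P (even_fun a)) m)"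
    "a \<in> C \<Longrightarrow> down (commutator M X X) a = (\<lambda>m. - 2 * (val (X \<tau>) m * val (X \<tau>) m) * val (P (even_fun a)) m)"
proof -
  have d: "X \<in> D 1" using X by (simp add: null_field_def)
  note c = derivationsD(1)[OF d] \<tau>_carrier Q_closed even_fun_carrier P_closed
  let ?x = "val (X \<tau>)"
  have xC: "?x \<in> C" using c by (intro val_C) auto
  have X_odd: "X (even_fun b \<otimes>\<^bsub>A\<^esub> \<tau>) = X (even_fun b) \<otimes>\<^bsub>A\<^esub> \<tau> \<oplus>\<^bsub>A\<^esub> even_fun b \<otimes>\<^bsub>A\<^esub> X \<tau>" if "b \<in> C" for b
    by (rule even_times_\<tau>[OF that d])
  \<comment> \<open>X(b \<tau>) = X(b) \<tau> + b X(\<tau>), and only the second term has a nonzero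
    value.\<close>
  have val_X_odd: "val (X (superf (\<lambda>m. 0) b)) m = b m * ?x m" if b: "b \<in> C" for b m
  proof -
    have z: "even_fun (\<lambda>m. 0) = \<zero>\<^bsub>A\<^esub>"
      by (rule even_eqI) (auto simp: even_fun C_zero A.grade_zero val_zero)
    then have "superf (\<lambda>m. 0) b = even_fun b \<otimes>\<^bsub>A\<^esub> \<tau>" using c b by (simp add: superf_def)
    then show ?thesis using c b X_odd[OF b] by (simp add: val_simps val_\<tau> even_fun)
  qed
  have key: "X (even_fun a) = superf (\<lambda>m. 0) (\<lambda>m. - ?x m * val (P (even_fun a)) m)"
    and PC: "val (P (even_fun a)) \<in> C" "(\<lambda>m. - ?x m * val (P (even_fun a)) m) \<in> C" if a: "a \<in> C" for a
  proof -
    let ?p = "val (P (even_fun a))"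
    show p: "?p \<in> C" using c a by (intro val_C) auto
    have "(\<lambda>m. - 1 * ?x m * ?p m) \<in> C" by (intro C_mult C_cmult xC p)
    then show pC: "(\<lambda>m. - ?x m * ?p m) \<in> C" by simp
    \<comment> \<open>Q a has value 0, and its \<tau>-coefficient is the value of Q(Q a) = P
      a.\<close>
    have "Q (even_fun a) = superf (\<lambda>m. 0) ?p"
      using c a p C_zero Q_Q[of "even_fun a"]
      by (intro val_eqI) (simp_all add: superf_carrier val_superf val_Q_superf even_fun_Q)
    then have "val (X (Q (even_fun a))) m = ?p m * ?x m" for m using val_X_odd[OF p] by simp
    moreover have "val (X (Q (even_fun a))) m = - val (Q (X (even_fun a))) m" for m
      using null_field_Q[OF X, of "even_fun a"] c a by (simp add: val_simps)
    ultimately have "val (Q (X (even_fun a))) m = - ?x m * ?p m" for m by (metis minus_equation_iff mult.commute mult_minus_left)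
    moreover have "val (X (even_fun a)) m = 0" for m
      using val_odd derivationsD(4)[OF d even_fun(1)[OF a]] by simp
    ultimately show "X (even_fun a) = superf (\<lambda>m. 0) (\<lambda>m. - ?x m * ?p m)"
      using c a pC C_zero by (intro val_eqI) (simp_all add: superf_carrier val_superf val_Q_superf)
  qed
  show "a \<in> C \<Longrightarrow> X (even_fun a) = superf (\<lambda>m. 0) (\<lambda>m. - val (X \<tau>) m * val (P (even_fun a)) m)" by (rule key)
  assume a: "a \<in> C"
  have "commutator M X X (even_fun a) = X (X (even_fun a)) \<ominus>\<^bsub>A\<^esub> (-1) \<odot>\<^bsub>A\<^esub> X (X (even_fun a))"
    using commutator_homogeneous[OF d d] c a by (simp add: hcomm_apply)
  moreover have "val (X (X (even_fun a))) m = - ?x m * val (P (even_fun a)) m * ?x m" for m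
    unfolding key[OF a] by (rule val_X_odd[OF PC(2)[OF a]])
  ultimately show "down (commutator M X X) a = (\<lambda>m. - 2 * (?x m * ?x m) * val (P (even_fun a)) m)"
    using c a by (auto simp: down_def val_simps)
qed

text \<open>A field is determined by its action on \<tau> and on the even functions, and for an odd
  null field both are expressed through \<xi>.\<close>

lemma odd_null_field_zero:
  assumes X: "null_field 1 X" and \<xi>: "\<And>m. m \<in> pts \<Longrightarrow> val (X \<tau>) m = 0"
  shows "X = \<zero>\<^bsub>V\<^esub>"
proof -
  have d: "X \<in> D 1" using X by (simp add: null_field_def)
  note c = derivationsD(1)[OF d] \<tau>_carrier even_fun_carrier
  have \<xi>0: "val (X \<tau>) m = 0" for m using \<xi> val_outside by (cases "m \<in> pts") auto
  have "X \<tau> \<in> grade A 0" using derivationsD(4)[OF d \<tau>_odd] by simp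
  then have X\<tau>: "X \<tau> = \<zero>\<^bsub>A\<^esub>"
    using c \<xi>0 val_Q_even by (intro val_eqI) (simp_all add: val_simps)
  have Xe: "X (even_fun a) = \<zero>\<^bsub>A\<^esub>" if "a \<in> C" for a
    unfolding odd_null_field(1)[OF X that] using C_zero
    by (intro val_eqI) (simp_all add: \<xi>0 superf_carrier val_superf val_Q_superf val_simps)
  show ?thesis
  proof (rule Vect_eqI[OF D_Vect[OF d] Vect_zero_closed])
    fix f assume f: "f \<in> carrier A"
    have "X f = X (superf (val f) (val (Q f)))" using superf_val[OF f] by simp
    also have "\<dots> = \<zero>\<^bsub>A\<^esub>"
      using D_superf[OF val_C[OF f] val_Q_C[OF f] d] Xe[OF val_C[OF f]] Xe[OF val_Q_C[OF f]] X\<tau>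
        even_fun_carrier[OF val_Q_C[OF f]] \<tau>_carrier by simp
    finally show "X f = \<zero>\<^bsub>V\<^esub> f" using f by (simp add: V_zero)
  qed
qed

lemma odd_null_field_on_component:
  assumes X: "null_field 1 X" and K: "K \<in> connected_components_of (points M)" and m: "m \<in> K"
    and zero: "val (X \<tau>) m = 0" and m': "m' \<in> K"
  shows "val (X \<tau>) m' = 0"
proof -
  have d: "X \<in> D 1" using X by (simp add: null_field_def)
  let ?x = "val (X \<tau>)" and ?E = "commutator M X X"
  have xC: "?x \<in> C" using derivationsD(1)[OF d \<tau>_carrier] by (rule val_C)
  have E: "null_field 0 ?E" using null_field_commutator[OF X X] by simp
  have dE: "der (down ?E)" using G0.killing_def even_null_field(2)[OF E] by blast
  have "G0.flat_at (down ?E) m"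
    unfolding G0.flat_at_def
  proof (intro ballI conjI allI impI)
    fix a assume a: "a \<in> C"
    let ?p = "val (P (even_fun a))"
    have pC: "?p \<in> C" using a by (intro val_C P_closed even_fun_carrier)
    show "down ?E a m = 0" using odd_null_field(2)[OF X a] zero by simp
    fix Y assume Y: "der Y"
    \<comment> \<open>The factor \<xi>^2 is kept as two separate factors: after one derivation each
      term still contains \<xi>, which is 0 at m.\<close>
    have "down ?E a = (\<lambda>m. - 2 * (?x m * (?x m * ?p m)))"
      using odd_null_field(2)[OF X a] by (simp add: mult.assoc)
    then have "Y (down ?E a) = (\<lambda>m. - 2 * (Y ?x m * (?x m * ?p m) + ?x m * (Y ?x m * ?p m + ?x m * Y ?p m)))"
      by (simp only: der_cmult[OF Y C_mult[OF xC C_mult[OF xC pC]]] der_leibniz[OF Y xC C_mult[OF xC pC]]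
          der_leibniz[OF Y xC pC])
    then show "Y (down ?E a) m = 0" using zero by simp
  qed
  then have flat: "down ?E a m' = 0" if "a \<in> C" for a
    using G0.killing_flat_on_component[OF even_null_field(2)[OF E] K m _ m' that] by blast
  have "m' \<in> pts" using K m' connected_components_of_subset by blast
  \<comment> \<open>Where P f = 1, the reduced field applied to the value of f is -2 \<xi>^2, so its
    vanishing forces \<xi> = 0.\<close>
  then obtain f where f: "f \<in> grade A 0" "val (P f) m' = 1" by (rule P_nonvanishing)
  then have "down ?E (val f) m' = - 2 * (?x m' * ?x m')"
    using odd_null_field(2)[OF X val_C[OF A.grade_carrier[OF f(1)]]] by (simp add: even_fun_val)
  then show ?thesis using flat[OF val_C[OF A.grade_carrier[OF f(1)]]] by simp
qed

text \<open>Packages a finite set of linear functionals on all fields whose common kernel in the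
  super-null algebra consists of fields that are trivial over K. The sets of the components are
  later united.\<close>

definition functionals_testing :: "'p set \<Rightarrow> (('f \<Rightarrow> 'f) \<Rightarrow> real) set \<Rightarrow> bool" where
  "functionals_testing K L \<longleftrightarrow> finite L \<and>
    (\<forall>l \<in> L. \<forall>X \<in> carrier V. \<forall>Y \<in> carrier V. l (X \<oplus>\<^bsub>V\<^esub> Y) = l X + l Y) \<and>
    (\<forall>l \<in> L. \<forall>c. \<forall>X \<in> carrier V. l (c \<odot>\<^bsub>V\<^esub> X) = c * l X) \<and>
    (\<forall>X \<in> carrier N. (\<forall>l \<in> L. l X = 0) \<longrightarrow>
      (\<forall>m \<in> K. val (part 1 X \<tau>) m = 0 \<and> (\<forall>a \<in> C. down X a m = 0)))"

lemma component_functionals: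
  assumes K: "K \<in> connected_components_of (points M)"
  shows "\<exists>L. functionals_testing K L"
proof -
  obtain m where m: "m \<in> K" using nonempty_connected_components_of[OF K] by blast
  then have mp: "m \<in> pts" using K connected_components_of_subset by blast
  obtain A' B where AB: "finite A'" "A' \<subseteq> C" "finite B" "\<And>Y. Y \<in> B \<Longrightarrow> der Y"
    and test: "\<And>X. der X \<Longrightarrow> (\<And>a. a \<in> A' \<Longrightarrow> X a m = 0) \<Longrightarrow>
      (\<And>a Y. a \<in> A' \<Longrightarrow> Y \<in> B \<Longrightarrow> Y (X a) m = 0) \<Longrightarrow> G0.flat_at X m"
    by (rule G0.flat_at_finite_test[OF mp]) (rule that, assumption+, blast)
  \<comment> \<open>One functional for the odd part, the value of \<xi> at m, and finitely many for
    the 1-jet of the reduced even part. \<open>X \<tau>\<close> may replace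
    \<open>part 1 X \<tau>\<close>, since the even part maps \<tau> to an odd function, of value 0;
    this keeps linearity immediate.\<close>
  define L where "L = {\<lambda>X. val (X \<tau>) m} \<union> (\<lambda>a X. down X a m) ` A' \<union> (\<lambda>(a, Y) X. Y (down X a) m) ` (A' \<times> B)"
  have down_add: "down (X \<oplus>\<^bsub>V\<^esub> Y) a = (\<lambda>m. down X a m + down Y a m)"
    and down_smult: "down (c \<odot>\<^bsub>V\<^esub> X) a = (\<lambda>m. c * down X a m)"
    if "X \<in> carrier V" "Y \<in> carrier V" "a \<in> C" for X Y a c
    using that by (auto simp: down_def V_add V_smult val_simps even_fun_carrier VectD(1))
  have dC: "down X a \<in> C" if "X \<in> carrier V" "a \<in> C" for X a
    using der_closed[OF down_der[OF that(1)] that(2)] .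
  have AC: "a \<in> C" if "a \<in> A'" for a using that AB(2) by blast
  have "l (X \<oplus>\<^bsub>V\<^esub> Y) = l X + l Y" if "l \<in> L" "X \<in> carrier V" "Y \<in> carrier V" for l X Y
    using that \<tau>_carrier AC dC
    by (auto simp: L_def V_add val_simps VectD(1) down_add der_plus[OF AB(4)])
  moreover have "l (c \<odot>\<^bsub>V\<^esub> X) = c * l X" if "l \<in> L" "X \<in> carrier V" for l X c
    using that \<tau>_carrier AC dC
    by (auto simp: L_def V_smult val_simps VectD(1) down_smult der_cmult[OF AB(4)])
  moreover have "val (part 1 X \<tau>) m' = 0 \<and> (\<forall>a \<in> C. down X a m' = 0)"
    if X: "X \<in> carrier N" and l: "\<forall>l \<in> L. l X = 0" and m': "m' \<in> K" for X m'
  proof -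
    have XV: "X \<in> carrier V" and nf: "\<And>p. null_field p (part p X)" using X snull_iff by auto
    have "val (X \<tau>) m = 0" using l by (simp add: L_def)
    moreover have "X \<tau> = part 0 X \<tau> \<oplus>\<^bsub>A\<^esub> part 1 X \<tau>" using part_sum[OF XV] V_add \<tau>_carrier by metis
    moreover have "val (part 0 X \<tau>) m = 0"
      using val_odd derivationsD(4)[OF part_D[OF XV] \<tau>_odd, of 0] by simp
    ultimately have "val (part 1 X \<tau>) m = 0"
      using derivationsD(1)[OF part_D[OF XV] \<tau>_carrier] by (simp add: val_simps)
    from odd_null_field_on_component[OF nf K m this m'] have "val (part 1 X \<tau>) m' = 0" .
    moreover have "down X a m' = 0" if a: "a \<in> C" for a
    proof -
      have kill: "G0.killing (down (part 0 X))" by (rule even_null_field(2)[OF nf])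
      have "G0.flat_at (down (part 0 X)) m"
      proof (rule test)
        show "der (down (part 0 X))" using kill G0.killing_def by blast
        show "down (part 0 X) a m = 0" if "a \<in> A'" for a
          using l that down_part[OF XV AC[OF that]] by (auto simp: L_def)
        show "Y (down (part 0 X) a) m = 0" if "a \<in> A'" "Y \<in> B" for a Y
          using l that down_part[OF XV AC[OF that(1)]] by (force simp: L_def)
      qed
      from G0.killing_flat_on_component[OF kill K m this m' a] show ?thesis
        using down_part[OF XV a] by simp
    qed
    ultimately show ?thesis by blast
  qed
  moreover have "finite L" using AB by (simp add: L_def)
  ultimately have "functionals_testing K L" unfolding functionals_testing_def by blast
  then show ?thesis ..
qed

theorem snull_fin_dim:
  assumes fin: "finite (connected_components_of (points M))"
  shows "vectorspace.fin_dim real_ring N"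
proof -
  interpret N: super_vector_space N by (rule snull_super_vector_space)
  have "\<forall>K \<in> connected_components_of (points M). \<exists>L. functionals_testing K L"
    using component_functionals by blast
  then obtain L where L: "\<forall>K \<in> connected_components_of (points M). functionals_testing K (L K)"
    by (rule bchoice[THEN exE])
  note LD = L[unfolded functionals_testing_def, rule_format]
  let ?I = "\<Union>K \<in> connected_components_of (points M). L K"
  show ?thesis
  proof (rule N.fin_dim_of_separating_functionals[where I = ?I and l = "\<lambda>l. l"])
    show "finite ?I" using fin LD by simp
    show "l (X \<oplus>\<^bsub>N\<^esub> Y) = l X + l Y" if "l \<in> ?I" "X \<in> carrier N" "Y \<in> carrier N" for l X Y
      unfolding snull_simps(3) using that(1) LD snull_Vect[OF that(2)] snull_Vect[OF that(3)] by (elim UN_E) simp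
    show "l (c \<odot>\<^bsub>N\<^esub> X) = c * l X" if "l \<in> ?I" "X \<in> carrier N" for l X c
      unfolding snull_simps(4) using that(1) LD snull_Vect[OF that(2)] by (elim UN_E) simp
    fix X assume X: "X \<in> carrier N" and l: "\<And>l. l \<in> ?I \<Longrightarrow> l X = 0"
    have XV: "X \<in> carrier V" and nf: "\<And>p. null_field p (part p X)" using X snull_iff by auto
    have z: "val (part 1 X \<tau>) m = 0 \<and> (\<forall>a \<in> C. down X a m = 0)" if m: "m \<in> pts" for m
    proof -
      obtain K where K: "K \<in> connected_components_of (points M)" "m \<in> K"
        using m Union_connected_components_of[of "points M"] by blast
      have "\<forall>l \<in> L K. l X = 0" using l K(1) by blast
      then show ?thesis
        using LD[OF K(1)] X K(2) by simp
    qed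
    have "part 1 X = \<zero>\<^bsub>V\<^esub>" using odd_null_field_zero[OF nf] z by blast
    moreover have "part 0 X = \<zero>\<^bsub>V\<^esub>"
    proof -
      have d0: "down (part 0 X) a = (\<lambda>m. 0)" if a: "a \<in> C" for a
      proof
        fix m
        have "down X a \<in> C" using der_closed[OF down_der[OF XV] a] .
        then show "down (part 0 X) a m = 0"
          using z a C_outside unfolding down_part[OF XV a] by (cases "m \<in> pts") auto
      qed
      have "part 0 X = lift (\<lambda>a m. 0)"
        using even_null_field(1)[OF nf[of 0]] lift_cong[OF d0] by simp
      also have "\<dots> = \<zero>\<^bsub>V\<^esub>"
        by (intro Vect_eqI val_eqI)
          (simp_all add: lift_Vect der_zero Vect_closed lift_carrier V_zero val_lift val_Q_lift val_simps)
      finally show ?thesis .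
    qed
    ultimately show "X = \<zero>\<^bsub>N\<^esub>"
      using part_sum[OF XV] V_zero_simps(1) by (simp add: snull_simps(2))
  qed
qed

end

theorem corollary2p2:
  fixes M :: "('p, 'f) superspace"
    and g :: "('f \<Rightarrow> 'f) \<Rightarrow> ('f \<Rightarrow> 'f) \<Rightarrow> 'f"
    and Q P :: "'f \<Rightarrow> 'f"
  assumes "super_null_riemannian TYPE('n::finite) M g Q P"
    and "finite (connected_components_of (points M))"
  shows "lie_superalgebra (snull M g Q P) \<and>
         vectorspace.fin_dim real_ring (snull M g Q P)"
  using super_null_riemannian.snull_lie_superalgebra[OF assms(1)]
    super_null_riemannian.snull_fin_dim[OF assms] by blast

end
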